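(* The following statements hold. (1) For every $n\ge 1$ the monoids $2\mathfrak{Cob}_n$ and $\overline{2\mathfrak{Cob}_n}$ are non-finitely based. (2) For every $n\ge 2$ the monoids $2\mathfrak{Cob}^\circ_n$ and $\overline{2\mathfrak{Cob}^\circ_n}$ are non-finitely based. (3) For every $n\ge 2$ the monoids $\mathfrak{P}^{\mathrm d}_n$ and $\overline{\mathfrak{P}^{\mathrm d}_n}$ are non-finitely based.
   Context: Equational logic: let $X=\{x_1,x_2,\dots\}$ be a countably infinite set of letters and $X^+$ the free semigroup on $X$. A semigroup identity $u\bumpeq v$ is a pair $(u,v)\in X^+\times X^+$; it holds in a semigroup $\mathcal S$ if $u\varphi=v\varphi$ for every morphism $\varphi:X^+\to\mathcal S$. A semigroup (in particular, a monoid, considered as a semigroup) $\mathcal S$ is finitely based if there is a finite set $\Sigma$ of identities holding in $\mathcal S$ such that every identity holding in $\mathcal S$ holds in every semigroup satisfying all identities of $\Sigma$; otherwise $\mathcal S$ is non-finitely based. Partitions: $[n]=\{1,\dots,n\}$; a partition $\alpha:[n]\leadsto[n]$ is a set partition of $[n]\sqcup[n]$ (first copy: incoming vertices, second copy: outgoing vertices). For $\alpha,\beta:[n]\leadsto[n]$, let $(\alpha\cup\beta)^t$ be the partition of $[n]\sqcup[n]\sqcup[n]$ generated by $\alpha$ on the first two components and $\beta$ on the last two; the product $\alpha\beta$ is its restriction to the first and last components. A dead block is a block of $(\alpha\cup\beta)^t$ contained in the middle component; $\mathrm b(\alpha,\beta)$ is the number of dead blocks. Labels: given functions $g,h$ from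 the set of blocks of $\alpha$, respectively $\beta$, to $\mathbb Z$, a block $C$ of $(\alpha\cup\beta)^t$ that is the union of blocks $A_1,\dots,A_a$ of $\alpha$ and $B_1,\dots,B_b$ of $\beta$ and contains exactly $v$ elements of the middle component receives the label $\mathbf g(C)=\sum_i g(A_i)+\sum_j h(B_j)+v-(a+b)+1$; the label of a block of $\alpha\beta$ is the label of the block of $(\alpha\cup\beta)^t$ containing it. The monoids: - $\overline{2\mathfrak{Cob}_n}$ consists of all triples $(\alpha,g,s)$ with $\alpha:[n]\leadsto[n]$ a partition, $g$ a function from the blocks of $\alpha$ to $\mathbb Z$, and $s\in\bigoplus_{i\in\mathbb Z}\mathbb Z$; the product is $(\alpha,g,s)(\beta,h,t)=(\alpha\beta,\mathbf g,s+t+\mathbf b)$, where $\mathbf b=(b_i)_{i\in\mathbb Z}$ and $b_i$ is the number of dead blocks with label $i$. The monoid $2\mathfrak{Cob}_n$ (the local monoid at object $n$ of the category of 2-cobordisms, described by combinatorial data) is the submonoid of all triples with $g$ taking values in $\mathbb N_0$ and $s\in\bigoplus_{i\in\mathbb N_0}\mathbb N_0$. - $\overline{2\mathfrak{Cob}^\circ_n}$ and $2\mathfrak{Cob}^\circ_n$ are obtained from these by omitting the third component: pairs $(\alpha,g)$ with $g$ having values in $\mathbb Z$, respectively $\mathbb N_0$, and product $(\alpha,g)(\beta,h)=(\alpha\beta,\mathbf g)$. - $\overline{\mathfrak{P}^{\mathrm d}_n}$ (respectively $\mathfrak{P}^{\mathrm d}_n$) consists of all pairs $(\alpha,s)$ with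 $\alpha:[n]\leadsto[n]$ a partition and $s\in\mathbb Z$ (respectively $s\in\mathbb N_0$), with product $(\alpha,s)(\beta,t)=(\alpha\beta,s+t+\mathrm b(\alpha,\beta))$. *)

theory Defs
  imports "HOL-Algebra.Group" "HOL-Library.Disjoint_Sets" "HOL-Library.Countable_Set"
begin

section \<open>Semigroup identities and finite bases\<close>

text \<open>
  Semigroups are given by the \<open>carrier\<close> and \<open>mult\<close> fields of a monoid record; the
  field \<open>one\<close> plays no role.  This lets us regard a monoid as a semigroup without conversion
  and reuse \<^const>\<open>hom\<close>, which concerns the multiplication only.
\<close>

definition is_semigroup :: "('a, 'm) monoid_scheme \<Rightarrow> bool" where
  "is_semigroup S \<longleftrightarrow>
     (\<forall>x\<in>carrier S. \<forall>y\<in>carrier S. x \<otimes>\<^bsub>S\<^esub> y \<in> carrier S) \<and>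
     (\<forall>x\<in>carrier S. \<forall>y\<in>carrier S. \<forall>z\<in>carrier S.
        (x \<otimes>\<^bsub>S\<^esub> y) \<otimes>\<^bsub>S\<^esub> z = x \<otimes>\<^bsub>S\<^esub> (y \<otimes>\<^bsub>S\<^esub> z))"

text \<open>
  The free semigroup on the countably infinite alphabet \<open>nat\<close>: nonempty words only, so
  the value of \<open>one\<close> lies outside the carrier.
\<close>

definition free_semigroup :: "nat list monoid" where
  "free_semigroup = \<lparr>carrier = {w. w \<noteq> []}, mult = (@), one = []\<rparr>"

type_synonym sg_identity = "nat list \<times> nat list"

definition identities :: "sg_identity set" where
  "identities = carrier free_semigroup \<times> carrier free_semigroup"

definition holds_in :: "sg_identity \<Rightarrow> ('a, 'm) monoid_scheme \<Rightarrow> bool" where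
  "holds_in e S \<longleftrightarrow> (\<forall>\<phi>\<in>hom free_semigroup S. \<phi> (fst e) = \<phi> (snd e))"

text \<open>
  Semantic consequence.  A formula of HOL cannot quantify over the semigroups of all types, so the
  definition ranges over semigroups whose carrier is a set of natural numbers.  This loses
  nothing: by \<open>entails_holds_in\<close> below, a consequence in this sense holds in
  every semigroup, of whatever type, that satisfies all the identities in \<open>\<Sigma>\<close>.
\<close>

definition entails :: "sg_identity set \<Rightarrow> sg_identity \<Rightarrow> bool" where
  "entails \<Sigma> e \<longleftrightarrow>
     (\<forall>T :: nat monoid. is_semigroup T \<longrightarrow> (\<forall>d\<in>\<Sigma>. holds_in d T) \<longrightarrow> holds_in e T)"

definition finitely_based :: "('a, 'm) monoid_scheme \<Rightarrow> bool" where
  "finitely_based S \<longleftrightarrow>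
     (\<exists>\<Sigma>\<subseteq>identities. finite \<Sigma> \<and> (\<forall>d\<in>\<Sigma>. holds_in d S) \<and>
        (\<forall>e\<in>identities. holds_in e S \<longrightarrow> entails \<Sigma> e))"

lemma entails_holds_in:
  fixes T :: "('a, 'm) monoid_scheme"
  assumes ent: "entails \<Sigma> e" and "\<Sigma> \<subseteq> identities" and "e \<in> identities"
    and sg: "is_semigroup T" and sat: "\<forall>d\<in>\<Sigma>. holds_in d T"
  shows "holds_in e T"
  unfolding holds_in_def
proof
  fix \<phi> assume \<phi>: "\<phi> \<in> hom free_semigroup T"
  define R where "R = \<phi> ` {w. w \<noteq> []}"
  define f where "f = to_nat_on R"
  define k where "k = inv_into R f"
  define N where "N = \<lparr>carrier = f ` R, mult = (\<lambda>a b. f (k a \<otimes>\<^bsub>T\<^esub> k b)), one = 0\<rparr>"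
  have "countable R" by (simp add: R_def)
  then have inj: "inj_on f R" by (simp add: f_def inj_on_to_nat_on)
  have kf: "k (f x) = x" if "x \<in> R" for x
    using inj that by (simp add: k_def)
  have R_sub: "R \<subseteq> carrier T"
    using \<phi> by (auto simp: R_def hom_def free_semigroup_def)
  have R_closed: "x \<otimes>\<^bsub>T\<^esub> y \<in> R" if "x \<in> R" "y \<in> R" for x y
  proof -
    from \<open>x \<in> R\<close> obtain u where "u \<noteq> []" "x = \<phi> u"
      unfolding R_def by blast
    moreover from \<open>y \<in> R\<close> obtain v where "v \<noteq> []" "y = \<phi> v"
      unfolding R_def by blast
    ultimately have "x \<otimes>\<^bsub>T\<^esub> y = \<phi> (u @ v)"
      using \<phi> by (simp add: hom_def free_semigroup_def)
    then show ?thesis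
      using \<open>u \<noteq> []\<close> unfolding R_def by simp
  qed
  have assoc: "(x \<otimes>\<^bsub>T\<^esub> y) \<otimes>\<^bsub>T\<^esub> z = x \<otimes>\<^bsub>T\<^esub> (y \<otimes>\<^bsub>T\<^esub> z)" if "x \<in> R" "y \<in> R" "z \<in> R" for x y z
    using sg R_sub that unfolding is_semigroup_def by blast
  have sgN: "is_semigroup N"
    by (auto simp: is_semigroup_def N_def kf R_closed assoc)
  have satN: "holds_in d N" if d: "d \<in> \<Sigma>" for d
    unfolding holds_in_def
  proof
    fix \<psi> assume \<psi>: "\<psi> \<in> hom free_semigroup N"
    have mem: "\<psi> w \<in> f ` R" if "w \<noteq> []" for w
      using \<psi> that by (auto simp: hom_def free_semigroup_def N_def)
    have memk: "k (\<psi> w) \<in> R" if "w \<noteq> []" for w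
      using mem[OF that] kf by auto
    have "k (\<psi> (u @ v)) = k (\<psi> u) \<otimes>\<^bsub>T\<^esub> k (\<psi> v)" if "u \<noteq> []" "v \<noteq> []" for u v
    proof -
      have "\<psi> (u @ v) = f (k (\<psi> u) \<otimes>\<^bsub>T\<^esub> k (\<psi> v))"
        using \<psi> that by (simp add: hom_def free_semigroup_def N_def)
      then show ?thesis using memk R_closed kf that by simp
    qed
    then have "(\<lambda>w. k (\<psi> w)) \<in> hom free_semigroup T"
      using memk R_sub by (auto simp: hom_def free_semigroup_def)
    moreover have "\<forall>\<phi>\<in>hom free_semigroup T. \<phi> (fst d) = \<phi> (snd d)"
      using sat d unfolding holds_in_def by simp
    ultimately have eq: "k (\<psi> (fst d)) = k (\<psi> (snd d))"
      by (rule bspec[rotated])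
    have "fst d \<noteq> []" "snd d \<noteq> []"
      using assms(2) d by (auto simp: identities_def free_semigroup_def)
    then have "\<psi> (fst d) \<in> f ` R" "\<psi> (snd d) \<in> f ` R"
      using mem by simp_all
    then show "\<psi> (fst d) = \<psi> (snd d)"
      using eq inj by (auto simp: kf)
  qed
  have "\<phi> w \<in> R" if "w \<noteq> []" for w
    using that by (auto simp: R_def)
  then have "(\<lambda>w. f (\<phi> w)) \<in> hom free_semigroup N"
    using \<phi> by (simp add: hom_def free_semigroup_def N_def kf)
  moreover have "holds_in e N"
    using ent sgN satN unfolding entails_def by blast
  then have "\<forall>\<psi>\<in>hom free_semigroup N. \<psi> (fst e) = \<psi> (snd e)"
    unfolding holds_in_def .
  ultimately have "f (\<phi> (fst e)) = f (\<phi> (snd e))"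
    by (rule bspec[rotated])
  moreover have "\<phi> (fst e) \<in> R" "\<phi> (snd e) \<in> R"
    using assms(3) by (auto simp: R_def identities_def free_semigroup_def)
  ultimately show "\<phi> (fst e) = \<phi> (snd e)"
    using inj by (simp add: inj_on_eq_iff)
qed

section \<open>Partitions and their product\<close>

text \<open>
  The vertices \<open>Inl i\<close> are incoming, the vertices \<open>Inr i\<close> outgoing.  In the triple union,
  \<open>Inl i\<close>, \<open>Inr (Inl i)\<close> and \<open>Inr (Inr i)\<close> are the elements of the first, middle and
  last component.
\<close>

type_synonym vert = "nat + nat"
type_synonym vert3 = "nat + nat + nat"
type_synonym part = "vert set set"
type_synonym label = "vert set \<Rightarrow> int"

definition verts :: "nat \<Rightarrow> vert set" where
  "verts n = {1..n} <+> {1..n}"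

definition verts3 :: "nat \<Rightarrow> vert3 set" where
  "verts3 n = {1..n} <+> {1..n} <+> {1..n}"

definition middle :: "nat \<Rightarrow> vert3 set" where
  "middle n = (\<lambda>i. Inr (Inl i)) ` {1..n}"

definition parts :: "nat \<Rightarrow> part set" where
  "parts n = {\<alpha>. partition_on (verts n) \<alpha>}"

definition emb12 :: "vert \<Rightarrow> vert3" where
  "emb12 = case_sum Inl (\<lambda>i. Inr (Inl i))"

definition emb23 :: "vert \<Rightarrow> vert3" where
  "emb23 = case_sum (\<lambda>i. Inr (Inl i)) (\<lambda>i. Inr (Inr i))"

definition emb13 :: "vert \<Rightarrow> vert3" where
  "emb13 = case_sum Inl (\<lambda>i. Inr (Inr i))"

text \<open>
  The partition generated by both families of blocks.  The relation ``lying in a common block'' is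
  symmetric, and reflexive on \<open>verts3 n\<close>, so its transitive closure is an equivalence.
\<close>

definition join3 :: "nat \<Rightarrow> part \<Rightarrow> part \<Rightarrow> vert3 set set" where
  "join3 n \<alpha> \<beta> =
     verts3 n // (\<Union>B \<in> (`) emb12 ` \<alpha> \<union> (`) emb23 ` \<beta>. B \<times> B)\<^sup>+"

definition part_mult :: "nat \<Rightarrow> part \<Rightarrow> part \<Rightarrow> part" where
  "part_mult n \<alpha> \<beta> = (\<lambda>C. emb13 -` C) ` join3 n \<alpha> \<beta> - {{}}"

definition part_one :: "nat \<Rightarrow> part" where
  "part_one n = (\<lambda>i. {Inl i, Inr i}) ` {1..n}"

definition dead_blocks :: "nat \<Rightarrow> part \<Rightarrow> part \<Rightarrow> vert3 set set" where
  "dead_blocks n \<alpha> \<beta> = {C \<in> join3 n \<alpha> \<beta>. C \<subseteq> middle n}"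

section \<open>Labels\<close>

text \<open>A labelling of \<open>\<alpha>\<close> is a function on the blocks of \<open>\<alpha>\<close>, undefined elsewhere.\<close>

definition label3 ::
    "nat \<Rightarrow> part \<Rightarrow> label \<Rightarrow> part \<Rightarrow> label \<Rightarrow> vert3 set \<Rightarrow> int" where
  "label3 n \<alpha> g \<beta> h C =
     (let As = {A \<in> \<alpha>. emb12 ` A \<subseteq> C}; Bs = {B \<in> \<beta>. emb23 ` B \<subseteq> C} in
      (\<Sum>A\<in>As. g A) + (\<Sum>B\<in>Bs. h B) + int (card (C \<inter> middle n))
        - (int (card As) + int (card Bs)) + 1)"

definition label_mult ::
    "nat \<Rightarrow> part \<Rightarrow> label \<Rightarrow> part \<Rightarrow> label \<Rightarrow> label" where
  "label_mult n \<alpha> g \<beta> h =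
     (\<lambda>D\<in>part_mult n \<alpha> \<beta>. label3 n \<alpha> g \<beta> h (THE C. C \<in> join3 n \<alpha> \<beta> \<and> emb13 ` D \<subseteq> C))"

definition dead_count ::
    "nat \<Rightarrow> part \<Rightarrow> label \<Rightarrow> part \<Rightarrow> label \<Rightarrow> int \<Rightarrow> int" where
  "dead_count n \<alpha> g \<beta> h i = int (card {C \<in> dead_blocks n \<alpha> \<beta>. label3 n \<alpha> g \<beta> h C = i})"

section \<open>The monoids\<close>

text \<open>
  Elements of a direct sum of copies of the integers are functions of finite support.  The monoids
  over \<open>\<nat>\<^sub>0\<close> are submonoids: they share the multiplication and the unit of those over the
  integers, whose names end in \<open>bar\<close>.
\<close>

definition Cob_bar :: "nat \<Rightarrow> (part \<times> label \<times> (int \<Rightarrow> int)) monoid" where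
  "Cob_bar n = \<lparr>
     carrier = {(\<alpha>, g, s). \<alpha> \<in> parts n \<and> g \<in> \<alpha> \<rightarrow>\<^sub>E UNIV \<and> finite {i. s i \<noteq> 0}},
     mult = (\<lambda>(\<alpha>, g, s) (\<beta>, h, t).
       (part_mult n \<alpha> \<beta>, label_mult n \<alpha> g \<beta> h, \<lambda>i. s i + t i + dead_count n \<alpha> g \<beta> h i)),
     one = (part_one n, \<lambda>A\<in>part_one n. 0, \<lambda>i. 0)\<rparr>"

definition Cob :: "nat \<Rightarrow> (part \<times> label \<times> (int \<Rightarrow> int)) monoid" where
  "Cob n = (Cob_bar n)\<lparr>
     carrier := {(\<alpha>, g, s) \<in> carrier (Cob_bar n).
       (\<forall>A\<in>\<alpha>. 0 \<le> g A) \<and> (\<forall>i. 0 \<le> s i) \<and> (\<forall>i<0. s i = 0)}\<rparr>"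

definition Cobo_bar :: "nat \<Rightarrow> (part \<times> label) monoid" where
  "Cobo_bar n = \<lparr>
     carrier = {(\<alpha>, g). \<alpha> \<in> parts n \<and> g \<in> \<alpha> \<rightarrow>\<^sub>E UNIV},
     mult = (\<lambda>(\<alpha>, g) (\<beta>, h). (part_mult n \<alpha> \<beta>, label_mult n \<alpha> g \<beta> h)),
     one = (part_one n, \<lambda>A\<in>part_one n. 0)\<rparr>"

definition Cobo :: "nat \<Rightarrow> (part \<times> label) monoid" where
  "Cobo n = (Cobo_bar n)\<lparr>
     carrier := {(\<alpha>, g) \<in> carrier (Cobo_bar n). \<forall>A\<in>\<alpha>. 0 \<le> g A}\<rparr>"

definition Pd_bar :: "nat \<Rightarrow> (part \<times> int) monoid" where
  "Pd_bar n = \<lparr>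
     carrier = parts n \<times> UNIV,
     mult = (\<lambda>(\<alpha>, s) (\<beta>, t).
       (part_mult n \<alpha> \<beta>, s + t + int (card (dead_blocks n \<alpha> \<beta>)))),
     one = (part_one n, 0)\<rparr>"

definition Pd :: "nat \<Rightarrow> (part \<times> int) monoid" where
  "Pd n = (Pd_bar n)\<lparr>carrier := {(\<alpha>, s) \<in> carrier (Pd_bar n). 0 \<le> s}\<rparr>"

end

theory Submission
  imports "HOL-Library.Multiset" "HOL-Library.Ramsey" "HOL-Library.Sublist" Defs
begin

text \<open>
  Let \<open>S\<close> be one of the monoids.  Two facts about the identities of \<open>S\<close> are played off
  against each other.

  On the one hand, an identity \<open>u = v\<close> of \<open>S\<close> is rigid locally: \<open>u\<close> and \<open>v\<close>
  have the same content, and after deletion of any set of letters they still have the same first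
  letter, the same last letter and the same pairs of neighbours (\<open>u\<close> and \<open>v\<close> are
  \<^emph>\<open>equi-adjacent\<close>).  Deleting a letter means to substitute the unit.  The other letters
  are sent to partitions chosen so that a dead block, a dead block with a special label, or a loop that
  raises a label arises exactly where a letter \<open>x\<close> meets a letter \<open>y\<close>
  (\<open>equi_adjacent_if_holds_in_Cob\<close>, \<open>equi_adjacent_if_holds_in_Cobo\<close>,
  \<open>equi_adjacent_if_holds_in_Pd\<close>).

  On the other hand, if \<open>a\<close>, \<open>b\<close>, \<open>c\<close> lie over the same idempotent
  partition, then \<open>a b a c a = a c a b a\<close>.  The labels of a product over an idempotent
  depend only on the first and the last factor, on the factors as a multiset and on the multiset of
  neighbouring pairs of factors (\<open>label_interchange\<close>).  There are finitely many
  partitions of \<open>[n]\<close>, so for words over a finite alphabet all homomorphisms to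
  \<open>S\<close> can be watched at once by a finite colouring.  A Ramsey argument then finds in every
  recurrent infinite word a factor \<open>x y x z x\<close> such that \<open>x\<close>, \<open>y\<close>,
  \<open>z\<close> go to the same idempotent under each homomorphism
  (\<open>recurrent_monochromatic\<close>), and \<open>x y x z x = x z x y x\<close> holds in \<open>S\<close>.

  It remains to choose, for a given finite set \<open>\<Sigma>\<close> of identities of \<open>S\<close>, the
  infinite word such that \<open>\<Sigma>\<close> cannot rewrite its factors.  Let \<open>r\<close> exceed the
  number of letters of any identity in \<open>\<Sigma>\<close> by more than two.  The word used,
  \<open>selfsim r\<close>, is a fixed point of a substitution with blocks of length \<open>r\<close>:
  a letter knows its place in its block, and two neighbours inside a block determine the block.  By
  descent along the substitution, if \<open>u\<close>, \<open>v\<close> are equi-adjacent, \<open>u\<close> has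
  less than \<open>r - 2\<close> letters and a substitution maps \<open>u\<close> to a factor of the word,
  then it maps \<open>v\<close> to the same factor (\<open>equi_adjacent_image_selfsim\<close>).  Hence the
  semigroup of nonempty factors of \<open>x y x z x\<close> with a zero adjoined satisfies
  \<open>\<Sigma>\<close>.  It does not satisfy \<open>x y x z x = x z x y x\<close>, because the
  two sides are different words: the infinite word contains no square
  (\<open>not_finitely_based\<close>).
\<close>


section \<open>A self-similar square-free word\<close>

definition half :: "nat \<Rightarrow> nat \<Rightarrow> nat \<Rightarrow> nat" where
  "half r c a = (if even c then a mod r else a div r)"

text \<open>
  The infinite fixed point, starting with the letter \<open>0\<close>, of the substitution that sends a
  letter \<open>a < r * r\<close>, read as a pair of digits, to the block whose entry at place
  \<open>c\<close> is the pair of \<open>c\<close> and a digit of \<open>a\<close>: the low digit if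
  \<open>c\<close> is even, the high digit if \<open>c\<close> is odd.
\<close>

fun selfsim :: "nat \<Rightarrow> nat \<Rightarrow> nat" where
  "selfsim r p =
     (if p = 0 \<or> r < 2 then 0 else p mod r + r * half r (p mod r) (selfsim r (p div r)))"

declare selfsim.simps [simp del]

lemma selfsim_0 [simp]: "selfsim r 0 = 0"
  by (simp add: selfsim.simps)

lemma selfsim_eq:
  assumes "2 \<le> r"
  shows "selfsim r p = p mod r + r * half r (p mod r) (selfsim r (p div r))"
proof (cases "p = 0")
  case True then show ?thesis by (simp add: half_def)
next
  case False then show ?thesis using assms by (subst selfsim.simps) simp
qed

lemma selfsim_mod: "2 \<le> r \<Longrightarrow> selfsim r p mod r = p mod r"
  by (subst selfsim_eq) auto

lemma selfsim_div: "2 \<le> r \<Longrightarrow> selfsim r p div r = half r (p mod r) (selfsim r (p div r))"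
  by (subst selfsim_eq) auto

lemma selfsim_less:
  assumes "2 \<le> r"
  shows "selfsim r p < r * r"
proof (induction p rule: less_induct)
  case (less p)
  show ?case
  proof (cases "p = 0")
    case False
    with assms have "p div r < p" by simp
    from less[OF this] have "selfsim r (p div r) div r < r"
      by (simp add: less_mult_imp_div_less)
    then have "half r (p mod r) (selfsim r (p div r)) < r"
      using assms by (simp add: half_def)
    then have "selfsim r p div r < r"
      by (simp add: selfsim_div assms)
    then show ?thesis
      using assms by (simp add: div_less_iff_less_mult)
  qed (use assms in simp)
qed

text \<open>
  Recovers a letter from the entries at the places \<open>c\<close> and \<open>c + 1\<close> of its block.
  One of these places is even and shows the low digit, the other one is odd and shows the high digit.
\<close>

definition unhalf :: "nat \<Rightarrow> nat \<Rightarrow> nat \<Rightarrow> nat \<Rightarrow> nat" where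
  "unhalf r c a b = (if even c then a div r + r * (b div r) else b div r + r * (a div r))"

lemma unhalf_selfsim:
  assumes "2 \<le> r" "p mod r = c" "c + 1 < r"
  shows "unhalf r c (selfsim r p) (selfsim r (Suc p)) = selfsim r (p div r)"
proof -
  have "Suc p mod r = c + 1" "Suc p div r = p div r"
    using assms by (auto simp: mod_Suc div_Suc)
  then have "selfsim r p div r = half r c (selfsim r (p div r))"
    "selfsim r (Suc p) div r = half r (c + 1) (selfsim r (p div r))"
    using assms by (simp_all only: selfsim_div)
  then show ?thesis
    by (simp add: unhalf_def half_def)
qed

lemma selfsim_block_cong:
  assumes "2 \<le> r" "selfsim r m = selfsim r n" "c < r"
  shows "selfsim r (r * m + c) = selfsim r (r * n + c)"
  using assms by (simp add: selfsim_eq[of r "r * _ + c"])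

lemma selfsim_power_block_cong:
  assumes "2 \<le> r" "selfsim r a = selfsim r b"
  shows "q < r ^ m \<Longrightarrow> selfsim r (r ^ m * a + q) = selfsim r (r ^ m * b + q)"
proof (induction m arbitrary: q)
  case (Suc m)
  then have "q div r < r ^ m"
    by (simp add: less_mult_imp_div_less mult.commute)
  from Suc.IH[OF this] have "selfsim r (r * (r ^ m * a + q div r) + q mod r) =
      selfsim r (r * (r ^ m * b + q div r) + q mod r)"
    using assms by (intro selfsim_block_cong) auto
  then show ?case
    by (simp add: algebra_simps)
qed (use assms in simp)

text \<open>
  The block of a letter \<open>a\<close> begins with \<open>r * (a mod r)\<close>, a letter with low digit
  \<open>0\<close>, and so the block of that letter begins with \<open>0\<close>.  Hence every multiple of
  \<open>r * r\<close> carries the letter \<open>0\<close>.  From there the \<open>m\<close>-th iterate of the substitution repeats the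
  initial segment of length \<open>r ^ m\<close>.
\<close>

lemma selfsim_recurrent:
  assumes "2 \<le> r" "q < r ^ m"
  shows "selfsim r (r ^ m * (r * r * n) + q) = selfsim r q"
proof -
  have "selfsim r (r * n) mod r = 0"
    using assms by (simp add: selfsim_mod)
  then have "selfsim r (r * (r * n)) = 0"
    using assms by (subst selfsim_eq) (auto simp: half_def)
  then have "selfsim r (r * r * n) = selfsim r 0"
    by (simp add: mult.assoc)
  from selfsim_power_block_cong[OF assms(1) this assms(2)] show ?thesis
    by simp
qed

lemma ex_residue_ge:
  fixes c r i :: nat
  assumes "c < r"
  obtains p where "i \<le> p" "p < i + r" "p mod r = c"
proof -
  define p where "p = i + (c + r - i mod r) mod r"
  have "p mod r = (i mod r + (c + r - i mod r)) mod r"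
    unfolding p_def by (simp add: mod_simps)
  also have "i mod r + (c + r - i mod r) = c + r"
    using assms mod_less_divisor[of r i] by linarith
  finally have "p mod r = c" using assms by simp
  moreover have "i \<le> p" "p < i + r" using assms by (auto simp: p_def)
  ultimately show ?thesis using that by blast
qed

text \<open>
  Equal letters sit at positions that are congruent modulo \<open>r\<close>, so the period \<open>l\<close>
  of a square is a multiple of \<open>r\<close>.  Reading off the blocks from pairs of neighbours at a
  fixed place then gives a square of period \<open>l div r\<close> one level up.
\<close>

lemma selfsim_squarefree:
  assumes "3 \<le> r" "0 < l"
  shows "\<exists>k<l. selfsim r (i + k) \<noteq> selfsim r (i + l + k)"
  using assms(2)
proof (induction l arbitrary: i rule: less_induct)
  case (less l)
  have r: "2 \<le> r" using assms by simp
  show ?case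
  proof (rule ccontr)
    assume "\<not> ?thesis"
    then have eq: "selfsim r (i + k) = selfsim r (i + l + k)" if "k < l" for k
      using that by blast
    have "i mod r = (i + l) mod r"
      using eq[of 0] less.prems r by (metis add.right_neutral selfsim_mod)
    then have "r dvd l"
      by (metis add_diff_cancel_left' le_add1 mod_eq_dvd_iff_nat)
    then obtain l' where l': "l = r * l'" by blast
    with less.prems r have "0 < l'" "l' < l" by auto
    \<comment> \<open>The place \<open>c\<close> is chosen such that the pair \<open>c\<close>, \<open>c + 1\<close> is not cut by
        the start of the square.\<close>
    obtain c where c: "c + 1 < r" "i mod r \<noteq> c + 1"
    proof (cases "i mod r = 1")
      case True then show ?thesis using that[of 1] assms by simp
    next
      case False then show ?thesis using that[of 0] assms by simp
    qed
    then obtain p where p: "i \<le> p" "p < i + r" "p mod r = c"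
      using ex_residue_ge[of c r i] by auto
    have "p + 1 \<noteq> i + r"
    proof
      assume "p + 1 = i + r"
      then have "(p + 1) mod r = i mod r" by simp
      then show False using c p(3) by (simp add: mod_Suc)
    qed
    then have p': "p + 1 < i + r" using p by simp
    have "selfsim r (p div r + k) = selfsim r (p div r + l' + k)" if "k < l'" for k
    proof -
      define m where "m = p + r * k"
      have "r * k + r \<le> r * l'" using that by (metis Suc_leI mult_Suc_right add.commute mult_le_mono2)
      then have "m - i < l" "Suc m - i < l" "i \<le> m"
        using p p' by (auto simp: m_def l')
      then have "selfsim r m = selfsim r (m + l)" "selfsim r (Suc m) = selfsim r (Suc (m + l))"
        using eq[of "m - i"] eq[of "Suc m - i"] by (auto simp: algebra_simps)
      moreover have "m mod r = c" "(m + l) mod r = c" using p by (auto simp: m_def l')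
      ultimately have "selfsim r (m div r) = selfsim r ((m + l) div r)"
        using unhalf_selfsim[OF r] c by metis
      moreover have "m div r = p div r + k"
        using r by (simp add: m_def)
      moreover have "(m + l) div r = p div r + l' + k"
      proof -
        have "m + l = p + r * (l' + k)" by (simp add: m_def l' distrib_left)
        then show ?thesis using r by simp
      qed
      ultimately show ?thesis by simp
    qed
    with less.IH[OF \<open>l' < l\<close> \<open>0 < l'\<close>] show False by blast
  qed
qed

text \<open>
  Commuting words are powers of a common word, so their product would contain a square.
\<close>

lemma map_selfsim_no_commuting_factor:
  assumes "3 \<le> r" "s @ t = map (selfsim r) [i..<j]" "s \<noteq> []" "t \<noteq> []"
  shows "s @ t \<noteq> t @ s"
proof
  assume "s @ t = t @ s"
  then obtain m n z where z: "concat (replicate m z) = s" "concat (replicate n z) = t"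
    using comm_append_are_replicate by blast
  have "z \<noteq> []" "0 < m" "0 < n" using z assms by (auto intro: gr0I)
  then obtain m' n' where "m = Suc m'" "n = Suc n'" by (metis gr0_implies_Suc)
  have "s @ t = concat (replicate (m + n) z)"
    by (simp add: replicate_add flip: z)
  moreover have "m + n = Suc (Suc (m' + n'))"
    using \<open>m = Suc m'\<close> \<open>n = Suc n'\<close> by simp
  ultimately have "s @ t = z @ z @ concat (replicate (m' + n') z)"
    by simp
  then have w: "map (selfsim r) [i..<j] = z @ z @ concat (replicate (m' + n') z)"
    (is "_ = _ @ _ @ ?y") using assms by simp
  have "selfsim r (i + k) = selfsim r (i + length z + k)" if "k < length z" for k
  proof -
    have "j - i = length (z @ z @ ?y)" by (metis w length_map length_upt)
    then have "i + length z + k < j" using that by simp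
    moreover have "map (selfsim r) [i..<j] ! k = map (selfsim r) [i..<j] ! (length z + k)"
      unfolding w using that by (simp add: nth_append)
    ultimately show ?thesis by (simp add: add.assoc)
  qed
  then show False using selfsim_squarefree[OF assms(1), of "length z" i] \<open>z \<noteq> []\<close> by blast
qed

section \<open>Words with the same neighbours under all deletions\<close>

definition adj :: "'a list \<Rightarrow> ('a \<times> 'a) set" where
  "adj w = {(x, y). \<exists>a b. w = a @ x # y # b}"

text \<open>
  The marks \<open>None\<close> at both ends turn statements about first and last letters into
  statements about neighbours.
\<close>

definition framed :: "'a list \<Rightarrow> 'a option list" where
  "framed w = None # map Some w @ [None]"

text \<open>
  What the substitutions of the unit and of a few simple partitions reveal about a word.
\<close>

definition equi_adjacent :: "'a list \<Rightarrow> 'a list \<Rightarrow> bool" where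
  "equi_adjacent u v \<longleftrightarrow> mset u = mset v \<and>
     (\<forall>K. adj (framed (filter K u)) = adj (framed (filter K v)))"

lemma equi_adjacent_filter: "equi_adjacent u v \<Longrightarrow> equi_adjacent (filter K u) (filter K v)"
  by (simp add: equi_adjacent_def)

lemma equi_adjacent_set: "equi_adjacent u v \<Longrightarrow> set u = set v"
  unfolding equi_adjacent_def by (metis set_mset_mset)

lemma framed_append_eqD:
  assumes "framed w = p @ q" "p \<noteq> []" "q \<noteq> []"
  obtains s t where "w = s @ t" "p = None # map Some s" "q = map Some t @ [None]"
proof -
  obtain p' where p': "p = None # p'" "map Some w @ [None] = p' @ q"
    using assms by (auto simp: framed_def Cons_eq_append_conv)
  obtain q' where q': "q = q' @ [None]" "map Some w = p' @ q'"
    using p'(2) assms(3) by (cases q rule: rev_cases) auto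
  then obtain s t where "w = s @ t" "p' = map Some s" "q' = map Some t"
    by (auto simp: map_eq_append_conv)
  with that p' q' show ?thesis by blast
qed

lemma framed_infix_SomeD:
  assumes "framed w = a @ x # m @ y # b"
  shows "None \<notin> set m"
proof -
  have "framed w = (a @ [x]) @ (m @ y # b)" using assms by simp
  then obtain s t where st: "w = s @ t" "m @ y # b = map Some t @ [None]"
    by (rule framed_append_eqD) auto
  then have "butlast (m @ y # b) = map Some t" by simp
  then show ?thesis by (auto simp: butlast_append dest!: arg_cong[of _ _ set])
qed

lemma filter_eq_append_ConsD:
  assumes "filter P w = A @ x # B"
  obtains a b where "w = a @ x # b" "P x" "filter P a = A" "filter P b = B"
  using assms
proof (induction A arbitrary: w thesis)
  case Nil
  then obtain us vs where "w = us @ x # vs" "\<forall>u\<in>set us. \<not> P u" "P x" "B = filter P vs"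
    by (auto dest: filter_eq_ConsD)
  then show ?case using Nil(1)[of us vs] by (simp add: filter_empty_conv)
next
  case (Cons c A)
  then obtain us vs where w: "w = us @ c # vs" "\<forall>u\<in>set us. \<not> P u" "P c" "A @ x # B = filter P vs"
    by (auto dest: filter_eq_ConsD)
  from w(4)[symmetric] obtain a b where "vs = a @ x # b" "P x" "filter P a = A" "filter P b = B"
    by (rule Cons.IH[rotated])
  then show ?case using Cons.prems(1)[of "us @ c # a" b] w by simp
qed

lemma framed_filter: "framed (filter K w) = filter (case_option True K) (framed w)"
  by (simp add: framed_def filter_map o_def)

text \<open>
  The neighbours \<open>x\<close>, \<open>y\<close> that remain when the letters of \<open>m\<close> are
  deleted from \<open>v\<close> must be neighbours in \<open>u\<close> after the same deletion.
\<close>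

lemma equi_adjacent_infix:
  assumes "equi_adjacent u v" "framed v = a @ x # m @ y # b" "x \<notin> set m" "y \<notin> set m"
  obtains a' m' b' where "framed u = a' @ x # m' @ y # b'" "set m' \<subseteq> set m"
proof -
  define K where "K z = (Some z \<notin> set m)" for z
  define P where "P = case_option True K"
  have None: "None \<notin> set m" using framed_infix_SomeD[OF assms(2)] .
  have P: "P z \<longleftrightarrow> z \<notin> set m" for z
    using None by (cases z) (auto simp: P_def K_def)
  have "framed (filter K v) = filter P a @ x # y # filter P b"
    using assms(2-4) by (simp add: framed_filter flip: P_def) (simp add: P filter_False)
  then have "(x, y) \<in> adj (framed (filter K v))"
    unfolding adj_def by blast
  then have "(x, y) \<in> adj (framed (filter K u))"
    using assms(1) by (simp add: equi_adjacent_def)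
  then obtain A B where "filter P (framed u) = A @ x # y # B"
    unfolding adj_def framed_filter P_def by blast
  then obtain a' c where 1: "framed u = a' @ x # c" "filter P c = y # B"
    by (rule filter_eq_append_ConsD)
  from 1(2) obtain m' b' where 2: "c = m' @ y # b'" "filter P m' = []"
    by (rule filter_eq_append_ConsD[of P c "[]", simplified]) auto
  then have "set m' \<subseteq> set m" using P by (auto simp: filter_empty_conv)
  with 1 2 that show ?thesis by simp
qed

section \<open>Equi-adjacent words with an image in the self-similar word\<close>

definition offset :: "('a \<Rightarrow> 'b list) \<Rightarrow> 'a option list \<Rightarrow> nat" where
  "offset \<theta> w = length (concat (map (case_option [] \<theta>) w))"

lemma offset_simps [simp]:
  "offset \<theta> [] = 0"
  "offset \<theta> (x # w) = length (case_option [] \<theta> x) + offset \<theta> w"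
  "offset \<theta> (u @ v) = offset \<theta> u + offset \<theta> v"
  "offset \<theta> (map Some s) = length (concat (map \<theta> s))"
  by (auto simp: offset_def o_def)

text \<open>
  The residue modulo \<open>r\<close> of the position in the infinite word at which an occurrence of
  \<open>x\<close> starts.  It is the same for all occurrences of \<open>x\<close>, because the first letter
  of the image knows it.  The final mark starts at \<open>j\<close>, where the image of the whole word
  ends.
\<close>

definition start_res :: "nat \<Rightarrow> (nat \<Rightarrow> nat list) \<Rightarrow> nat \<Rightarrow> nat option \<Rightarrow> nat" where
  "start_res r \<theta> j x = (case x of None \<Rightarrow> j | Some z \<Rightarrow> hd (\<theta> z)) mod r"

definition end_res :: "nat \<Rightarrow> (nat \<Rightarrow> nat list) \<Rightarrow> nat \<Rightarrow> nat option \<Rightarrow> nat" where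
  "end_res r \<theta> i x = (case x of None \<Rightarrow> i | Some z \<Rightarrow> hd (\<theta> z) + length (\<theta> z)) mod r"

text \<open>
  All boundaries between neighbours in the framed word, placed at \<open>i\<close>, have the residues
  prescribed by the letters on both sides.
\<close>

definition fits :: "nat \<Rightarrow> (nat \<Rightarrow> nat list) \<Rightarrow> nat \<Rightarrow> nat \<Rightarrow> nat list \<Rightarrow> bool" where
  "fits r \<theta> i j w \<longleftrightarrow> (\<forall>p q. framed w = p @ q \<longrightarrow> p \<noteq> [] \<longrightarrow> q \<noteq> [] \<longrightarrow>
     (i + offset \<theta> p) mod r = start_res r \<theta> j (hd q) \<and>
     (i + offset \<theta> p) mod r = end_res r \<theta> i (last p))"

lemma fitsD:
  assumes "fits r \<theta> i j w" "framed w = p @ q" "p \<noteq> []" "q \<noteq> []"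
  shows "(i + offset \<theta> p) mod r = start_res r \<theta> j (hd q)"
    and "(i + offset \<theta> p) mod r = end_res r \<theta> i (last p)"
  using assms unfolding fits_def by blast+

lemma image_nth:
  assumes "concat (map \<theta> w) = map X [i..<j]" "w = s @ z # t" "k < length (\<theta> z)"
  shows "\<theta> z ! k = X (i + length (concat (map \<theta> s)) + k)"
    and "i + length (concat (map \<theta> s)) + k < j"
proof -
  let ?l = "length (concat (map \<theta> s))"
  have "length (concat (map \<theta> w)) = j - i" using assms(1) by simp
  then show *: "i + ?l + k < j" using assms(2,3) by simp
  have "\<theta> z ! k = concat (map \<theta> w) ! (?l + k)"
    using assms(2,3) by (simp add: nth_append)
  also have "\<dots> = X (i + (?l + k))"
    unfolding assms(1) using * by (subst nth_map) auto
  finally show "\<theta> z ! k = X (i + ?l + k)" by (simp add: add.assoc)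
qed

lemma fits_image_selfsim:
  assumes "2 \<le> r" "concat (map \<theta> w) = map (selfsim r) [i..<j]" "i \<le> j"
    and ne: "\<And>x. x \<in> set w \<Longrightarrow> \<theta> x \<noteq> []"
  shows "fits r \<theta> i j w"
  unfolding fits_def
proof (intro allI impI)
  fix p q assume pq: "framed w = p @ q" "p \<noteq> []" "q \<noteq> []"
  obtain s t where st: "w = s @ t" "p = None # map Some s" "q = map Some t @ [None]"
    by (rule framed_append_eqD[OF pq])
  have head: "hd (\<theta> z) mod r = (i + length (concat (map \<theta> s'))) mod r" if "w = s' @ z # t'" for s' z t'
  proof -
    have "\<theta> z \<noteq> []" using ne that by simp
    then have "hd (\<theta> z) = selfsim r (i + length (concat (map \<theta> s')))"
      using image_nth(1)[OF assms(2) that, of 0] by (simp add: hd_conv_nth)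
    then show ?thesis using assms by (simp add: selfsim_mod)
  qed
  have len: "i + length (concat (map \<theta> w)) = j" using assms by simp
  have 1: "(i + offset \<theta> p) mod r = start_res r \<theta> j (hd q)"
  proof (cases t)
    case Nil then show ?thesis using st len by (simp add: start_res_def)
  next
    case (Cons z t') then show ?thesis using st head[of s z t'] by (simp add: start_res_def)
  qed
  have 2: "(i + offset \<theta> p) mod r = end_res r \<theta> i (last p)"
  proof (cases s rule: rev_cases)
    case Nil then show ?thesis using st by (simp add: end_res_def)
  next
    case (snoc s' z)
    then have "hd (\<theta> z) mod r = (i + length (concat (map \<theta> s'))) mod r"
      using st head[of s' z t] by simp
    then have "(hd (\<theta> z) + length (\<theta> z)) mod r = (i + length (concat (map \<theta> s')) + length (\<theta> z)) mod r"
      by (rule mod_add_cong) simp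
    then show ?thesis using st snoc by (simp add: end_res_def add.assoc)
  qed
  from 1 2 show "(i + offset \<theta> p) mod r = start_res r \<theta> j (hd q) \<and>
     (i + offset \<theta> p) mod r = end_res r \<theta> i (last p)" ..
qed

text \<open>
  The condition links each letter to the next one only, so it is inherited by words with no new pairs
  of neighbours.
\<close>

lemma fits_adj:
  assumes "fits r \<theta> i j u" "adj (framed v) \<subseteq> adj (framed u)"
  shows "fits r \<theta> i j v"
  unfolding fits_def
proof (intro allI impI)
  fix p q assume pq: "framed v = p @ q" "p \<noteq> []" "q \<noteq> []"
  have link: "end_res r \<theta> i (last p) = start_res r \<theta> j (hd q)" if pq: "framed v = p @ q" "p \<noteq> []" "q \<noteq> []" for p q
  proof -
    have "framed v = butlast p @ last p # hd q # tl q" using pq by simp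
    then have "(last p, hd q) \<in> adj (framed u)" using assms(2) unfolding adj_def by blast
    then obtain a b where "framed u = (a @ [last p]) @ (hd q # b)" by (auto simp: adj_def)
    from fitsD[OF assms(1) this] show ?thesis by simp
  qed
  from pq have "(i + offset \<theta> p) mod r = end_res r \<theta> i (last p)"
  proof (induction p arbitrary: q rule: rev_induct)
    case (snoc x p)
    show ?case
    proof (cases "p = []")
      case True
      then show ?thesis using snoc.prems by (auto simp: framed_def end_res_def)
    next
      case False
      have "framed v = p @ (x # q)" using snoc.prems by simp
      from snoc.IH[OF this False] link[OF this False]
      have *: "(i + offset \<theta> p) mod r = start_res r \<theta> j x" by simp
      have "x \<noteq> None"
      proof -
        have "framed v = (p @ [x]) @ q" using snoc.prems by simp
        then show ?thesis by (rule framed_append_eqD) (use snoc.prems False in \<open>auto simp: append_eq_Cons_conv append_eq_map_conv\<close>)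
      qed
      then obtain z where z: "x = Some z" by blast
      with * have "(i + offset \<theta> p) mod r = hd (\<theta> z) mod r" by (simp add: start_res_def)
      then have "(i + offset \<theta> p + length (\<theta> z)) mod r = (hd (\<theta> z) + length (\<theta> z)) mod r"
        by (rule mod_add_cong) simp
      then show ?thesis using z by (simp add: end_res_def add.assoc)
    qed
  qed simp
  with link[OF pq] show "(i + offset \<theta> p) mod r = start_res r \<theta> j (hd q) \<and>
     (i + offset \<theta> p) mod r = end_res r \<theta> i (last p)" by simp
qed

lemma block_eq:
  fixes r :: nat
  assumes "x mod r = y mod r" "r * n \<le> x" "x < r * n + r" "r * n \<le> y" "y < r * n + r"
  shows "x = y"
proof -
  have "x div r = n" "y div r = n"
    using assms by (auto intro!: div_nat_eqI simp: mult.commute)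
  with assms(1) show ?thesis by (metis div_mult_mod_eq)
qed

lemma block_mod:
  fixes r :: nat
  assumes "r * n \<le> x" "x < r * n + r"
  shows "x mod r = x - r * n"
proof -
  obtain d where "x = r * n + d" using assms(1) le_Suc_ex by blast
  with assms show ?thesis by simp
qed

text \<open>
  If in \<open>v\<close> only short letters lie between \<open>x\<close> and \<open>y\<close>, all inside
  one block, then \<open>x\<close> and \<open>y\<close> occur in \<open>u\<close> in the same relative position.
  Inside a block all boundaries have different residues, so \<open>x\<close> and \<open>y\<close> differ from
  the letters of \<open>m\<close>, and deleting these from \<open>u\<close> as well as from \<open>v\<close> makes
  \<open>x\<close> and \<open>y\<close> neighbours.  In \<open>u\<close> the letters between them belong to
  \<open>m\<close>; by their residues, a run of such letters cannot leave the block before it arrives at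
  the residue where \<open>y\<close> starts.
\<close>

lemma equi_adjacent_gap:
  assumes comp: "equi_adjacent u v" and fit: "fits r \<theta> i j u" "fits r \<theta> i j v"
    and ne: "\<And>z. z \<in> set u \<Longrightarrow> \<theta> z \<noteq> []"
    and v: "framed v = a @ x # m @ y # b"
    and e: "e = i + offset \<theta> (a @ [x])" "r * n \<le> e" "e + offset \<theta> m < r * n + r"
  obtains a' m' b' n' where "framed u = a' @ x # m' @ y # b'" "offset \<theta> m' = offset \<theta> m"
    "i + offset \<theta> (a' @ [x]) = r * n' + (e - r * n)"
proof -
  define t where "t = e + offset \<theta> m - r * n"
  have t: "t < r" "e + offset \<theta> m = r * n + t" using e by (auto simp: t_def)
  have y: "start_res r \<theta> j y = t"
  proof -
    have "(e + offset \<theta> m) mod r = t" using t by simp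
    then show ?thesis using fitsD(1)[OF fit(2), of "(a @ [x]) @ m" "y # b"] v e(1) by (simp add: add.assoc)
  qed
  have x: "end_res r \<theta> i x = e - r * n"
  proof -
    have "e mod r = end_res r \<theta> i x"
      using fitsD(2)[OF fit(2), of "a @ [x]" "m @ y # b"] v e(1) by auto
    moreover have "e mod r = e - r * n"
      using e by (intro block_mod) auto
    ultimately show ?thesis by simp
  qed
  have inner: "start_res r \<theta> j (Some z) + length (\<theta> z) \<le> t" "start_res r \<theta> j (Some z) < t"
      "end_res r \<theta> i (Some z) \<noteq> e - r * n" if zm: "Some z \<in> set m" for z
  proof -
    obtain m1 m2 where m: "m = m1 @ Some z # m2" using split_list[OF zm] by blast
    have "None \<notin> set m" by (rule framed_infix_SomeD[OF v])
    have "Some z \<in> set (framed v)" using v zm by simp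
    then have "z \<in> set v" by (auto simp: framed_def)
    then have pos: "0 < length (\<theta> z)" using ne equi_adjacent_set[OF comp] by simp
    have le: "e + offset \<theta> m1 + length (\<theta> z) \<le> r * n + t" using t m by simp
    have "start_res r \<theta> j (Some z) = (e + offset \<theta> m1) mod r"
      using fitsD(1)[OF fit(2), of "(a @ [x]) @ m1" "Some z # m2 @ y # b"] v e m by (simp add: add.assoc)
    also have "\<dots> = e + offset \<theta> m1 - r * n"
      using le t e by (intro block_mod) auto
    finally have s: "start_res r \<theta> j (Some z) = e + offset \<theta> m1 - r * n" .
    show "start_res r \<theta> j (Some z) + length (\<theta> z) \<le> t" "start_res r \<theta> j (Some z) < t"
      unfolding s using le e pos by linarith+
    have "end_res r \<theta> i (Some z) = (e + offset \<theta> m1 + length (\<theta> z)) mod r"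
      using fitsD(2)[OF fit(2), of "(a @ [x]) @ m1 @ [Some z]" "m2 @ y # b"] v e m by (simp add: add.assoc)
    also have "\<dots> = e + offset \<theta> m1 + length (\<theta> z) - r * n"
      using le t e by (intro block_mod) auto
    finally show "end_res r \<theta> i (Some z) \<noteq> e - r * n" using pos e(2) by linarith
  qed
  have None: "None \<notin> set m" by (rule framed_infix_SomeD[OF v])
  have "x \<notin> set m" using inner(3) x None by (cases x) auto
  moreover have "y \<notin> set m" using inner(2) y None by (cases y) auto
  ultimately obtain a' m' b' where u: "framed u = a' @ x # m' @ y # b'" "set m' \<subseteq> set m"
    by (rule equi_adjacent_infix[OF comp v])
  define e' n' where "e' = i + offset \<theta> (a' @ [x])" and "n' = e' div r"
  have e': "e' = r * n' + (e - r * n)"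
  proof -
    have "e' mod r = e - r * n"
      using fitsD(2)[OF fit(1), of "a' @ [x]" "m' @ y # b'"] u x by (auto simp: e'_def)
    then show ?thesis unfolding n'_def by (metis mult_div_mod_eq)
  qed
  have e'_ge: "r * n' \<le> e'" using e' by simp
  have "e' + offset \<theta> p \<le> r * n' + t" if "m' = p @ q" for p q
    using that
  proof (induction p arbitrary: q rule: rev_induct)
    case Nil then show ?case using e' t by simp
  next
    case (snoc w p)
    then have "w \<in> set m" using u(2) by auto
    then obtain z where z: "w = Some z" using None by (metis option.exhaust)
    have le: "e' + offset \<theta> p \<le> r * n' + t" using snoc by simp
    have res: "(e' + offset \<theta> p) mod r = start_res r \<theta> j (Some z)"
      using fitsD(1)[OF fit(1), of "(a' @ [x]) @ p" "w # q @ y # b'"] u snoc.prems z by (simp add: e'_def add.assoc)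
    have "e' + offset \<theta> p = r * n' + start_res r \<theta> j (Some z)"
    proof (rule block_eq[where n = n' and r = r])
      show "r * n' \<le> e' + offset \<theta> p" using e'_ge by linarith
      show "e' + offset \<theta> p < r * n' + r" using t(1) le by linarith
      show "r * n' + start_res r \<theta> j (Some z) < r * n' + r"
        using inner(2)[of z] z \<open>w \<in> set m\<close> t(1) by simp
    qed (use res in \<open>simp_all add: start_res_def\<close>)
    then show ?case using inner(1)[of z] z \<open>w \<in> set m\<close> by simp
  qed
  then have "e' + offset \<theta> m' \<le> r * n' + t" by simp
  moreover have "(e' + offset \<theta> m') mod r = t"
    using fitsD(1)[OF fit(1), of "(a' @ [x]) @ m'" "y # b'"] u y by (simp add: e'_def add.assoc)
  ultimately have "e' + offset \<theta> m' = r * n' + t"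
    using block_eq[of "e' + offset \<theta> m'" r "r * n' + t" n'] t(1) e'_ge by auto
  then have "offset \<theta> m' = offset \<theta> m" using e' t e by linarith
  with that[OF u(1)] e' show ?thesis unfolding e'_def by blast
qed

lemma concat_map_cover:
  assumes "k < length (concat (map \<theta> w))"
  obtains s z t where "w = s @ z # t" "length (concat (map \<theta> s)) \<le> k"
    "k < length (concat (map \<theta> s)) + length (\<theta> z)"
    "concat (map \<theta> w) ! k = \<theta> z ! (k - length (concat (map \<theta> s)))"
  using assms
proof (induction w arbitrary: k thesis)
  case (Cons a w)
  show ?case
  proof (cases "k < length (\<theta> a)")
    case True
    then show ?thesis using Cons.prems(1)[of "[]" a w] by (simp add: nth_append)
  next
    case False
    with Cons.prems(2) have "k - length (\<theta> a) < length (concat (map \<theta> w))" by simp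
    then obtain s z t where "w = s @ z # t" "length (concat (map \<theta> s)) \<le> k - length (\<theta> a)"
      "k - length (\<theta> a) < length (concat (map \<theta> s)) + length (\<theta> z)"
      "concat (map \<theta> w) ! (k - length (\<theta> a)) = \<theta> z ! (k - length (\<theta> a) - length (concat (map \<theta> s)))"
      using Cons.IH by blast
    then show ?thesis using Cons.prems(1)[of "a # s" z t] False by (simp add: nth_append)
  qed
qed simp

text \<open>
  The image of \<open>z\<close> one level up: the blocks whose entries at the places \<open>c\<close> and
  \<open>c + 1\<close> belong to the image of \<open>z\<close>.
\<close>

definition contract :: "nat \<Rightarrow> nat \<Rightarrow> (nat \<Rightarrow> nat list) \<Rightarrow> nat \<Rightarrow> nat list" where
  "contract r c \<theta> z = map (\<lambda>k. unhalf r c (\<theta> z ! k) (\<theta> z ! Suc k))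
     (filter (\<lambda>k. (hd (\<theta> z) + k) mod r = c) [0..<length (\<theta> z)])"

text \<open>
  If no boundary between letters separates the places \<open>c\<close> and \<open>c + 1\<close> of a block,
  then each such pair belongs to the image of a single letter, so contraction is compatible with
  concatenation.
\<close>

lemma contract_image:
  assumes fit: "fits r \<theta> i j w" and c: "c + 1 < r"
    and ne: "\<And>z. z \<in> set w \<Longrightarrow> start_res r \<theta> j (Some z) \<noteq> c + 1 \<and> end_res r \<theta> i (Some z) \<noteq> c + 1"
  shows "concat (map (contract r c \<theta>) w) =
    map (\<lambda>p. unhalf r c (concat (map \<theta> w) ! (p - i)) (concat (map \<theta> w) ! (Suc p - i)))
      (filter (\<lambda>p. p mod r = c) [i..<i + length (concat (map \<theta> w))])"
proof -
  define X where "X = concat (map \<theta> w)"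
  have "concat (map (contract r c \<theta>) s) =
    map (\<lambda>p. unhalf r c (X ! (p - i)) (X ! (Suc p - i)))
      (filter (\<lambda>p. p mod r = c) [i..<i + length (concat (map \<theta> s))])" if "w = s @ t" for s t
    using that
  proof (induction s arbitrary: t rule: rev_induct)
    case (snoc z s)
    define l where "l = length (concat (map \<theta> s))"
    have z: "z \<in> set w" using snoc.prems by simp
    have f: "framed w = (None # map Some s) @ (Some z # map Some t @ [None])"
      using snoc.prems by (simp add: framed_def)
    have start: "(i + l) mod r = hd (\<theta> z) mod r"
      using fitsD(1)[OF fit f] by (simp add: start_res_def l_def)
    have X: "X ! (l + k) = \<theta> z ! k" if "k < length (\<theta> z)" for k
      using that snoc.prems by (simp add: X_def l_def nth_append)
    have "[i..<i + length (concat (map \<theta> (s @ [z])))] = [i..<i + l] @ map (\<lambda>k. i + l + k) [0..<length (\<theta> z)]"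
    proof -
      have "map (\<lambda>k. i + l + k) [0..<length (\<theta> z)] = [i + l..<i + l + length (\<theta> z)]"
        using map_add_upt[of "i + l" "length (\<theta> z)"] by (simp add: add.commute)
      moreover have "[i..<i + l + length (\<theta> z)] = [i..<i + l] @ [i + l..<i + l + length (\<theta> z)]"
        using upt_add_eq_append[of i "i + l"] by simp
      ultimately show ?thesis by (simp add: l_def add.assoc)
    qed
    moreover have "map (\<lambda>p. unhalf r c (X ! (p - i)) (X ! (Suc p - i)))
        (filter (\<lambda>p. p mod r = c) (map (\<lambda>k. i + l + k) [0..<length (\<theta> z)])) = contract r c \<theta> z"
    proof -
      have res: "(i + l + k) mod r = (hd (\<theta> z) + k) mod r" for k
        by (rule mod_add_cong[OF start refl])
      have "Suc k < length (\<theta> z)" if "k < length (\<theta> z)" "(hd (\<theta> z) + k) mod r = c" for k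
      proof (rule ccontr)
        assume "\<not> ?thesis"
        with that have k: "length (\<theta> z) = Suc k" by simp
        have "Suc (hd (\<theta> z) + k) mod r = c + 1"
          using that(2) c by (auto simp: mod_Suc)
        then show False using ne[OF z] k by (simp add: end_res_def)
      qed
      then show ?thesis
        unfolding contract_def filter_map o_def map_map res
        by (intro map_cong refl) (simp add: X add.assoc flip: add_Suc_right)
    qed
    ultimately show ?case using snoc.IH[of "z # t"] snoc.prems by (simp add: l_def)
  qed simp
  from this[of w "[]"] show ?thesis by (simp add: X_def)
qed

lemma map_div_filter_upt:
  fixes r c :: nat
  assumes "c < r" "i \<le> j"
  obtains i' j' where "i' \<le> j'" "map (\<lambda>p. p div r) (filter (\<lambda>p. p mod r = c) [i..<j]) = [i'..<j']"
proof -
  \<comment> \<open>\<open>g k\<close> is the first block whose place \<open>c\<close> is not before \<open>k\<close>.\<close>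
  define g where "g k = (k + (r - 1 - c)) div r" for k
  have step: "g (Suc k) = (if k mod r = c then Suc (k div r) else g k)" "k mod r = c \<Longrightarrow> g k = k div r" for k
  proof -
    define a b where "a = k div r" and "b = k mod r"
    have k: "k = r * a + b" "b < r" using assms by (auto simp: a_def b_def)
    have gk: "g (k + d) = a + (b + d + (r - 1 - c)) div r" for d
    proof -
      define f where "f = b + d + (r - 1 - c)"
      have "g (k + d) = (f + r * a) div r" unfolding g_def k(1) f_def by (simp add: ac_simps)
      also have "\<dots> = a + f div r" using assms by simp
      finally show ?thesis by (simp only: f_def)
    qed
    have div: "x div r = (if x < r then 0 else 1)" if "x < 2 * r" for x
      using that by (simp add: div_nat_eqI)
    have 0: "g k = a + (if b + (r - 1 - c) < r then 0 else 1)"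
      using gk[of 0] div[of "b + (r - 1 - c)"] k(2) assms by simp
    have 1: "g (Suc k) = a + (if b + 1 + (r - 1 - c) < r then 0 else 1)"
      using gk[of 1] div[of "b + 1 + (r - 1 - c)"] k(2) assms by simp
    show "g (Suc k) = (if k mod r = c then Suc (k div r) else g k)" "k mod r = c \<Longrightarrow> g k = k div r"
      unfolding 0 1 using assms k(2) unfolding a_def[symmetric] b_def[symmetric] by auto
  qed
  have mono: "g i \<le> g (i + d)" for d unfolding g_def by (intro div_le_mono) simp
  have "map (\<lambda>p. p div r) (filter (\<lambda>p. p mod r = c) [i..<i + d]) = [g i..<g (i + d)]" for d
  proof (induction d)
    case (Suc d)
    then show ?case using step[of "i + d"] mono[of d] by auto
  qed simp
  from this[of "j - i"] mono[of "j - i"] that show ?thesis using assms by simp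
qed

lemma append_Cons_eq_cases:
  assumes "s @ z # t = s' @ z' # t'"
  obtains "s = s'" "z = z'" "t = t'"
    | m where "s' = s @ z # m" "t = m @ z' # t'"
    | m where "s = s' @ z' # m" "t' = m @ z # t"
proof -
  have "(\<exists>us. s = s' @ us \<and> us @ z # t = z' # t') \<or> (\<exists>us. s @ us = s' \<and> z # t = us @ z' # t')"
    using assms unfolding append_eq_append_conv2 by blast
  then show thesis
  proof (elim disjE exE conjE)
    fix us assume "s = s' @ us" "us @ z # t = z' # t'"
    then show thesis using that(1,3) by (cases us) auto
  next
    fix us assume "s @ us = s'" "z # t = us @ z' # t'"
    then show thesis using that(1,2) by (cases us) auto
  qed
qed

lemma ex_avoiding_residue:
  assumes "finite B" "card B + 1 < r"
  obtains c :: nat where "c + 1 < r" "c + 1 \<notin> B"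
proof -
  have "\<not> {1..<r} \<subseteq> B"
  proof
    assume "{1..<r} \<subseteq> B"
    from card_mono[OF assms(1) this] show False using assms(2) by simp
  qed
  then obtain b where "b \<in> {1..<r}" "b \<notin> B" by blast
  with that[of "b - 1"] show ?thesis by simp
qed

lemma concat_map_filter_nonempty:
  "concat (map \<theta> (filter (\<lambda>z. \<theta> z \<noteq> []) w)) = concat (map \<theta> w)"
  by (induction w) auto

lemma length_concat_map_mset_cong:
  assumes "mset u = mset v"
  shows "length (concat (map \<theta> u)) = length (concat (map \<theta> v))"
proof -
  have "length (concat (map \<theta> w)) = sum_mset (image_mset (length \<circ> \<theta>) (mset w))" for w
    by (induction w) auto
  then show ?thesis using assms by metis
qed

lemma length_le_length_concat_map:
  "(\<And>z. z \<in> set w \<Longrightarrow> \<theta> z \<noteq> []) \<Longrightarrow> length w \<le> length (concat (map \<theta> w))"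
proof (induction w)
  case (Cons z w)
  then have "0 < length (\<theta> z)" "length w \<le> length (concat (map \<theta> w))" by auto
  then have "Suc (length w) \<le> length (\<theta> z) + length (concat (map \<theta> w))" by linarith
  then show ?case by simp
qed simp

lemma mset_eq_length_le_1:
  assumes "mset u = mset v" "length u \<le> 1"
  shows "v = u"
proof (cases u)
  case (Cons x u')
  then have "u = [x]" using assms by simp
  then show ?thesis using assms by simp
qed (use assms in simp)

lemma framed_eq_NoneD:
  "framed w = a @ None # m @ y # b \<Longrightarrow> a = []"
  "framed w = a @ y # m @ None # b \<Longrightarrow> b = []"
proof -
  assume 1: "framed w = a @ None # m @ y # b"
  show "a = []"
  proof (rule ccontr)
    assume "a \<noteq> []"
    then obtain s t where "None # m @ y # b = map Some t @ [None]"
      using framed_append_eqD[OF 1] by blast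
    then show False by (cases t) auto
  qed
next
  assume 2: "framed w = a @ y # m @ None # b"
  show "b = []"
  proof (rule ccontr)
    assume "b \<noteq> []"
    then obtain s t where "a @ y # m @ [None] = None # map Some s"
      using framed_append_eqD[of w "a @ y # m @ [None]" b] 2 by auto
    then have "last (a @ y # m @ [None]) = last (None # map Some s)"
      "length (a @ y # m @ [None]) = length (None # map Some s)" by metis+
    then show False by (cases s rule: rev_cases) auto
  qed
qed

lemma framed_eq_SomeD:
  assumes "framed w = a @ Some y # b"
  obtains s t where "w = s @ y # t" "a = None # map Some s"
proof -
  have "a \<noteq> []" using assms by (cases a) (auto simp: framed_def)
  with assms obtain s t where st: "w = s @ t" "a = None # map Some s" "Some y # b = map Some t @ [None]"
    by (auto elim: framed_append_eqD)
  then obtain t' where "t = y # t'" by (cases t) auto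
  with st that show ?thesis by blast
qed

text \<open>
  Induction on the length of the image.  There are fewer residues of boundaries than places in a block,
  so some pair of neighbouring places \<open>c\<close>, \<open>c + 1\<close>, the marker, is never cut.  Contraction
  to the blocks with a marker in the image gives a shorter factor of the infinite word, and the induction
  hypothesis shows that the images of \<open>u\<close> and of \<open>v\<close> have the same markers.  The other
  entries of a block of the image of \<open>v\<close> are compared with an anchor: the letter of \<open>v\<close>
  that covers the marker or, if the marker lies outside, one of the ends of the word.  Between a letter that covers the
  entry in question and the anchor there are only letters inside the block, so by
  \<open>equi_adjacent_gap\<close> the two occur in the same relative position in \<open>u\<close>, whose image is known
  to be a factor of the infinite word.
\<close>

theorem equi_adjacent_image_selfsim:
  fixes u v :: "nat list"
  assumes "equi_adjacent u v" "card (set u) + 2 < r" "concat (map \<theta> u) = map (selfsim r) [i..<j]"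
  shows "concat (map \<theta> v) = concat (map \<theta> u)"
  using assms
proof (induction "length (concat (map \<theta> u))" arbitrary: u v \<theta> i j rule: less_induct)
  case less
  \<comment> \<open>Letters with empty image are deleted, since their residues are meaningless.\<close>
  define u1 v1 where "u1 = filter (\<lambda>z. \<theta> z \<noteq> []) u" and "v1 = filter (\<lambda>z. \<theta> z \<noteq> []) v"
  have img: "concat (map \<theta> u1) = concat (map \<theta> u)" "concat (map \<theta> v1) = concat (map \<theta> v)"
    unfolding u1_def v1_def by (rule concat_map_filter_nonempty)+
  have comp: "equi_adjacent u1 v1" unfolding u1_def v1_def using less.prems(1) by (rule equi_adjacent_filter)
  have ms: "mset u1 = mset v1" using comp by (simp add: equi_adjacent_def)
  have ne: "\<theta> z \<noteq> []" if "z \<in> set u1" for z using that by (simp add: u1_def)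
  have r: "2 \<le> r" using less.prems by simp
  let ?W = "selfsim r"
  have imgW: "concat (map \<theta> u1) = map ?W [i..<j]" using less.prems(3) img by simp
  show ?case
  proof (cases "j - i \<le> 1")
    case True
    then have "length u1 \<le> 1"
      using length_le_length_concat_map[of u1 \<theta>] ne imgW by fastforce
    then have "v1 = u1" using mset_eq_length_le_1[OF ms] by simp
    then show ?thesis using img by simp
  next
    case False
    then have ij: "i \<le> j" by simp
    have fitu: "fits r \<theta> i j u1"
      by (rule fits_image_selfsim[OF r imgW ij ne])
    have fitv: "fits r \<theta> i j v1"
    proof (rule fits_adj[OF fitu])
      have "adj (framed (filter (\<lambda>_. True) u1)) = adj (framed (filter (\<lambda>_. True) v1))"
        using comp unfolding equi_adjacent_def by blast
      then show "adj (framed v1) \<subseteq> adj (framed u1)" by simp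
    qed
    define Y where "Y = concat (map \<theta> v1)"
    have lenY: "length Y = j - i"
      unfolding Y_def length_concat_map_mset_cong[OF ms[symmetric]] imgW by simp
    have sets: "set v1 = set u1" using equi_adjacent_set[OF comp] by simp

    define B where "B = insert (j mod r) ((\<lambda>z. start_res r \<theta> j (Some z)) ` set u1)"
    have "card ((\<lambda>z. start_res r \<theta> j (Some z)) ` set u1) \<le> card (set u1)"
      by (rule card_image_le) simp
    also have "\<dots> \<le> card (set u)" by (rule card_mono) (auto simp: u1_def)
    finally have "card B + 1 < r"
      using less.prems(2) unfolding B_def by (simp add: card_insert_if)
    then obtain c where c: "c + 1 < r" "c + 1 \<notin> B"
      using ex_avoiding_residue[of B r] by (auto simp: B_def)
    have nostart: "start_res r \<theta> j x \<noteq> c + 1" if "x = None \<or> x \<in> Some ` set u1" for x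
    proof -
      have "start_res r \<theta> j x \<in> B" using that by (auto simp: B_def start_res_def[of r \<theta> j None])
      then show ?thesis using c(2) by metis
    qed
    have boundary: "(i + offset \<theta> p) mod r \<noteq> c + 1" if "framed u1 = p @ q" "p \<noteq> []" "q \<noteq> []" for p q
    proof -
      have "hd q \<in> set (framed u1)" using that by simp
      then have "hd q = None \<or> hd q \<in> Some ` set u1" by (auto simp: framed_def)
      then show ?thesis using fitsD(1)[OF fitu that] nostart by simp
    qed
    have noend: "end_res r \<theta> i (Some z) \<noteq> c + 1" if z: "z \<in> set u1" for z
    proof -
      obtain s t where "u1 = s @ z # t" using split_list[OF z] by blast
      then have *: "framed u1 = (None # map Some s @ [Some z]) @ (map Some t @ [None])"
        by (simp add: framed_def)
      from boundary[OF *] fitsD(2)[OF fitu *] show ?thesis by simp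
    qed
    have ic: "i mod r \<noteq> c + 1"
      using boundary[of "[None]" "map Some u1 @ [None]"] by (simp add: framed_def)
    have jc: "j mod r \<noteq> c + 1"
      using nostart[of None] by (simp add: start_res_def)

    define F where "F = filter (\<lambda>p. p mod r = c) [i..<j]"
    have F: "Suc p < j" if "i \<le> p" "p < j" "p mod r = c" for p
    proof (rule ccontr)
      assume "\<not> ?thesis"
      then have "j = Suc p" using that by simp
      then have "j mod r = c + 1" using that c by (simp add: mod_Suc)
      then show False using jc by simp
    qed
    have U: "concat (map (contract r c \<theta>) u1) = map (\<lambda>p. ?W (p div r)) F"
    proof -
      have "i + length (concat (map \<theta> u1)) = j" using imgW ij by simp
      then have "concat (map (contract r c \<theta>) u1) =
          map (\<lambda>p. unhalf r c (map ?W [i..<j] ! (p - i)) (map ?W [i..<j] ! (Suc p - i))) F"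
        using contract_image[OF fitu c(1)] nostart noend imgW by (simp add: F_def)
      also have "\<dots> = map (\<lambda>p. ?W (p div r)) F"
        unfolding F_def
      proof (intro map_cong refl)
        fix p assume "p \<in> set (filter (\<lambda>p. p mod r = c) [i..<j])"
        then have p: "i \<le> p" "p < j" "p mod r = c" by auto
        then have "map ?W [i..<j] ! (p - i) = ?W p" "map ?W [i..<j] ! (Suc p - i) = ?W (Suc p)"
          using F[OF p] by auto
        then show "unhalf r c (map ?W [i..<j] ! (p - i)) (map ?W [i..<j] ! (Suc p - i)) = ?W (p div r)"
          using unhalf_selfsim[OF r p(3) c(1)] by simp
      qed
      finally show ?thesis .
    qed
    have "concat (map (contract r c \<theta>) v1) = concat (map (contract r c \<theta>) u1)"
    proof -
      obtain i' j' where "map (\<lambda>p. p div r) F = [i'..<j']"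
        using map_div_filter_upt[OF _ ij, of c r] c unfolding F_def by (metis add_lessD1)
      then have *: "concat (map (contract r c \<theta>) u1) = map ?W [i'..<j']"
        unfolding U by (metis map_map comp_def map_eq_conv)
      have "i mod r \<noteq> Suc i mod r" using r by (simp add: mod_Suc)
      moreover have "i \<in> set [i..<j]" "Suc i \<in> set [i..<j]" using False by auto
      ultimately obtain p where "p \<in> set [i..<j]" "p mod r \<noteq> c" by metis
      then have "length F < length [i..<j]" unfolding F_def by (rule length_filter_less)
      then have "length (concat (map (contract r c \<theta>) u1)) < length (concat (map \<theta> u))"
        using U imgW img by simp
      moreover have "card (set u1) \<le> card (set u)" by (rule card_mono) (auto simp: u1_def)
      ultimately show ?thesis using less.hyps[OF _ comp _ *] less.prems(2) by simp
    qed
    moreover have "concat (map (contract r c \<theta>) v1) =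
        map (\<lambda>p. unhalf r c (Y ! (p - i)) (Y ! (Suc p - i))) F"
      using contract_image[OF fitv c(1)] nostart noend sets lenY ij by (simp add: F_def Y_def)
    \<comment> \<open>The induction hypothesis, read entry by entry.\<close>
    ultimately have marker: "unhalf r c (Y ! (p - i)) (Y ! (Suc p - i)) = ?W (p div r)"
      if "i \<le> p" "p < j" "p mod r = c" for p
      using that U by (auto simp: F_def)

    have all: "Y ! (p - i) = ?W p" if p: "i \<le> p" "p < j" for p
    proof -
      \<comment> \<open>\<open>q\<close> is the position of the marker of the block that contains \<open>p\<close>.\<close>
      define n q where "n = p div r" and "q = r * n + c"
      have pn: "r * n \<le> p" "p < r * n + r"
      proof -
        have "p = r * n + p mod r" "p mod r < r" using r by (simp_all add: n_def)
        then show "r * n \<le> p" "p < r * n + r" by linarith+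
      qed
      obtain s y t where y: "v1 = s @ y # t" and "length (concat (map \<theta> s)) \<le> p - i"
        "p - i < length (concat (map \<theta> s)) + length (\<theta> y)"
        "Y ! (p - i) = \<theta> y ! (p - i - length (concat (map \<theta> s)))"
        using concat_map_cover[of "p - i" \<theta> v1] p lenY unfolding Y_def by (metis diff_less_mono)
      moreover define S where "S = i + length (concat (map \<theta> s))"
      ultimately have S: "S \<le> p" "p < S + length (\<theta> y)" "Y ! (p - i) = \<theta> y ! (p - S)"
        using p by auto
      have framed_v: "framed v1 = (None # map Some s) @ Some y # map Some t @ [None]"
        using y by (simp add: framed_def)
      \<comment> \<open>It suffices to find one occurrence of \<open>y\<close> in \<open>u1\<close> that has the same place in
          a block with the same letter above it.\<close>
      have same: "\<theta> y ! (p - S) = ?W p"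
        if "u1 = s' @ y # t'" "i + length (concat (map \<theta> s')) + (p - S) = r * n' + (p - r * n)" "?W n' = ?W n"
        for s' t' n'
      proof -
        have "\<theta> y ! (p - S) = ?W (r * n' + (p - r * n))"
          using image_nth(1)[OF imgW that(1), of "p - S"] S that(2) by simp
        also have "\<dots> = ?W (r * n + (p - r * n))"
          using that(3) pn by (intro selfsim_block_cong[OF r]) auto
        finally show ?thesis using pn by simp
      qed

      have right_of: "\<theta> y ! (p - S) = ?W p"
        if v: "framed v1 = a @ x # m @ Some y # b" "b = map Some t @ [None]"
          and e: "e = i + offset \<theta> (a @ [x])" "r * n \<le> e"
          and anchor: "\<And>a' m' b' n'. framed u1 = a' @ x # m' @ Some y # b' \<Longrightarrow>
            i + offset \<theta> (a' @ [x]) = r * n' + (e - r * n) \<Longrightarrow> ?W n' = ?W n"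
        for a x m b e
      proof -
        have "(a @ x # m) @ Some y # b = (None # map Some s) @ Some y # map Some t @ [None]"
          using v framed_v by simp
        then have "a @ x # m = None # map Some s" using v(2) by simp
        then have "offset \<theta> (a @ x # m) = offset \<theta> (None # map Some s)" by simp
        then have eS: "e + offset \<theta> m = S" using e by (simp add: S_def)
        then have "e + offset \<theta> m < r * n + r" using S pn by simp
        then obtain a' m' b' n' where u: "framed u1 = a' @ x # m' @ Some y # b'"
          "offset \<theta> m' = offset \<theta> m" "i + offset \<theta> (a' @ [x]) = r * n' + (e - r * n)"
          using equi_adjacent_gap[OF comp fitu fitv ne v(1) e] by blast
        obtain s' t' where s': "u1 = s' @ y # t'" "a' @ x # m' = None # map Some s'"
          using framed_eq_SomeD[of u1 "a' @ x # m'" y b'] u(1) by auto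
        then have "offset \<theta> (a' @ x # m') = length (concat (map \<theta> s'))" by simp
        then have "i + length (concat (map \<theta> s')) + (p - S) = r * n' + (p - r * n)"
          using u eS e(2) S by simp
        then show ?thesis by (rule same[OF s'(1) _ anchor[OF u(1,3)]])
      qed

      have left_of: "\<theta> y ! (p - S) = ?W p"
        if v: "framed v1 = (None # map Some s) @ Some y # m @ x # b"
          and e: "S + length (\<theta> y) + offset \<theta> m < r * n + r"
          and anchor: "\<And>a' m' b' n'. framed u1 = a' @ Some y # m' @ x # b' \<Longrightarrow>
            i + offset \<theta> (a' @ Some y # m') = r * n' + (S + length (\<theta> y) + offset \<theta> m - r * n) \<Longrightarrow> ?W n' = ?W n"
        for m x b
      proof -
        define e where "e = S + length (\<theta> y)"
        have "e = i + offset \<theta> ((None # map Some s) @ [Some y])" "r * n \<le> e" "e + offset \<theta> m < r * n + r"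
          using S pn that(2) by (auto simp: e_def S_def)
        then obtain a' m' b' n' where u: "framed u1 = a' @ Some y # m' @ x # b'"
          "offset \<theta> m' = offset \<theta> m" "i + offset \<theta> (a' @ [Some y]) = r * n' + (e - r * n)"
          using equi_adjacent_gap[OF comp fitu fitv ne v] by blast
        obtain s' t' where s': "u1 = s' @ y # t'" "a' = None # map Some s'"
          using framed_eq_SomeD[OF u(1)] by blast
        have *: "i + length (concat (map \<theta> s')) + length (\<theta> y) = r * n' + (e - r * n)"
          using u(3) s'(2) by simp
        then have pos: "i + length (concat (map \<theta> s')) + (p - S) = r * n' + (p - r * n)"
          using S pn unfolding e_def by linarith
        have "i + offset \<theta> (a' @ Some y # m') = r * n' + (e + offset \<theta> m - r * n)"
          using * u(2) s'(2) \<open>r * n \<le> e\<close> by simp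
        then show ?thesis
          by (intro same[OF s'(1) pos] anchor[OF u(1)]) (simp only: e_def)
      qed

      have "\<theta> y ! (p - S) = ?W p"
      proof (cases "i \<le> q \<and> q < j")
        case True
        then have q: "i \<le> q" "q < j" by auto
        have qc: "q mod r = c" "q div r = n" using c r by (auto simp: q_def)
        have "Suc q < j" using F[OF q qc(1)] .
        obtain s2 x t2 where x: "v1 = s2 @ x # t2" and "length (concat (map \<theta> s2)) \<le> q - i"
          "q - i < length (concat (map \<theta> s2)) + length (\<theta> x)"
          using concat_map_cover[of "q - i" \<theta> v1] q lenY unfolding Y_def by (metis diff_less_mono)
        moreover define R where "R = i + length (concat (map \<theta> s2))"
        ultimately have R: "R \<le> q" "q < R + length (\<theta> x)" using q by auto
        have framed_x: "framed v1 = (None # map Some s2 @ [Some x]) @ (map Some t2 @ [None])"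
          using x by (simp add: framed_def)
        have xu: "x \<in> set u1" using x sets by auto
        have R': "Suc q < R + length (\<theta> x)"
        proof (rule ccontr)
          assume "\<not> ?thesis"
          then have "i + offset \<theta> (None # map Some s2 @ [Some x]) = Suc q" using R by (simp add: R_def)
          then have "Suc q mod r = end_res r \<theta> i (Some x)"
            using fitsD(2)[OF fitv framed_x] by simp
          moreover have "Suc q mod r = c + 1" using qc c by (simp add: mod_Suc)
          ultimately show False using noend[OF xu] by simp
        qed
        have Yx: "Y ! (k - i) = \<theta> x ! (k - R)" if "R \<le> k" "k < R + length (\<theta> x)" for k
        proof -
          have "k - i = length (concat (map \<theta> s2)) + (k - R)" using that by (simp add: R_def)
          moreover have "k - R < length (\<theta> x)" using that by linarith
          ultimately show ?thesis unfolding Y_def x by (simp add: nth_append)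
        qed
        have anchor: "?W n' = ?W n"
          if "u1 = s' @ x # t'" "i + length (concat (map \<theta> s')) + (q - R) = r * n' + c" for s' t' n'
        proof -
          have "\<theta> x ! (q - R) = ?W (r * n' + c)"
            using image_nth(1)[OF imgW that(1), of "q - R"] R that(2) by simp
          moreover have "Suc q - R < length (\<theta> x)" using R R' by linarith
          then have "\<theta> x ! (Suc q - R) = ?W (Suc (r * n' + c))"
            using image_nth(1)[OF imgW that(1), of "Suc q - R"] R that(2) by (simp add: Suc_diff_le)
          ultimately have "unhalf r c (\<theta> x ! (q - R)) (\<theta> x ! (Suc q - R)) = ?W n'"
            using unhalf_selfsim[OF r, of "r * n' + c" c] c by simp
          moreover have "unhalf r c (\<theta> x ! (q - R)) (\<theta> x ! (Suc q - R)) = ?W n"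
            using marker[OF q qc(1)] Yx[of q] Yx[of "Suc q"] R R' qc by simp
          ultimately show ?thesis by simp
        qed
        have "s @ y # t = s2 @ x # t2" using x y by simp
        then show ?thesis
        proof (cases rule: append_Cons_eq_cases)
          case 1
          then have SR: "S = R" "y = x" by (simp_all add: S_def R_def)
          obtain s' t' where s': "u1 = s' @ x # t'" using split_list[OF xu] by blast
          define n' where "n' = (i + length (concat (map \<theta> s')) + (q - R)) div r"
          have "(i + length (concat (map \<theta> s'))) mod r = R mod r"
          proof -
            have "framed u1 = (None # map Some s') @ (Some x # map Some t' @ [None])"
              "framed v1 = (None # map Some s2) @ (Some x # map Some t2 @ [None])"
              using s' x by (simp_all add: framed_def)
            from fitsD(1)[OF fitu this(1)] fitsD(1)[OF fitv this(2)] show ?thesis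
              by (simp add: R_def)
          qed
          then have "(i + length (concat (map \<theta> s')) + (q - R)) mod r = (R + (q - R)) mod r"
            by (rule mod_add_cong) simp
          then have "(i + length (concat (map \<theta> s')) + (q - R)) mod r = c" using R qc by simp
          then have *: "i + length (concat (map \<theta> s')) + (q - R) = r * n' + c"
            unfolding n'_def by (metis mult_div_mod_eq)
          have "i + length (concat (map \<theta> s')) + (p - S) = r * n' + (p - r * n)"
            using * S SR R pn unfolding q_def by linarith
          then show ?thesis using same[of s' t' n', OF _ _ anchor[OF s' *]] s' SR by blast
        next
          case (2 m)
          have v: "framed v1 = (None # map Some s) @ Some y # map Some m @ Some x # map Some t2 @ [None]"
            using 2 framed_v by simp
          have eR: "S + length (\<theta> y) + offset \<theta> (map Some m) = R"
            using 2 by (simp add: S_def R_def)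
          show ?thesis
          proof (rule left_of[OF v])
            show "S + length (\<theta> y) + offset \<theta> (map Some m) < r * n + r"
              unfolding eR using R c by (simp add: q_def)
          next
            fix a' m' b' n' assume u: "framed u1 = a' @ Some y # m' @ Some x # b'"
              and "i + offset \<theta> (a' @ Some y # m') = r * n' + (S + length (\<theta> y) + offset \<theta> (map Some m) - r * n)"
            then have pos: "i + offset \<theta> (a' @ Some y # m') = r * n' + (R - r * n)" unfolding eR by simp
            obtain s' t' where s': "u1 = s' @ x # t'" "a' @ Some y # m' = None # map Some s'"
              using framed_eq_SomeD[of u1 "a' @ Some y # m'" x b'] u by auto
            then have "offset \<theta> (a' @ Some y # m') = length (concat (map \<theta> s'))" by simp
            moreover have "r * n \<le> R" using eR S pn by simp
            ultimately have "i + length (concat (map \<theta> s')) + (q - R) = r * n' + c"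
              using pos R by (simp add: q_def)
            then show "?W n' = ?W n" by (rule anchor[OF s'(1)])
          qed
        next
          case (3 m)
          have v: "framed v1 = (None # map Some s2) @ Some x # map Some m @ Some y # map Some t @ [None]"
            using 3 framed_v by simp
          show ?thesis
          proof (rule right_of[OF v refl])
            show e: "R + length (\<theta> x) = i + offset \<theta> ((None # map Some s2) @ [Some x])"
              by (simp add: R_def)
            show "r * n \<le> R + length (\<theta> x)" using R by (simp add: q_def)
            fix a' m' b' n' assume u: "framed u1 = a' @ Some x # m' @ Some y # b'"
              and pos: "i + offset \<theta> (a' @ [Some x]) = r * n' + (R + length (\<theta> x) - r * n)"
            obtain s' t' where s': "u1 = s' @ x # t'" "a' = None # map Some s'"
              using framed_eq_SomeD[OF u] by blast
            then have "i + length (concat (map \<theta> s')) + length (\<theta> x) = r * n' + (R + length (\<theta> x) - r * n)"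
              using pos by simp
            then have "i + length (concat (map \<theta> s')) + (q - R) = r * n' + c"
              using R unfolding q_def by linarith
            then show "?W n' = ?W n" by (rule anchor[OF s'(1)])
          qed
        qed
      next
        case False
        then consider "q < i" | "j \<le> q" by linarith
        then show ?thesis
        proof cases
          case 1
          then have "r * n \<le> i" by (simp add: q_def)
          have v: "framed v1 = [] @ None # map Some s @ Some y # map Some t @ [None]"
            using framed_v by simp
          show ?thesis
          proof (rule right_of[OF v refl])
            show "i = i + offset \<theta> ([] @ [None])" by simp
            fix a' m' b' n' assume u: "framed u1 = a' @ None # m' @ Some y # b'"
              and pos: "i + offset \<theta> (a' @ [None]) = r * n' + (i - r * n)"
            have "a' = []" using framed_eq_NoneD(1)[OF u] .
            then have "i + offset \<theta> (a' @ [None]) = i" by simp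
            then have "r * n' = r * n" using pos \<open>r * n \<le> i\<close> by linarith
            then show "?W n' = ?W n" using r by simp
          qed fact
        next
          case 2
          have eJ: "S + length (\<theta> y) + offset \<theta> (map Some t) = j"
          proof -
            have "length Y = j - i" by (rule lenY)
            then show ?thesis using ij unfolding Y_def S_def y by simp
          qed
          have "r * n \<le> j" using p pn by simp
          show ?thesis
          proof (rule left_of)
            show "framed v1 = (None # map Some s) @ Some y # map Some t @ None # []"
              using framed_v by simp
            show "S + length (\<theta> y) + offset \<theta> (map Some t) < r * n + r"
              unfolding eJ using 2 c by (simp add: q_def)
            fix a' m' b' n' assume u: "framed u1 = a' @ Some y # m' @ None # b'"
              and "i + offset \<theta> (a' @ Some y # m') = r * n' + (S + length (\<theta> y) + offset \<theta> (map Some t) - r * n)"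
            then have pos: "i + offset \<theta> (a' @ Some y # m') = r * n' + (j - r * n)" unfolding eJ by simp
            have b': "b' = []" using framed_eq_NoneD(2)[OF u] .
            have "offset \<theta> (framed u1) = length (concat (map \<theta> u1))" by (simp add: framed_def)
            also have "\<dots> = j - i" using imgW by simp
            finally have "offset \<theta> (a' @ Some y # m') = j - i" using u b' by simp
            then have "j = r * n' + (j - r * n)" using pos ij by linarith
            then have "r * n' = r * n" using \<open>r * n \<le> j\<close> by linarith
            then show "?W n' = ?W n" using r by simp
          qed
        qed
      qed
      then show ?thesis using S by simp
    qed
    have "Y = map ?W [i..<j]"
    proof (rule nth_equalityI)
      fix k assume "k < length Y"
      then show "Y ! k = map ?W [i..<j] ! k" using all[of "i + k"] lenY by simp
    qed (use lenY in simp)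
    then show ?thesis using img imgW by (simp add: Y_def)
  qed
qed

section \<open>Monochromatic factors of recurrent words\<close>

lemma Ramsey_intervals:
  fixes f :: "nat \<Rightarrow> nat \<Rightarrow> 'c"
  assumes "infinite Z" "finite C" "\<And>x y. x < y \<Longrightarrow> f x y \<in> C"
  obtains Y t where "Y \<subseteq> Z" "infinite Y" "\<And>x y. x \<in> Y \<Longrightarrow> y \<in> Y \<Longrightarrow> x < y \<Longrightarrow> f x y = t"
proof -
  obtain h where h: "bij_betw h C {0..<card C}"
    using ex_bij_betw_finite_nat[OF assms(2)] by blast
  define g where "g S = h (f (Min S) (Max S))" for S
  have g: "g {x, y} = h (f x y)" "g {y, x} = h (f x y)" if "x < y" for x y
    using that by (simp_all add: g_def)
  have lt: "h (f x y) < card C" if "x < y" for x y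
    using h assms(3)[OF that] by (auto dest: bij_betwE)
  have "\<forall>x\<in>Z. \<forall>y\<in>Z. x \<noteq> y \<longrightarrow> g {x, y} < card C"
    using g lt by (metis linorder_neqE_nat)
  from Ramsey2[OF assms(1) this] obtain Y t where Y: "Y \<subseteq> Z" "infinite Y"
    "\<forall>x\<in>Y. \<forall>y\<in>Y. x \<noteq> y \<longrightarrow> g {x, y} = t" by blast
  have "f x y = inv_into C h t" if "x \<in> Y" "y \<in> Y" "x < y" for x y
  proof -
    have "h (f x y) = t" using Y(3) that g(1) by (metis less_irrefl)
    then show ?thesis using h assms(3)[OF that(3)] by (auto simp: bij_betw_def inv_into_f_f)
  qed
  with that Y show ?thesis by blast
qed

lemma sublist_map_uptE:
  assumes "sublist w (map X [i..<j])"
  obtains i' j' where "w = map X [i'..<j']"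
proof -
  obtain p q where assms: "map X [i..<j] = p @ w @ q" using assms by (auto simp: sublist_def)
  have len: "length p + length w + length q = j - i"
    using arg_cong[OF assms, of length] by simp
  have "w = take (length w) (drop (length p) (map X [i..<j]))"
    using assms by (metis append_eq_conv_conj)
  also have "\<dots> = map X [i + length p..<i + length p + length w]"
    using len by (intro nth_equalityI) (simp_all add: take_map drop_map)
  finally show ?thesis by (rule that)
qed

lemma map_upt_split:
  "i \<le> j \<Longrightarrow> j \<le> k \<Longrightarrow> map X [i..<k] = map X [i..<j] @ map X [j..<k]"
  using upt_add_eq_append[of i j "k - j"] by simp

text \<open>
  By Ramsey's theorem, an infinite set of positions contains positions \<open>a < b < c < d\<close> such
  that all words between them have the same, hence idempotent, colour \<open>e\<close>.  Among all such
  quadruples take one for which the right ideal generated by \<open>e\<close> in the semigroup of colours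
  is as small as possible.  Let \<open>v\<close> be the word from \<open>a\<close> to \<open>d\<close>, and apply
  the theorem again to the occurrences of \<open>v\<close>: there is a factor
  \<open>v R1 v R2 v\<close> such that \<open>v R1\<close> and \<open>v R2\<close> have the same idempotent colour.
  It generates the same right ideal as \<open>e\<close> by minimality, so \<open>v R1 v\<close> and
  \<open>v R2 v\<close> have the colour \<open>e\<close>.  For \<open>x\<close> take the middle third
  of \<open>v\<close>; the outer thirds complete \<open>R1\<close> and \<open>R2\<close> to words of colour
  \<open>e\<close>.
\<close>

lemma recurrent_monochromatic:
  fixes X :: "nat \<Rightarrow> 'a" and col :: "'a list \<Rightarrow> 'c"
  assumes recurrent: "\<And>l. infinite {n. \<forall>q<l. X (n + q) = X q}"
    and fin: "finite (col ` lists A)" and X: "range X \<subseteq> A"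
    and cong: "\<And>u u' v v'. \<lbrakk>u \<noteq> []; u' \<noteq> []; v \<noteq> []; v' \<noteq> []; col u = col u'; col v = col v'\<rbrakk>
      \<Longrightarrow> col (u @ v) = col (u' @ v')"
  obtains x y z i j where "x \<noteq> []" "y \<noteq> []" "z \<noteq> []"
    "x @ y @ x @ z @ x = map X [i..<j]" "col y = col x" "col z = col x" "col (x @ x) = col x"
proof -
  define F where "F i j = map X [i..<j]" for i j
  have split: "F i k = F i j @ F j k" if "i \<le> j" "j \<le> k" for i j k
    using map_upt_split[OF that] by (simp add: F_def)
  have F_ne: "F i j \<noteq> []" if "i < j" for i j using that by (simp add: F_def)
  have F_A: "F i j \<in> lists A" for i j using X by (auto simp: F_def image_subset_iff)
  define ideal where "ideal w = (\<lambda>z. col (w @ z)) ` lists A" for w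
  have ideal_fin: "finite (ideal w)" if "w \<in> lists A" for w
    using that by (intro finite_subset[OF _ fin]) (auto simp: ideal_def intro!: imageI)
  define good where "good a b c d \<longleftrightarrow> a < b \<and> b < c \<and> c < d \<and> col (F b c) = col (F a b) \<and>
    col (F c d) = col (F a b) \<and> col (F a c) = col (F a b)" for a b c d
  have homog: "\<exists>Y. Y \<subseteq> Z \<and> infinite Y \<and> (\<exists>t. \<forall>x\<in>Y. \<forall>y\<in>Y. x < y \<longrightarrow> col (F x y) = t)"
    if "infinite Z" for Z
    by (rule Ramsey_intervals[OF that fin, of "\<lambda>x y. col (F x y)"]) (use F_A in auto)
  have next_ex: "\<exists>y'\<in>Y. y + l < y'" if "infinite Y" for Y :: "nat set" and y l
    using that by (meson infinite_nat_iff_unbounded)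
  have good_in: "\<exists>a\<in>Z. \<exists>b\<in>Z. \<exists>c\<in>Z. \<exists>d\<in>Z. good a b c d \<and> a + l < b \<and> b + l < c \<and> c + l < d" if "infinite Z" for Z l
  proof -
    obtain Y t where Y: "Y \<subseteq> Z" "infinite Y" "\<forall>x\<in>Y. \<forall>y\<in>Y. x < y \<longrightarrow> col (F x y) = t"
      using homog[OF \<open>infinite Z\<close>] by blast
    obtain a where a: "a \<in> Y" using infinite_imp_nonempty[OF Y(2)] by blast
    obtain b where b: "b \<in> Y" "a + l < b" using next_ex[OF Y(2)] by blast
    obtain c where c: "c \<in> Y" "b + l < c" using next_ex[OF Y(2)] by blast
    obtain d where d: "d \<in> Y" "c + l < d" using next_ex[OF Y(2)] by blast
    have "good a b c d" using Y(3) a b c d by (simp add: good_def)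
    with a b c d Y(1) show ?thesis by blast
  qed

  define P where "P m \<longleftrightarrow> (\<exists>a b c d. good a b c d \<and> card (ideal (F a b)) = m)" for m
  have "\<exists>m. P m" using good_in[of UNIV 0] by (auto simp: P_def)
  then have "P (LEAST m. P m)" by (rule LeastI_ex)
  then obtain a b c d where g: "good a b c d" and min: "card (ideal (F a b)) = (LEAST m. P m)"
    unfolding P_def by blast
  define e v where "e = col (F a b)" and "v = F a d"
  have lt: "a < b" "b < c" "c < d" using g by (auto simp: good_def)
  have e: "col (F b c) = e" "col (F c d) = e" "col (F a c) = e" using g by (auto simp: good_def e_def)
  have v: "v = F a b @ F b c @ F c d" using split[of a b d] split[of b c d] lt by (simp add: v_def)
  have ee: "col (s @ t) = e" if "s \<noteq> []" "t \<noteq> []" "col s = e" "col t = e" for s t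
  proof -
    have "col (s @ t) = col (F a b @ F b c)"
      using that e lt by (intro cong F_ne) (auto simp: e_def)
    then show ?thesis using split[of a b c] lt e by simp
  qed
  have cv: "col v = e" unfolding v
    using lt e by (intro ee F_ne) (auto simp: e_def F_ne)
  have v_ne: "v \<noteq> []" using lt by (auto simp: v_def F_ne)

  let ?Z = "(\<lambda>n. n + a) ` {n. \<forall>q<d. X (n + q) = X q}"
  have occ: "F n (n + (d - a)) = v" if n: "n \<in> ?Z" for n
  proof -
    obtain k where k: "n = k + a" "\<And>q. q < d \<Longrightarrow> X (k + q) = X q" using n by auto
    show ?thesis
    proof (rule nth_equalityI)
      fix m assume "m < length (F n (n + (d - a)))"
      then have "m < d - a" by (simp add: F_def)
      then show "F n (n + (d - a)) ! m = v ! m"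
        using k(1) k(2)[of "a + m"] by (simp add: F_def v_def add.assoc)
    qed (simp add: F_def v_def)
  qed
  have "infinite ?Z" using recurrent by (simp add: finite_image_iff)
  from good_in[OF this, of "d - a"] obtain a' b' c' d' where Z: "a' \<in> ?Z" "b' \<in> ?Z" "c' \<in> ?Z"
    and g': "good a' b' c' d'" and gap: "a' + (d - a) < b'" "b' + (d - a) < c'"
    by (elim bexE conjE)
  define R1 R2 where "R1 = F (a' + (d - a)) b'" and "R2 = F (b' + (d - a)) c'"
  have Q1: "F a' b' = v @ R1" and Q2: "F b' c' = v @ R2"
    using split[of a' "a' + (d - a)" b'] split[of b' "b' + (d - a)" c'] gap occ Z by (simp_all add: R1_def R2_def)
  have R_ne: "R1 \<noteq> []" "R2 \<noteq> []" using gap by (simp_all add: R1_def R2_def F_ne)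
  have inA: "v \<in> lists A" "R1 \<in> lists A" unfolding v_def R1_def by (rule F_A)+

  \<comment> \<open>By minimality, \<open>e\<close> is a right multiple of the colour of \<open>v @ R1\<close>.  That colour
      is idempotent, so it fixes \<open>e\<close> from the left.\<close>
  have absorb: "col ((v @ R1) @ v) = e"
  proof -
    define Q where "Q = v @ R1"
    have Q: "Q \<noteq> []" "col (Q @ Q) = col Q"
    proof -
      show "Q \<noteq> []" using v_ne by (simp add: Q_def)
      have "col (F a' b' @ F b' c') = col (F a' b')"
        using g' split[of a' b' c'] by (simp add: good_def)
      moreover have "col (F a' b' @ F a' b') = col (F a' b' @ F b' c')"
        using g' by (intro cong F_ne) (auto simp: good_def)
      ultimately show "col (Q @ Q) = col Q" by (simp add: Q_def Q1)
    qed
    have "ideal Q \<subseteq> ideal v"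
      using inA by (auto simp: ideal_def Q_def intro!: image_eqI[of _ _ "R1 @ _"])
    moreover have "ideal v = ideal (F a b)"
    proof -
      have "col (v @ z) = col (F a b @ z)" for z
        using cv e_def lt v_ne by (cases "z = []") (auto intro!: cong simp: F_ne)
      then show ?thesis by (simp add: ideal_def)
    qed
    moreover have "card (ideal (F a b)) \<le> card (ideal Q)"
    proof -
      have "P (card (ideal Q))" using g' by (auto simp: P_def Q_def simp flip: Q1)
      then show ?thesis unfolding min by (rule Least_le)
    qed
    ultimately have "ideal Q = ideal v"
      using ideal_fin[OF inA(1)] by (metis card_seteq)
    moreover have "col v \<in> ideal v" by (auto simp: ideal_def intro!: image_eqI[of _ _ "[]"])
    ultimately have "col v \<in> ideal Q" by simp
    then obtain z where z: "col v = col (Q @ z)" by (auto simp only: ideal_def image_iff)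
    have "col (Q @ v) = col (Q @ (Q @ z))" using z Q(1) v_ne by (intro cong) auto
    also have "\<dots> = col (Q @ z)"
    proof (cases "z = []")
      case True then show ?thesis using Q by simp
    next
      case False
      have "col ((Q @ Q) @ z) = col (Q @ z)" using False Q by (intro cong) auto
      then show ?thesis by simp
    qed
    finally show ?thesis using z cv by (simp add: Q_def)
  qed
  have absorb2: "col ((v @ R2) @ v) = e"
  proof -
    have "col (v @ R1) = col (v @ R2)" using g' Q1 Q2 by (simp add: good_def)
    then have "col ((v @ R2) @ v) = col ((v @ R1) @ v)"
      using cong[of "v @ R2" "v @ R1" v v] v_ne by simp
    then show ?thesis using absorb by simp
  qed
  have return: "col (F c d @ R @ F a b) = e" if "R \<noteq> []" "col ((v @ R) @ v) = e" for R
  proof -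
    have "col ((F c d @ R) @ F a b) = col ((v @ R) @ v)"
      using cong[of "F c d" v R R] cong[of "F c d @ R" "v @ R" "F a b" v] that(1) cv e lt v_ne
      by (simp add: F_ne e_def)
    then show ?thesis using that by simp
  qed
  define x y z where "x = F b c" and "y = F c d @ R1 @ F a b" and "z = F c d @ R2 @ F a b"
  have "F a' (c' + (d - a)) = v @ R1 @ v @ R2 @ v"
    using split[of a' b' "c' + (d - a)"] split[of b' c' "c' + (d - a)"] gap Q1 Q2 occ[OF Z(3)]
    by simp
  also have "\<dots> = F a b @ (x @ y @ x @ z @ x) @ F c d" by (simp add: v x_def y_def z_def)
  finally have w: "F a' (c' + (d - a)) = F a b @ (x @ y @ x @ z @ x) @ F c d" .
  then have "sublist (x @ y @ x @ z @ x) (map X [a'..<c' + (d - a)])"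
    unfolding sublist_def F_def by blast
  then obtain i j where "x @ y @ x @ z @ x = map X [i..<j]" by (rule sublist_map_uptE)
  moreover have "col y = col x" "col z = col x"
    unfolding y_def z_def x_def e(1) using return R_ne absorb absorb2 by blast+
  moreover have "col (x @ x) = col x" using ee[of x x] lt e by (simp add: x_def F_ne)
  ultimately show ?thesis using that[of x y z i j] lt by (simp add: x_def y_def z_def F_ne)
qed

section \<open>A criterion for the absence of a finite basis\<close>

text \<open>
  The Rees quotient of the free semigroup by the ideal of words that are not factors of \<open>U\<close>;
  \<open>None\<close> is its zero.
\<close>

definition factor_quotient :: "'a list \<Rightarrow> 'a list option monoid" where
  "factor_quotient U =
     \<lparr>carrier = insert None (Some ` {w. w \<noteq> [] \<and> sublist w U}),
      mult = (\<lambda>a b. case (a, b) of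
        (Some s, Some t) \<Rightarrow> if sublist (s @ t) U then Some (s @ t) else None | _ \<Rightarrow> None),
      one = None\<rparr>"

lemma sublist_appendD: "sublist (s @ t) U \<Longrightarrow> sublist s U \<and> sublist t U"
  by (meson prefix_imp_sublist prefixI sublist_order.order_trans suffix_imp_sublist suffixI)

lemma factor_quotient_mult [simp]:
  "Some s \<otimes>\<^bsub>factor_quotient U\<^esub> Some t = (if sublist (s @ t) U then Some (s @ t) else None)"
  "None \<otimes>\<^bsub>factor_quotient U\<^esub> b = None"
  "a \<otimes>\<^bsub>factor_quotient U\<^esub> None = None"
  by (auto simp: factor_quotient_def split: option.splits)

lemma is_semigroup_factor_quotient: "is_semigroup (factor_quotient U)"
  unfolding is_semigroup_def
proof (intro conjI ballI)
  fix a b assume "a \<in> carrier (factor_quotient U)" "b \<in> carrier (factor_quotient U)"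
  then show "a \<otimes>\<^bsub>factor_quotient U\<^esub> b \<in> carrier (factor_quotient U)"
    by (cases a; cases b) (auto simp: factor_quotient_def)
next
  fix a b c
  show "a \<otimes>\<^bsub>factor_quotient U\<^esub> b \<otimes>\<^bsub>factor_quotient U\<^esub> c =
    a \<otimes>\<^bsub>factor_quotient U\<^esub> (b \<otimes>\<^bsub>factor_quotient U\<^esub> c)"
  proof (cases "a = None \<or> b = None \<or> c = None")
    case False
    then obtain s t w where "a = Some s" "b = Some t" "c = Some w" by auto
    moreover have "sublist (s @ t @ w) U \<Longrightarrow> sublist (s @ t) U \<and> sublist (t @ w) U"
      using sublist_appendD[of "s @ t" w U] sublist_appendD[of s "t @ w" U] by simp
    ultimately show ?thesis by auto
  qed auto
qed

lemma free_semigroup_hom_append: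
  assumes "\<phi> \<in> hom free_semigroup S" "u \<noteq> []" "v \<noteq> []"
  shows "\<phi> (u @ v) = \<phi> u \<otimes>\<^bsub>S\<^esub> \<phi> v"
  using assms by (simp add: hom_def free_semigroup_def)

lemma free_semigroup_hom_closed:
  assumes "\<phi> \<in> hom free_semigroup S" "u \<noteq> []"
  shows "\<phi> u \<in> carrier S"
  using assms by (auto simp: hom_def free_semigroup_def)

lemma hom_factor_quotient:
  fixes U :: "nat list"
  assumes \<phi>: "\<phi> \<in> hom free_semigroup (factor_quotient U)" and "w \<noteq> []"
  shows "\<phi> w = (if (\<forall>a\<in>set w. \<phi> [a] \<noteq> None) \<and> sublist (concat (map (\<lambda>a. the (\<phi> [a])) w)) U
    then Some (concat (map (\<lambda>a. the (\<phi> [a])) w)) else None)"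
  using \<open>w \<noteq> []\<close>
proof (induction w rule: list_nonempty_induct)
  case (single a)
  have "\<phi> [a] \<in> carrier (factor_quotient U)" using \<phi> by (rule free_semigroup_hom_closed) simp
  then show ?case by (auto simp: factor_quotient_def)
next
  case (cons a w)
  define t where "t = concat (map (\<lambda>a. the (\<phi> [a])) w)"
  have "\<phi> ([a] @ w) = \<phi> [a] \<otimes>\<^bsub>factor_quotient U\<^esub> \<phi> w"
    using \<phi> cons by (intro free_semigroup_hom_append) auto
  then have "\<phi> (a # w) = \<phi> [a] \<otimes>\<^bsub>factor_quotient U\<^esub>
      (if (\<forall>a\<in>set w. \<phi> [a] \<noteq> None) \<and> sublist t U then Some t else None)"
    unfolding cons.IH t_def by simp
  moreover have "sublist t U" if "sublist (s @ t) U" for s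
    using sublist_appendD[OF that] by blast
  ultimately show ?case
    by (cases "\<phi> [a]") (simp_all flip: t_def)
qed

text \<open>
  The map \<open>\<pi>\<close> is a morphism to a finite magma.  Two nonempty words get the same colour if their images
  under \<open>\<pi> \<circ> \<phi>\<close> agree for every homomorphism \<open>\<phi>\<close> to \<open>S\<close>.  There are
  finitely many colours, because \<open>\<pi> \<circ> \<phi>\<close> is determined by its values at the finitely many
  letters.  The resulting identity \<open>x y x z x = x z x y x\<close> of \<open>S\<close> fails in the
  factor quotient, which satisfies the proposed finite basis.
\<close>

theorem not_finitely_based:
  fixes S :: "('a, 'm) monoid_scheme"
  assumes fin: "finite (\<pi> ` carrier S)"
    and morph: "\<And>a b. \<lbrakk>a \<in> carrier S; b \<in> carrier S\<rbrakk> \<Longrightarrow> \<pi> (a \<otimes>\<^bsub>S\<^esub> b) = \<mu> (\<pi> a) (\<pi> b)"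
    and interchange: "\<And>a b c. \<lbrakk>a \<in> carrier S; b \<in> carrier S; c \<in> carrier S;
        \<pi> b = \<pi> a; \<pi> c = \<pi> a; \<mu> (\<pi> a) (\<pi> a) = \<pi> a\<rbrakk> \<Longrightarrow>
        a \<otimes>\<^bsub>S\<^esub> (b \<otimes>\<^bsub>S\<^esub> (a \<otimes>\<^bsub>S\<^esub> (c \<otimes>\<^bsub>S\<^esub> a))) = a \<otimes>\<^bsub>S\<^esub> (c \<otimes>\<^bsub>S\<^esub> (a \<otimes>\<^bsub>S\<^esub> (b \<otimes>\<^bsub>S\<^esub> a)))"
    and equi_adjacent: "\<And>u v. \<lbrakk>(u, v) \<in> identities; holds_in (u, v) S\<rbrakk> \<Longrightarrow> equi_adjacent u v"
  shows "\<not> finitely_based S"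
proof
  assume "finitely_based S"
  then obtain \<Sigma> where \<Sigma>: "\<Sigma> \<subseteq> identities" "finite \<Sigma>" "\<forall>d\<in>\<Sigma>. holds_in d S"
    and basis: "\<And>e. e \<in> identities \<Longrightarrow> holds_in e S \<Longrightarrow> entails \<Sigma> e"
    unfolding finitely_based_def by blast
  define r where "r = 3 + (\<Sum>(u, v)\<in>\<Sigma>. card (set u) + card (set v))"
  have r: "3 \<le> r" by (simp add: r_def)
  have small: "card (set u) + 2 < r" "card (set v) + 2 < r" if "(u, v) \<in> \<Sigma>" for u v
  proof -
    have "(\<lambda>(u, v). card (set u) + card (set v)) (u, v) \<le> (\<Sum>(u, v)\<in>\<Sigma>. card (set u) + card (set v))"
      using \<Sigma>(2) that by (intro member_le_sum) auto
    then show "card (set u) + 2 < r" "card (set v) + 2 < r" by (simp_all add: r_def)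
  qed
  let ?W = "selfsim r" and ?A = "{..<r * r}"
  have W: "range ?W \<subseteq> ?A" using selfsim_less r by auto

  let ?H = "hom free_semigroup S"
  \<comment> \<open>Letters outside the finite alphabet are folded into it, so that colours are defined, and a
      congruence, for all words.\<close>
  define cl where "cl w = map (\<lambda>a. a mod (r * r)) w" for w
  have cl: "cl w \<in> lists ?A" "cl w = [] \<longleftrightarrow> w = []" "cl (u @ v) = cl u @ cl v" for w u v
    using r by (auto simp: cl_def)
  have cl_id: "cl w = w" if "w \<in> lists ?A" for w
    using that by (auto simp: cl_def intro!: map_idI)
  define gen where "gen \<phi> = restrict (\<lambda>a. \<pi> (\<phi> [a])) ?A" for \<phi> :: "nat list \<Rightarrow> 'a"
  define col where "col w = (if w = [] then {} else {(gen \<phi>, \<pi> (\<phi> (cl w))) |\<phi>. \<phi> \<in> ?H})" for w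
  have determined: "\<pi> (\<phi> w) = \<pi> (\<psi> w)"
    if "\<phi> \<in> ?H" "\<psi> \<in> ?H" "gen \<phi> = gen \<psi>" "w \<noteq> []" "w \<in> lists ?A" for \<phi> \<psi> w
    using that(4,5)
  proof (induction w rule: list_nonempty_induct)
    case (single a)
    then show ?case using fun_cong[OF that(3), of a] by (simp add: gen_def)
  next
    case (cons a w)
    then have "\<pi> (\<phi> [a]) = \<pi> (\<psi> [a])" using fun_cong[OF that(3), of a] by (simp add: gen_def)
    moreover have "\<pi> (\<chi> ([a] @ w)) = \<mu> (\<pi> (\<chi> [a])) (\<pi> (\<chi> w))" if "\<chi> \<in> ?H" for \<chi>
      using that cons(1) by (simp add: free_semigroup_hom_append[OF that, of "[a]" w, simplified] morph free_semigroup_hom_closed)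
    ultimately show ?case using cons that(1,2) by simp
  qed
  have colD: "\<pi> (\<phi> (cl u)) = \<pi> (\<phi> (cl v))" if "col u = col v" "u \<noteq> []" "v \<noteq> []" "\<phi> \<in> ?H" for u v \<phi>
  proof -
    have "(gen \<phi>, \<pi> (\<phi> (cl u))) \<in> col u" using that(2,4) by (auto simp: col_def)
    then have "(gen \<phi>, \<pi> (\<phi> (cl u))) \<in> col v" using that(1) by simp
    then obtain \<psi> where "\<psi> \<in> ?H" "gen \<phi> = gen \<psi>" "\<pi> (\<phi> (cl u)) = \<pi> (\<psi> (cl v))"
      using \<open>v \<noteq> []\<close> by (auto simp: col_def)
    then show ?thesis using determined[of \<phi> \<psi> "cl v"] that cl by simp
  qed
  have mult: "\<pi> (\<phi> (u @ v)) = \<mu> (\<pi> (\<phi> u)) (\<pi> (\<phi> v))" if "\<phi> \<in> ?H" "u \<noteq> []" "v \<noteq> []" for \<phi> u v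
    using that by (simp add: free_semigroup_hom_append morph free_semigroup_hom_closed)

  obtain x y z i j where xyz: "x \<noteq> []" "y \<noteq> []" "z \<noteq> []" "x @ y @ x @ z @ x = map ?W [i..<j]"
    "col y = col x" "col z = col x" "col (x @ x) = col x"
  proof (rule recurrent_monochromatic[of ?W col ?A])
    fix l
    have "l < r ^ l" using r by (intro power_gt_expt) simp
    then have "range (\<lambda>n. r ^ l * (r * r * n)) \<subseteq> {n. \<forall>q<l. ?W (n + q) = ?W q}"
      using r by (auto intro!: selfsim_recurrent)
    moreover have "inj (\<lambda>n. r ^ l * (r * r * n))" using r by (auto intro!: injI)
    then have "infinite (range (\<lambda>n. r ^ l * (r * r * n)))" by (simp add: finite_image_iff)
    ultimately show "infinite {n. \<forall>q<l. ?W (n + q) = ?W q}" using finite_subset by blast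
  next
    have "col w \<subseteq> (?A \<rightarrow>\<^sub>E \<pi> ` carrier S) \<times> \<pi> ` carrier S" for w
      using cl by (auto simp: col_def gen_def free_semigroup_hom_closed split: if_splits)
    then have "col ` lists ?A \<subseteq> Pow ((?A \<rightarrow>\<^sub>E \<pi> ` carrier S) \<times> \<pi> ` carrier S)" by blast
    then show "finite (col ` lists ?A)"
      by (rule finite_subset) (intro finite_Pow_iff[THEN iffD2] finite_cartesian_product finite_PiE fin, simp_all)
  next
    fix u u' v v' :: "nat list"
    assume "u \<noteq> []" "u' \<noteq> []" "v \<noteq> []" "v' \<noteq> []" "col u = col u'" "col v = col v'"
    then have "\<pi> (\<phi> (cl (u @ v))) = \<pi> (\<phi> (cl (u' @ v')))" if "\<phi> \<in> ?H" for \<phi>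
      using that colD[of u u' \<phi>] colD[of v v' \<phi>] by (simp add: cl mult)
    then show "col (u @ v) = col (u' @ v')"
      using \<open>u \<noteq> []\<close> \<open>u' \<noteq> []\<close> by (auto simp: col_def)
  qed (use W in auto)
  define U V where "U = x @ y @ x @ z @ x" and "V = x @ z @ x @ y @ x"
  have UV: "(U, V) \<in> identities" using xyz(1-3) by (simp add: identities_def free_semigroup_def U_def V_def)
  have "U \<in> lists ?A" using W xyz(4) by (auto simp: U_def image_subset_iff)
  then have xyzA: "x \<in> lists ?A" "y \<in> lists ?A" "z \<in> lists ?A" by (auto simp: U_def)
  have "holds_in (U, V) S"
    unfolding holds_in_def fst_conv snd_conv
  proof
    fix \<phi> assume \<phi>: "\<phi> \<in> ?H"
    have "\<pi> (\<phi> y) = \<pi> (\<phi> x)" "\<pi> (\<phi> z) = \<pi> (\<phi> x)" "\<pi> (\<phi> (x @ x)) = \<pi> (\<phi> x)"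
      using colD[of y x \<phi>] colD[of z x \<phi>] colD[of "x @ x" x \<phi>] xyz \<phi> xyzA by (simp_all add: cl_id)
    moreover from this(3) have "\<mu> (\<pi> (\<phi> x)) (\<pi> (\<phi> x)) = \<pi> (\<phi> x)"
      using mult[OF \<phi> xyz(1,1)] by simp
    ultimately show "\<phi> U = \<phi> V"
      unfolding U_def V_def using xyz(1-3)
      by (simp add: free_semigroup_hom_append[OF \<phi>] interchange free_semigroup_hom_closed[OF \<phi>])
  qed
  then have ent: "entails \<Sigma> (U, V)" using basis UV by blast
  have "U \<noteq> V"
  proof
    assume "U = V"
    then have "(y @ x) @ (z @ x) = (z @ x) @ (y @ x)" by (simp add: U_def V_def)
    moreover have "map ?W [i..<j] = x @ ((y @ x) @ (z @ x)) @ []" using xyz(4) by simp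
    then have "sublist ((y @ x) @ (z @ x)) (map ?W [i..<j])" unfolding sublist_def by blast
    then obtain i' j' where "(y @ x) @ (z @ x) = map ?W [i'..<j']" by (rule sublist_map_uptE)
    then have "(y @ x) @ (z @ x) \<noteq> (z @ x) @ (y @ x)"
      using xyz by (intro map_selfsim_no_commuting_factor[OF r]) auto
    ultimately show False by contradiction
  qed

  let ?Q = "factor_quotient U"
  have half: "\<phi> u = \<phi> v"
    if ids: "(u, v) \<in> identities" and hold: "holds_in (u, v) S" and card: "card (set u) + 2 < r"
      and \<phi>: "\<phi> \<in> hom free_semigroup ?Q" and def: "\<phi> u \<noteq> None" for u v \<phi>
  proof -
    have c: "equi_adjacent u v" by (rule equi_adjacent[OF ids hold])
    have ne: "u \<noteq> []" "v \<noteq> []" using ids by (auto simp: identities_def free_semigroup_def)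
    define \<theta> where "\<theta> a = the (\<phi> [a])" for a
    from def hom_factor_quotient[OF \<phi> ne(1)]
    have u: "\<forall>a\<in>set u. \<phi> [a] \<noteq> None" "sublist (concat (map \<theta> u)) U" "\<phi> u = Some (concat (map \<theta> u))"
      unfolding \<theta>_def by (auto split: if_splits)
    have "sublist (concat (map \<theta> u)) (map ?W [i..<j])" using u(2) xyz(4) by (simp add: U_def)
    then obtain i' j' where "concat (map \<theta> u) = map ?W [i'..<j']" by (rule sublist_map_uptE)
    then have "concat (map \<theta> v) = concat (map \<theta> u)"
      by (rule equi_adjacent_image_selfsim[OF c card])
    then show ?thesis
      using hom_factor_quotient[OF \<phi> ne(2), folded \<theta>_def] u equi_adjacent_set[OF c] by simp
  qed
  have "\<forall>d\<in>\<Sigma>. holds_in d ?Q"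
  proof
    fix d assume d: "d \<in> \<Sigma>"
    obtain u v where uv: "d = (u, v)" by (cases d)
    have "(u, v) \<in> identities" "holds_in (u, v) S" using d uv \<Sigma> by auto
    moreover then have "(v, u) \<in> identities" "holds_in (v, u) S"
      by (auto simp: identities_def holds_in_def)
    ultimately show "holds_in d ?Q"
      using half[of u v] half[of v u] small d unfolding uv holds_in_def by (metis fst_conv snd_conv)
  qed
  then have "holds_in (U, V) ?Q"
    by (rule entails_holds_in[OF ent \<Sigma>(1) UV is_semigroup_factor_quotient])
  moreover define \<iota> where "\<iota> w = (if sublist w U then Some w else None)" for w
  have "\<iota> \<in> hom free_semigroup ?Q"
  proof -
    have "\<iota> (u @ v) = \<iota> u \<otimes>\<^bsub>?Q\<^esub> \<iota> v" if "u \<noteq> []" "v \<noteq> []" for u v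
      using sublist_appendD[of u v U] by (auto simp: \<iota>_def)
    then show ?thesis
      by (auto simp: hom_def free_semigroup_def \<iota>_def factor_quotient_def)
  qed
  ultimately have "\<iota> U = \<iota> V" unfolding holds_in_def by simp
  moreover have "\<iota> U = Some U" by (simp add: \<iota>_def)
  ultimately show False using \<open>U \<noteq> V\<close> by (simp add: \<iota>_def split: if_splits)
qed

section \<open>Blocks and labels of a product of partitions\<close>

definition glue :: "part \<Rightarrow> part \<Rightarrow> (vert3 \<times> vert3) set" where
  "glue \<alpha> \<beta> = (\<Union>B \<in> (`) emb12 ` \<alpha> \<union> (`) emb23 ` \<beta>. B \<times> B)"

lemma glue_iff:
  "(x, y) \<in> glue \<alpha> \<beta> \<longleftrightarrow>
    (\<exists>A\<in>\<alpha>. x \<in> emb12 ` A \<and> y \<in> emb12 ` A) \<or> (\<exists>B\<in>\<beta>. x \<in> emb23 ` B \<and> y \<in> emb23 ` B)"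
  by (auto simp: glue_def)

lemma join3_glue: "join3 n \<alpha> \<beta> = verts3 n // (glue \<alpha> \<beta>)\<^sup>+"
  by (simp add: join3_def glue_def)

lemma emb_simps [simp]:
  "emb12 (Inl i) = Inl i" "emb12 (Inr i) = Inr (Inl i)"
  "emb23 (Inl i) = Inr (Inl i)" "emb23 (Inr i) = Inr (Inr i)"
  "emb13 (Inl i) = Inl i" "emb13 (Inr i) = Inr (Inr i)"
  by (simp_all add: emb12_def emb23_def emb13_def)

lemma inj_emb [simp]: "inj emb12" "inj emb23"
  by (auto intro!: injI simp: emb12_def emb23_def split: sum.splits)

lemma emb_eq_simps [simp]:
  "emb12 x = Inl i \<longleftrightarrow> x = Inl i" "emb12 x = Inr (Inl i) \<longleftrightarrow> x = Inr i" "emb12 x \<noteq> Inr (Inr i)"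
  "emb23 x \<noteq> Inl i" "emb23 x = Inr (Inl i) \<longleftrightarrow> x = Inl i" "emb23 x = Inr (Inr i) \<longleftrightarrow> x = Inr i"
  by (cases x; simp)+

lemma verts_simps [simp]:
  "Inl i \<in> verts n \<longleftrightarrow> i \<in> {1..n}" "Inr i \<in> verts n \<longleftrightarrow> i \<in> {1..n}"
  by (auto simp: verts_def)

lemma verts3_simps [simp]:
  "Inl i \<in> verts3 n \<longleftrightarrow> i \<in> {1..n}" "Inr (Inl i) \<in> verts3 n \<longleftrightarrow> i \<in> {1..n}"
  "Inr (Inr i) \<in> verts3 n \<longleftrightarrow> i \<in> {1..n}"
  by (auto simp: verts3_def)

lemma middle_simps [simp]:
  "Inl i \<notin> middle n" "Inr (Inl i) \<in> middle n \<longleftrightarrow> i \<in> {1..n}" "Inr (Inr i) \<notin> middle n"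
  by (auto simp: middle_def)

lemma emb_verts3 [simp]:
  "emb12 x \<in> verts3 n \<longleftrightarrow> x \<in> verts n" "emb23 x \<in> verts3 n \<longleftrightarrow> x \<in> verts n"
  "emb13 x \<in> verts3 n \<longleftrightarrow> x \<in> verts n"
  by (cases x; simp)+

lemma finite_parts: "finite (parts n)"
proof -
  have "parts n \<subseteq> Pow (Pow (verts n))" by (auto simp: parts_def partition_on_def)
  then show ?thesis by (rule finite_subset) (simp add: verts_def)
qed

lemma parts_finite: "\<alpha> \<in> parts n \<Longrightarrow> finite \<alpha>"
  using finite_elements[of "verts n" \<alpha>] by (simp add: parts_def verts_def)

lemma parts_Union: "\<alpha> \<in> parts n \<Longrightarrow> \<Union>\<alpha> = verts n"
  by (simp add: parts_def partition_on_def)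

lemma parts_subset: "\<alpha> \<in> parts n \<Longrightarrow> A \<in> \<alpha> \<Longrightarrow> A \<subseteq> verts n"
  using parts_Union by blast

lemma parts_cover:
  assumes "\<alpha> \<in> parts n" "x \<in> verts n"
  obtains A where "A \<in> \<alpha>" "x \<in> A"
  using assms parts_Union by blast

lemma parts_nonempty: "\<alpha> \<in> parts n \<Longrightarrow> A \<in> \<alpha> \<Longrightarrow> A \<noteq> {}"
  by (auto simp: parts_def partition_on_def)

lemma parts_eq: "\<lbrakk>\<alpha> \<in> parts n; A \<in> \<alpha>; B \<in> \<alpha>; x \<in> A; x \<in> B\<rbrakk> \<Longrightarrow> A = B"
  unfolding parts_def partition_on_def disjoint_def by blast

lemma equiv_glue:
  assumes "\<alpha> \<in> parts n" "\<beta> \<in> parts n"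
  shows "equiv (verts3 n) ((glue \<alpha> \<beta>)\<^sup>+)"
proof (rule equivI)
  have sub: "glue \<alpha> \<beta> \<subseteq> verts3 n \<times> verts3 n"
    using parts_subset[OF assms(1)] parts_subset[OF assms(2)] by (auto simp: glue_iff subset_iff)
  then show "(glue \<alpha> \<beta>)\<^sup>+ \<subseteq> verts3 n \<times> verts3 n"
    by (rule trancl_subset_Sigma)
  have "(x, x) \<in> glue \<alpha> \<beta>" if "x \<in> verts3 n" for x
  proof -
    have "\<exists>y\<in>verts n. x = emb12 y \<or> x = emb23 y"
    proof (cases x)
      case (Inl i) then show ?thesis using that by (intro bexI[of _ "Inl i"]) auto
    next
      case (Inr y) note xy = this
      show ?thesis
      proof (cases y)
        case (Inl i) then show ?thesis using that xy by (intro bexI[of _ "Inr i"]) auto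
      next
        case (Inr i) then show ?thesis using that xy by (intro bexI[of _ "Inr i"]) auto
      qed
    qed
    then show ?thesis
      using parts_cover[OF assms(1)] parts_cover[OF assms(2)] by (auto simp: glue_iff) (metis imageI)+
  qed
  then show "refl_on (verts3 n) ((glue \<alpha> \<beta>)\<^sup>+)"
    by (auto intro!: refl_onI)
  show "sym ((glue \<alpha> \<beta>)\<^sup>+)"
    by (rule sym_trancl) (auto simp: sym_def glue_iff)
qed simp

lemma partition_on_join3:
  assumes "\<alpha> \<in> parts n" "\<beta> \<in> parts n"
  shows "partition_on (verts3 n) (join3 n \<alpha> \<beta>)"
  unfolding join3_glue using equiv_glue[OF assms] by (rule partition_on_quotient)

lemma join3_closed:
  assumes "\<alpha> \<in> parts n" "\<beta> \<in> parts n" "C \<in> join3 n \<alpha> \<beta>" "x \<in> C" "(x, y) \<in> glue \<alpha> \<beta>"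
  shows "y \<in> C"
  using assms quotient_eq_iff[OF equiv_glue[OF assms(1,2)]] in_quotient_imp_closed[OF equiv_glue[OF assms(1,2)]]
  unfolding join3_glue by blast

lemma join3_blockI:
  assumes ab: "\<alpha> \<in> parts n" "\<beta> \<in> parts n"
    and C: "C \<subseteq> verts3 n" "C \<noteq> {}"
    and closed: "\<And>A x. \<lbrakk>A \<in> \<alpha>; x \<in> A; emb12 x \<in> C\<rbrakk> \<Longrightarrow> emb12 ` A \<subseteq> C"
      "\<And>B x. \<lbrakk>B \<in> \<beta>; x \<in> B; emb23 x \<in> C\<rbrakk> \<Longrightarrow> emb23 ` B \<subseteq> C"
    and hub: "\<And>x. x \<in> C \<Longrightarrow> (x, h) \<in> (glue \<alpha> \<beta>)\<^sup>+"
  shows "C \<in> join3 n \<alpha> \<beta>"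
proof -
  obtain c where c: "c \<in> C" using C by blast
  have eq: "equiv (verts3 n) ((glue \<alpha> \<beta>)\<^sup>+)" by (rule equiv_glue[OF ab])
  have "(glue \<alpha> \<beta>)\<^sup>+ `` {c} = C"
  proof (intro equalityI subsetI)
    fix x assume "x \<in> (glue \<alpha> \<beta>)\<^sup>+ `` {c}"
    then have "(c, x) \<in> (glue \<alpha> \<beta>)\<^sup>+" by simp
    then show "x \<in> C"
    proof induction
      case (base y) then show ?case using closed c unfolding glue_iff by blast
    next
      case (step y z) then show ?case using closed unfolding glue_iff by blast
    qed
  next
    fix x assume "x \<in> C"
    then have "(x, h) \<in> (glue \<alpha> \<beta>)\<^sup>+" "(c, h) \<in> (glue \<alpha> \<beta>)\<^sup>+" using hub c by auto
    then show "x \<in> (glue \<alpha> \<beta>)\<^sup>+ `` {c}"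
      using eq by (auto simp: equiv_def dest: symD intro: trancl_trans)
  qed
  then show ?thesis unfolding join3_glue using c C by (metis quotientI subsetD)
qed

lemma join3_image12:
  assumes ab: "\<alpha> \<in> parts n" "\<beta> \<in> parts n" and A: "A \<in> \<alpha>"
    and closed: "\<And>B x. \<lbrakk>B \<in> \<beta>; x \<in> B; emb23 x \<in> emb12 ` A\<rbrakk> \<Longrightarrow> emb23 ` B \<subseteq> emb12 ` A"
  shows "emb12 ` A \<in> join3 n \<alpha> \<beta>"
proof -
  obtain a where a: "a \<in> A" using parts_nonempty[OF ab(1) A] by blast
  show ?thesis
  proof (rule join3_blockI[OF ab, of _ "emb12 a"])
    show "emb12 ` A \<subseteq> verts3 n" using parts_subset[OF ab(1) A] by auto
    show "emb12 ` A \<noteq> {}" using a by blast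
    show "emb12 ` A' \<subseteq> emb12 ` A" if "A' \<in> \<alpha>" "x \<in> A'" "emb12 x \<in> emb12 ` A" for A' x
      using that parts_eq[OF ab(1) that(1) A] by (auto simp: inj_image_mem_iff[OF inj_emb(1)])
    show "(x, emb12 a) \<in> (glue \<alpha> \<beta>)\<^sup>+" if "x \<in> emb12 ` A" for x
      using that a A by (intro r_into_trancl) (auto simp: glue_iff)
  qed (use closed in blast)
qed

lemma join3_image23:
  assumes ab: "\<alpha> \<in> parts n" "\<beta> \<in> parts n" and B: "B \<in> \<beta>"
    and closed: "\<And>A x. \<lbrakk>A \<in> \<alpha>; x \<in> A; emb12 x \<in> emb23 ` B\<rbrakk> \<Longrightarrow> emb12 ` A \<subseteq> emb23 ` B"
  shows "emb23 ` B \<in> join3 n \<alpha> \<beta>"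
proof -
  obtain b where b: "b \<in> B" using parts_nonempty[OF ab(2) B] by blast
  show ?thesis
  proof (rule join3_blockI[OF ab, of _ "emb23 b"])
    show "emb23 ` B \<subseteq> verts3 n" using parts_subset[OF ab(2) B] by auto
    show "emb23 ` B \<noteq> {}" using b by blast
    show "emb23 ` B' \<subseteq> emb23 ` B" if "B' \<in> \<beta>" "x \<in> B'" "emb23 x \<in> emb23 ` B" for B' x
      using that parts_eq[OF ab(2) that(1) B] by (auto simp: inj_image_mem_iff[OF inj_emb(2)])
    show "(x, emb23 b) \<in> (glue \<alpha> \<beta>)\<^sup>+" if "x \<in> emb23 ` B" for x
      using that b B by (intro r_into_trancl) (auto simp: glue_iff)
  qed (use closed in blast)
qed

lemma join3_eq:
  assumes ab: "\<alpha> \<in> parts n" "\<beta> \<in> parts n"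
    and P: "\<Union>P = verts3 n" "P \<subseteq> join3 n \<alpha> \<beta>"
  shows "join3 n \<alpha> \<beta> = P"
proof
  show "join3 n \<alpha> \<beta> \<subseteq> P"
  proof
    fix C assume C: "C \<in> join3 n \<alpha> \<beta>"
    have p: "partition_on (verts3 n) (join3 n \<alpha> \<beta>)" by (rule partition_on_join3[OF ab])
    obtain x where x: "x \<in> C" using C p by (metis all_not_in_conv partition_onD3)
    then have "x \<in> \<Union>P" using C p P by (auto simp: partition_on_def)
    then obtain D where "D \<in> P" "x \<in> D" by blast
    then have "C = D" using x C P(2) p unfolding partition_on_def disjoint_def by blast
    then show "C \<in> P" using \<open>D \<in> P\<close> by simp
  qed
qed (rule P)

lemma label_mult_block:
  assumes ab: "\<alpha> \<in> parts n" "\<beta> \<in> parts n" and C: "C \<in> join3 n \<alpha> \<beta>" "emb13 -` C = D" "D \<noteq> {}"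
  shows "label_mult n \<alpha> g \<beta> h D = label3 n \<alpha> g \<beta> h C"
proof -
  have "D \<in> part_mult n \<alpha> \<beta>" using C by (auto simp: part_mult_def)
  moreover have "(THE C. C \<in> join3 n \<alpha> \<beta> \<and> emb13 ` D \<subseteq> C) = C"
  proof (rule the_equality)
    fix C' assume C': "C' \<in> join3 n \<alpha> \<beta> \<and> emb13 ` D \<subseteq> C'"
    obtain x where "x \<in> D" using C by blast
    then have "emb13 x \<in> C \<inter> C'" using C C' by auto
    then show "C' = C"
      using partition_on_join3[OF ab] C C' unfolding partition_on_def disjoint_def by blast
  qed (use C in auto)
  ultimately show ?thesis by (simp add: label_mult_def)
qed

lemma label3_eq:
  assumes "{A \<in> \<alpha>. emb12 ` A \<subseteq> C} = As" "{B \<in> \<beta>. emb23 ` B \<subseteq> C} = Bs"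
  shows "label3 n \<alpha> g \<beta> h C = (\<Sum>A\<in>As. g A) + (\<Sum>B\<in>Bs. h B) + int (card (C \<inter> middle n))
        - (int (card As) + int (card Bs)) + 1"
  using assms by (simp add: label3_def)

section \<open>Interchange over an idempotent partition\<close>

context
  fixes n :: nat and \<epsilon> :: part
  assumes \<epsilon>: "\<epsilon> \<in> parts n" and idem: "part_mult n \<epsilon> \<epsilon> = \<epsilon>"
begin

text \<open>
  A block of incoming vertices only is not touched by the second factor.
\<close>

lemma label_mult_upper:
  assumes B: "B \<in> \<epsilon>" "B \<subseteq> range Inl"
  shows "label_mult n \<epsilon> g \<epsilon> h B = g B"
proof -
  define C where "C = emb12 ` B"
  have vert: "x \<in> C \<Longrightarrow> x \<in> range Inl" for x using B by (auto simp: C_def)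
  have B_verts: "B \<subseteq> verts n" "B \<noteq> {}" using parts_subset[OF \<epsilon> B(1)] parts_nonempty[OF \<epsilon> B(1)] by auto
  have inB: "emb12 x \<in> C \<longleftrightarrow> x \<in> B" for x
    unfolding C_def by (auto dest: injD[OF inj_emb(1)])
  have notin: "emb23 x \<notin> C" for x
    using vert[of "emb23 x"] by (cases x) auto
  have "C \<in> join3 n \<epsilon> \<epsilon>"
    unfolding C_def by (rule join3_image12[OF \<epsilon> \<epsilon> B(1)]) (use notin in \<open>auto simp: C_def\<close>)
  moreover have "emb13 -` C = B"
  proof -
    have "emb13 x \<in> C \<longleftrightarrow> x \<in> B" for x
    proof (cases x)
      case (Inl i) then show ?thesis using inB[of x] by simp
    next
      case (Inr i) then show ?thesis using vert[of "emb13 x"] B(2) by auto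
    qed
    then show ?thesis by auto
  qed
  ultimately have "label_mult n \<epsilon> g \<epsilon> h B = label3 n \<epsilon> g \<epsilon> h C"
    using label_mult_block[OF \<epsilon> \<epsilon>] B_verts by blast
  also have "\<dots> = g B"
  proof -
    have "A = B" if A: "A \<in> \<epsilon>" "emb12 ` A \<subseteq> C" for A
    proof -
      obtain x where "x \<in> A" using parts_nonempty[OF \<epsilon> A(1)] by blast
      then show ?thesis using parts_eq[OF \<epsilon> A(1) B(1)] A(2) inB by blast
    qed
    then have As: "{A \<in> \<epsilon>. emb12 ` A \<subseteq> C} = {B}"
      using B(1) by (auto simp: C_def)
    have Bs: "{A \<in> \<epsilon>. emb23 ` A \<subseteq> C} = {}"
      using notin parts_nonempty[OF \<epsilon>] by (auto simp: image_subset_iff)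
    have "C \<inter> middle n = {}" using vert by (auto simp: middle_def)
    then show ?thesis unfolding label3_eq[OF As Bs] by simp
  qed
  finally show ?thesis .
qed

lemma label_mult_lower:
  assumes B: "B \<in> \<epsilon>" "B \<subseteq> range Inr"
  shows "label_mult n \<epsilon> g \<epsilon> h B = h B"
proof -
  define C where "C = emb23 ` B"
  have vert: "x \<in> C \<Longrightarrow> x \<in> range (\<lambda>i. Inr (Inr i))" for x using B by (auto simp: C_def)
  have B_verts: "B \<subseteq> verts n" "B \<noteq> {}" using parts_subset[OF \<epsilon> B(1)] parts_nonempty[OF \<epsilon> B(1)] by auto
  have inB: "emb23 x \<in> C \<longleftrightarrow> x \<in> B" for x
    unfolding C_def by (auto dest: injD[OF inj_emb(2)])
  have notin: "emb12 x \<notin> C" for x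
    using vert[of "emb12 x"] by (cases x) auto
  have "C \<in> join3 n \<epsilon> \<epsilon>"
    unfolding C_def by (rule join3_image23[OF \<epsilon> \<epsilon> B(1)]) (use notin in \<open>auto simp: C_def\<close>)
  moreover have "emb13 -` C = B"
  proof -
    have "emb13 x \<in> C \<longleftrightarrow> x \<in> B" for x
    proof (cases x)
      case (Inr i) then show ?thesis using inB[of x] by simp
    next
      case (Inl i) then show ?thesis using vert[of "emb13 x"] B(2) by auto
    qed
    then show ?thesis by auto
  qed
  ultimately have "label_mult n \<epsilon> g \<epsilon> h B = label3 n \<epsilon> g \<epsilon> h C"
    using label_mult_block[OF \<epsilon> \<epsilon>] B_verts by blast
  also have "\<dots> = h B"
  proof -
    have "A = B" if A: "A \<in> \<epsilon>" "emb23 ` A \<subseteq> C" for A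
    proof -
      obtain x where "x \<in> A" using parts_nonempty[OF \<epsilon> A(1)] by blast
      then show ?thesis using parts_eq[OF \<epsilon> A(1) B(1)] A(2) inB by blast
    qed
    then have Bs: "{A \<in> \<epsilon>. emb23 ` A \<subseteq> C} = {B}"
      using B(1) by (auto simp: C_def)
    have As: "{A \<in> \<epsilon>. emb12 ` A \<subseteq> C} = {}"
      using notin parts_nonempty[OF \<epsilon>] by (auto simp: image_subset_iff)
    have "C \<inter> middle n = {}" using vert by (auto simp: middle_def)
    then show ?thesis unfolding label3_eq[OF As Bs] by simp
  qed
  finally show ?thesis .
qed

definition agree_lower :: "label \<Rightarrow> label \<Rightarrow> bool" where
  "agree_lower g g' \<longleftrightarrow> (\<forall>A\<in>\<epsilon>. A \<subseteq> range Inr \<longrightarrow> g A = g' A)"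

definition agree_upper :: "label \<Rightarrow> label \<Rightarrow> bool" where
  "agree_upper g g' \<longleftrightarrow> (\<forall>A\<in>\<epsilon>. A \<subseteq> range Inl \<longrightarrow> g A = g' A)"

text \<open>
  Dead blocks consist of lower blocks of the first factor and upper blocks of the second one.
\<close>

lemma dead_count_cong:
  assumes "agree_lower g g'" "agree_upper h h'"
  shows "dead_count n \<epsilon> g \<epsilon> h = dead_count n \<epsilon> g' \<epsilon> h'"
proof -
  have "label3 n \<epsilon> g \<epsilon> h C = label3 n \<epsilon> g' \<epsilon> h' C" if "C \<in> dead_blocks n \<epsilon> \<epsilon>" for C
  proof -
    have mid: "C \<subseteq> middle n" using that by (simp add: dead_blocks_def)
    have "A \<subseteq> range Inr" if "emb12 ` A \<subseteq> C" for A
    proof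
      fix x assume "x \<in> A"
      then have "emb12 x \<in> middle n" using that mid by blast
      then show "x \<in> range Inr" by (cases x) auto
    qed
    moreover have "A \<subseteq> range Inl" if "emb23 ` A \<subseteq> C" for A
    proof
      fix x assume "x \<in> A"
      then have "emb23 x \<in> middle n" using that mid by blast
      then show "x \<in> range Inl" by (cases x) auto
    qed
    ultimately show ?thesis
      using assms unfolding label3_def Let_def agree_lower_def agree_upper_def
      by (auto intro!: arg_cong2[where f = "(+)"] sum.cong)
  qed
  then show ?thesis unfolding dead_count_def by (intro ext arg_cong[where f = "\<lambda>S. int (card S)"]) auto
qed

text \<open>
  Let \<open>C\<close> be the component that contains the transversal block \<open>B\<close> of the product.
  A block of the first factor that lies in \<open>C\<close> and contains an incoming vertex is equal to
  \<open>B\<close>, as the incoming vertices of \<open>C\<close> are those of \<open>B\<close> by idempotence; and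
  likewise for the second factor.  So the label of \<open>B\<close> in the product is the sum of its labels in the
  factors and of a term that depends only on lower blocks of the first and upper blocks of the second
  factor.
\<close>

lemma label_mult_transversal_cong:
  assumes agree: "agree_lower g g'" "agree_upper h h'"
    and B: "B \<in> \<epsilon>" "\<not> B \<subseteq> range Inl" "\<not> B \<subseteq> range Inr"
  shows "label_mult n \<epsilon> g \<epsilon> h B - g B - h B = label_mult n \<epsilon> g' \<epsilon> h' B - g' B - h' B"
proof -
  obtain i j where ij: "Inl i \<in> B" "Inr j \<in> B"
    using B(2,3) by (metis rangeI subsetI sum.exhaust)
  have "B \<in> part_mult n \<epsilon> \<epsilon>" using B idem by simp
  then obtain C where C: "C \<in> join3 n \<epsilon> \<epsilon>" "emb13 -` C = B" by (auto simp: part_mult_def)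
  have "B \<noteq> {}" using ij by blast
  note L = label_mult_block[OF \<epsilon> \<epsilon> C this]
  have Inl_C: "Inl k \<in> C \<longleftrightarrow> Inl k \<in> B" and Inr_C: "Inr (Inr k) \<in> C \<longleftrightarrow> Inr k \<in> B" for k
    using C(2) by (auto simp flip: C(2))
  have B12: "emb12 ` B \<subseteq> C"
    using join3_closed[OF \<epsilon> \<epsilon> C(1), of "Inl i"] ij Inl_C B(1) by (auto simp: glue_iff) (metis emb_simps(1) imageI)
  have B23: "emb23 ` B \<subseteq> C"
    using join3_closed[OF \<epsilon> \<epsilon> C(1), of "Inr (Inr j)"] ij Inr_C B(1) by (auto simp: glue_iff) (metis emb_simps(4) imageI)
  define Lo Up where "Lo = {A \<in> \<epsilon>. emb12 ` A \<subseteq> C \<and> A \<subseteq> range Inr}"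
    and "Up = {A \<in> \<epsilon>. emb23 ` A \<subseteq> C \<and> A \<subseteq> range Inl}"
  have As: "{A \<in> \<epsilon>. emb12 ` A \<subseteq> C} = insert B Lo"
  proof -
    have "A = B" if "A \<in> \<epsilon>" "emb12 ` A \<subseteq> C" and A: "\<not> A \<subseteq> range Inr" for A
    proof -
      obtain k where "Inl k \<in> A" using A by (metis rangeI subsetI sum.exhaust)
      moreover then have "Inl k \<in> B" using that(2) Inl_C by (metis emb_simps(1) image_subset_iff)
      ultimately show ?thesis using parts_eq[OF \<epsilon>] that(1) B(1) by blast
    qed
    then show ?thesis unfolding Lo_def using B(1) B12 by blast
  qed
  have Bs: "{A \<in> \<epsilon>. emb23 ` A \<subseteq> C} = insert B Up"
  proof -
    have "A = B" if "A \<in> \<epsilon>" "emb23 ` A \<subseteq> C" and A: "\<not> A \<subseteq> range Inl" for A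
    proof -
      obtain k where "Inr k \<in> A" using A by (metis rangeI subsetI sum.exhaust)
      moreover then have "Inr k \<in> B" using that(2) Inr_C by (metis emb_simps(4) image_subset_iff)
      ultimately show ?thesis using parts_eq[OF \<epsilon>] that(1) B(1) by blast
    qed
    then show ?thesis unfolding Up_def using B(1) B23 by blast
  qed
  have fin: "finite Lo" "finite Up" and nin: "B \<notin> Lo" "B \<notin> Up"
    using parts_finite[OF \<epsilon>] B by (auto simp: Lo_def Up_def)
  have "sum g Lo = sum g' Lo" "sum h Up = sum h' Up"
    using agree by (auto simp: Lo_def Up_def agree_lower_def agree_upper_def intro!: sum.cong)
  then show ?thesis
    unfolding L label3_eq[OF As Bs] using fin nin by simp
qed

text \<open>
  Each label is a sum of labels of the factors and of terms for neighbouring pairs of factors.  Both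
  products have the neighbours \<open>a b\<close>, \<open>b a\<close>, \<open>a c\<close>, \<open>c a\<close>, each once, and both begin
  and end with \<open>a\<close>.
\<close>

lemma label_interchange:
  defines "M \<equiv> \<lambda>g h. label_mult n \<epsilon> g \<epsilon> h" and "D \<equiv> \<lambda>g h. dead_count n \<epsilon> g \<epsilon> h"
  shows "M a (M b (M a (M c a))) = M a (M c (M a (M b a)))"
    and "D c a i + (D a (M c a) i + (D b (M a (M c a)) i + D a (M b (M a (M c a))) i)) =
         D b a i + (D a (M b a) i + (D c (M a (M b a)) i + D a (M c (M a (M b a))) i))"
proof -
  have up: "agree_upper (M g h) g" for g h
    using label_mult_upper by (simp add: agree_upper_def M_def)
  have refl: "agree_upper g g" "agree_lower g g" for g
    by (simp_all add: agree_upper_def agree_lower_def)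
  have D: "D g (M h k) = D g h" for g h k
    unfolding D_def by (rule dead_count_cong[OF refl(2) up])
  show "D c a i + (D a (M c a) i + (D b (M a (M c a)) i + D a (M b (M a (M c a))) i)) =
         D b a i + (D a (M b a) i + (D c (M a (M b a)) i + D a (M c (M a (M b a))) i))"
    by (simp add: D)
  show "M a (M b (M a (M c a))) = M a (M c (M a (M b a)))"
  proof
    fix B
    consider "B \<notin> \<epsilon>" | "B \<in> \<epsilon>" "B \<subseteq> range Inl" | "B \<in> \<epsilon>" "B \<subseteq> range Inr"
      | "B \<in> \<epsilon>" "\<not> B \<subseteq> range Inl" "\<not> B \<subseteq> range Inr" by blast
    then show "M a (M b (M a (M c a))) B = M a (M c (M a (M b a))) B"
    proof cases
      case 1 then show ?thesis by (simp add: M_def label_mult_def idem)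
    next
      case 2 then show ?thesis by (simp add: M_def label_mult_upper)
    next
      case 3 then show ?thesis by (simp add: M_def label_mult_lower)
    next
      case 4
      define J where "J g h = M g h B - g B - h B" for g h
      \<comment> \<open>A product has the upper labels of its first factor, so a junction sees only that factor.\<close>
      have J: "J g (M h k) = J g h" for g h k
        unfolding J_def M_def using label_mult_transversal_cong[OF refl(2) up 4, of g h k]
        unfolding M_def by simp
      have M: "M g h B = g B + h B + J g h" for g h by (simp add: J_def)
      show ?thesis by (simp add: M J)
    qed
  qed
qed

end

lemma Cob_bar_interchange:
  assumes "\<alpha> \<in> parts n" "part_mult n \<alpha> \<alpha> = \<alpha>" "fst a = \<alpha>" "fst b = \<alpha>" "fst c = \<alpha>"
  shows "a \<otimes>\<^bsub>Cob_bar n\<^esub> (b \<otimes>\<^bsub>Cob_bar n\<^esub> (a \<otimes>\<^bsub>Cob_bar n\<^esub> (c \<otimes>\<^bsub>Cob_bar n\<^esub> a))) =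
    a \<otimes>\<^bsub>Cob_bar n\<^esub> (c \<otimes>\<^bsub>Cob_bar n\<^esub> (a \<otimes>\<^bsub>Cob_bar n\<^esub> (b \<otimes>\<^bsub>Cob_bar n\<^esub> a)))"
proof -
  obtain ga gb gc sa sb sc where abc: "a = (\<alpha>, ga, sa)" "b = (\<alpha>, gb, sb)" "c = (\<alpha>, gc, sc)"
    using assms(3-5) by (cases a; cases b; cases c) auto
  show ?thesis
    unfolding abc Cob_bar_def
    apply (simp add: assms(2) label_interchange(1)[OF assms(1,2), where a = ga and b = gb and c = gc])
    apply (rule ext)
    subgoal for i
      using label_interchange(2)[OF assms(1,2), where a = ga and b = gb and c = gc and i = i] by linarith
    done
qed

lemma Cobo_bar_interchange:
  assumes "\<alpha> \<in> parts n" "part_mult n \<alpha> \<alpha> = \<alpha>" "fst a = \<alpha>" "fst b = \<alpha>" "fst c = \<alpha>"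
  shows "a \<otimes>\<^bsub>Cobo_bar n\<^esub> (b \<otimes>\<^bsub>Cobo_bar n\<^esub> (a \<otimes>\<^bsub>Cobo_bar n\<^esub> (c \<otimes>\<^bsub>Cobo_bar n\<^esub> a))) =
    a \<otimes>\<^bsub>Cobo_bar n\<^esub> (c \<otimes>\<^bsub>Cobo_bar n\<^esub> (a \<otimes>\<^bsub>Cobo_bar n\<^esub> (b \<otimes>\<^bsub>Cobo_bar n\<^esub> a)))"
proof -
  obtain ga gb gc where abc: "a = (\<alpha>, ga)" "b = (\<alpha>, gb)" "c = (\<alpha>, gc)"
    using assms(3-5) by (cases a; cases b; cases c) auto
  show ?thesis
    unfolding abc Cobo_bar_def
    using label_interchange(1)[OF assms(1,2), where a = ga and b = gb and c = gc] assms(2) by simp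
qed

lemma Pd_bar_interchange:
  assumes "part_mult n \<alpha> \<alpha> = \<alpha>" "fst a = \<alpha>" "fst b = \<alpha>" "fst c = \<alpha>"
  shows "a \<otimes>\<^bsub>Pd_bar n\<^esub> (b \<otimes>\<^bsub>Pd_bar n\<^esub> (a \<otimes>\<^bsub>Pd_bar n\<^esub> (c \<otimes>\<^bsub>Pd_bar n\<^esub> a))) =
    a \<otimes>\<^bsub>Pd_bar n\<^esub> (c \<otimes>\<^bsub>Pd_bar n\<^esub> (a \<otimes>\<^bsub>Pd_bar n\<^esub> (b \<otimes>\<^bsub>Pd_bar n\<^esub> a)))"
proof -
  obtain sa sb sc where abc: "a = (\<alpha>, sa)" "b = (\<alpha>, sb)" "c = (\<alpha>, sc)"
    using assms(2-4) by (cases a; cases b; cases c) auto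
  show ?thesis
    unfolding abc Pd_bar_def using assms(1) by simp
qed

section \<open>Products of special partitions\<close>

definition zero_label :: "part \<Rightarrow> label" where
  "zero_label \<alpha> = (\<lambda>A\<in>\<alpha>. 0)"

lemma part_one_in_parts: "part_one n \<in> parts n"
  unfolding parts_def mem_Collect_eq
  by (rule partition_onI) (auto simp: part_one_def verts_def disjnt_def)

text \<open>
  Every middle vertex is tied to the outgoing vertex below it, so the components are the preimages of the
  blocks of \<open>\<alpha>\<close> under the map that identifies the middle layer with the last one.
\<close>

lemma join3_unit_right:
  assumes \<alpha>: "\<alpha> \<in> parts n"
  defines "p \<equiv> case_sum Inl (case_sum Inr Inr) :: vert3 \<Rightarrow> vert"
  shows "join3 n \<alpha> (part_one n) = (\<lambda>A. p -` A) ` \<alpha>"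
proof (rule join3_eq[OF \<alpha> part_one_in_parts])
  have p_verts: "p x \<in> verts n \<longleftrightarrow> x \<in> verts3 n" for x
    by (auto simp: p_def split: sum.splits)
  have p_emb: "p (emb12 x) = x" for x by (cases x) (auto simp: p_def)
  show "\<Union>((\<lambda>A. p -` A) ` \<alpha>) = verts3 n"
    using parts_Union[OF \<alpha>] p_verts by blast
  show "(\<lambda>A. p -` A) ` \<alpha> \<subseteq> join3 n \<alpha> (part_one n)"
  proof (rule image_subsetI)
    fix A assume A: "A \<in> \<alpha>"
    obtain a where a: "a \<in> A" using parts_nonempty[OF \<alpha> A] by blast
    show "p -` A \<in> join3 n \<alpha> (part_one n)"
    proof (rule join3_blockI[OF \<alpha> part_one_in_parts, of _ "emb12 a"])
      show "p -` A \<subseteq> verts3 n" using parts_subset[OF \<alpha> A] p_verts by blast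
      show "p -` A \<noteq> {}" using a p_emb by (metis empty_iff vimageI)
      show "emb12 ` B \<subseteq> p -` A" if "B \<in> \<alpha>" "x \<in> B" "emb12 x \<in> p -` A" for B x
        using that p_emb parts_eq[OF \<alpha> that(1) A] by auto
      show "emb23 ` B \<subseteq> p -` A" if "B \<in> part_one n" "x \<in> B" "emb23 x \<in> p -` A" for B x
        using that by (auto simp: part_one_def p_def)
      fix x assume x: "x \<in> p -` A"
      then have "x \<in> verts3 n" using parts_subset[OF \<alpha> A] p_verts by blast
      then have "(x, emb12 (p x)) \<in> (glue \<alpha> (part_one n))\<^sup>+"
      proof (cases x)
        case (Inl i)
        then show ?thesis using A x by (intro r_into_trancl) (auto simp: glue_iff p_def intro!: image_eqI[of _ _ "Inl i"])
      next
        case (Inr y)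
        show ?thesis
        proof (cases y)
          case (Inl i)
          with \<open>x = Inr y\<close> show ?thesis using A x by (intro r_into_trancl) (auto simp: glue_iff p_def intro!: image_eqI[of _ _ "Inr i"])
        next
          case (Inr i)
          with \<open>x = Inr y\<close> show ?thesis using \<open>x \<in> verts3 n\<close>
            by (intro r_into_trancl) (auto simp: glue_iff p_def part_one_def)
        qed
      qed
      also have "(emb12 (p x), emb12 a) \<in> (glue \<alpha> (part_one n))\<^sup>+"
        using x a A by (intro r_into_trancl) (auto simp: glue_iff)
      finally show "(x, emb12 a) \<in> (glue \<alpha> (part_one n))\<^sup>+" .
    qed
  qed
qed

lemma join3_unit_left:
  assumes \<alpha>: "\<alpha> \<in> parts n"
  defines "p \<equiv> case_sum Inl (case_sum Inl Inr) :: vert3 \<Rightarrow> vert"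
  shows "join3 n (part_one n) \<alpha> = (\<lambda>A. p -` A) ` \<alpha>"
proof (rule join3_eq[OF part_one_in_parts \<alpha>])
  have p_verts: "p x \<in> verts n \<longleftrightarrow> x \<in> verts3 n" for x
    by (auto simp: p_def split: sum.splits)
  have p_emb: "p (emb23 x) = x" for x by (cases x) (auto simp: p_def)
  show "\<Union>((\<lambda>A. p -` A) ` \<alpha>) = verts3 n"
    using parts_Union[OF \<alpha>] p_verts by blast
  show "(\<lambda>A. p -` A) ` \<alpha> \<subseteq> join3 n (part_one n) \<alpha>"
  proof (rule image_subsetI)
    fix A assume A: "A \<in> \<alpha>"
    obtain a where a: "a \<in> A" using parts_nonempty[OF \<alpha> A] by blast
    show "p -` A \<in> join3 n (part_one n) \<alpha>"
    proof (rule join3_blockI[OF part_one_in_parts \<alpha>, of _ "emb23 a"])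
      show "p -` A \<subseteq> verts3 n" using parts_subset[OF \<alpha> A] p_verts by blast
      show "p -` A \<noteq> {}" using a p_emb by (metis empty_iff vimageI)
      show "emb23 ` B \<subseteq> p -` A" if "B \<in> \<alpha>" "x \<in> B" "emb23 x \<in> p -` A" for B x
        using that p_emb parts_eq[OF \<alpha> that(1) A] by auto
      show "emb12 ` B \<subseteq> p -` A" if "B \<in> part_one n" "x \<in> B" "emb12 x \<in> p -` A" for B x
        using that by (auto simp: part_one_def p_def)
      fix x assume x: "x \<in> p -` A"
      then have "x \<in> verts3 n" using parts_subset[OF \<alpha> A] p_verts by blast
      then have "(x, emb23 (p x)) \<in> (glue (part_one n) \<alpha>)\<^sup>+"
      proof (cases x)
        case (Inl i)
        then show ?thesis using \<open>x \<in> verts3 n\<close>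
          by (intro r_into_trancl) (auto simp: glue_iff p_def part_one_def)
      next
        case (Inr y)
        show ?thesis
        proof (cases y)
          case (Inl i)
          with \<open>x = Inr y\<close> show ?thesis using A x by (intro r_into_trancl) (auto simp: glue_iff p_def intro!: image_eqI[of _ _ "Inl i"])
        next
          case (Inr i)
          with \<open>x = Inr y\<close> show ?thesis using A x by (intro r_into_trancl) (auto simp: glue_iff p_def intro!: image_eqI[of _ _ "Inr i"])
        qed
      qed
      also have "(emb23 (p x), emb23 a) \<in> (glue (part_one n) \<alpha>)\<^sup>+"
        using x a A by (intro r_into_trancl) (auto simp: glue_iff)
      finally show "(x, emb23 a) \<in> (glue (part_one n) \<alpha>)\<^sup>+" .
    qed
  qed
qed

text \<open>
  The component of \<open>A\<close> consists of \<open>A\<close> and of as many blocks of the unit as it has middle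
  vertices, so the corrections in the formula for the label cancel.
\<close>

lemma unit_right:
  assumes \<alpha>: "\<alpha> \<in> parts n"
  shows "part_mult n \<alpha> (part_one n) = \<alpha>" "dead_blocks n \<alpha> (part_one n) = {}"
    and "g \<in> \<alpha> \<rightarrow>\<^sub>E UNIV \<Longrightarrow> label_mult n \<alpha> g (part_one n) (zero_label (part_one n)) = g"
proof -
  define p :: "vert3 \<Rightarrow> vert" where "p = case_sum Inl (case_sum Inr Inr)"
  have J: "join3 n \<alpha> (part_one n) = (\<lambda>A. p -` A) ` \<alpha>"
    unfolding p_def by (rule join3_unit_right[OF \<alpha>])
  have p13: "p (emb13 x) = x" and p12: "p (emb12 x) = x" for x by (cases x; simp add: p_def)+
  have v13: "emb13 -` (p -` A) = A" for A using p13 by auto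
  have P: "part_mult n \<alpha> (part_one n) = (\<lambda>A. A) ` \<alpha> - {{}}"
    by (simp add: part_mult_def J image_image v13)
  then show mult: "part_mult n \<alpha> (part_one n) = \<alpha>" using parts_nonempty[OF \<alpha>] by auto
  have "\<not> p -` A \<subseteq> middle n" if A: "A \<in> \<alpha>" for A
  proof -
    obtain a where "a \<in> A" using parts_nonempty[OF \<alpha> A] by blast
    then have "emb13 a \<in> p -` A" using p13 by simp
    moreover have "emb13 a \<notin> middle n" by (cases a) auto
    ultimately show ?thesis by blast
  qed
  then show "dead_blocks n \<alpha> (part_one n) = {}" by (auto simp: dead_blocks_def J)
  assume g: "g \<in> \<alpha> \<rightarrow>\<^sub>E UNIV"
  let ?z = "zero_label (part_one n)"
  have "label_mult n \<alpha> g (part_one n) ?z A = g A" if A: "A \<in> \<alpha>" for A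
  proof -
    have "label_mult n \<alpha> g (part_one n) ?z A = label3 n \<alpha> g (part_one n) ?z (p -` A)"
      using A J v13 parts_nonempty[OF \<alpha> A]
      by (intro label_mult_block[OF \<alpha> part_one_in_parts]) auto
    also have "\<dots> = g A"
    proof -
      define I where "I = {i \<in> {1..n}. Inr i \<in> A}"
      have "B = A" if B: "B \<in> \<alpha>" "emb12 ` B \<subseteq> p -` A" for B
      proof -
        obtain b where "b \<in> B" using parts_nonempty[OF \<alpha> B(1)] by blast
        then show ?thesis using B p12 parts_eq[OF \<alpha> B(1) A, of b] by force
      qed
      then have As: "{B \<in> \<alpha>. emb12 ` B \<subseteq> p -` A} = {A}" using A p12 by auto
      have Bs: "{B \<in> part_one n. emb23 ` B \<subseteq> p -` A} = (\<lambda>i. {Inl i, Inr i}) ` I"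
        by (auto simp: part_one_def I_def p_def)
      have mid: "p -` A \<inter> middle n = (\<lambda>i. Inr (Inl i)) ` I"
        by (auto simp: middle_def I_def p_def)
      have "sum ?z ((\<lambda>i. {Inl i, Inr i}) ` I) = 0"
        by (intro sum.neutral) (auto simp: zero_label_def part_one_def I_def)
      moreover have "card ((\<lambda>i. {Inl i, Inr i} :: vert set) ` I) = card I"
        by (intro card_image inj_onI) (auto simp: doubleton_eq_iff)
      moreover have "card ((\<lambda>i. Inr (Inl i) :: vert3) ` I) = card I"
        by (intro card_image inj_onI) auto
      ultimately show ?thesis unfolding label3_eq[OF As Bs] mid by simp
    qed
    finally show ?thesis .
  qed
  moreover have "label_mult n \<alpha> g (part_one n) ?z A = g A" if "A \<notin> \<alpha>" for A
    using that by (simp add: label_mult_def mult PiE_arb[OF g that])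
  ultimately show "label_mult n \<alpha> g (part_one n) ?z = g" by blast
qed

lemma unit_left:
  assumes \<alpha>: "\<alpha> \<in> parts n"
  shows "part_mult n (part_one n) \<alpha> = \<alpha>" "dead_blocks n (part_one n) \<alpha> = {}"
    and "g \<in> \<alpha> \<rightarrow>\<^sub>E UNIV \<Longrightarrow> label_mult n (part_one n) (zero_label (part_one n)) \<alpha> g = g"
proof -
  define p :: "vert3 \<Rightarrow> vert" where "p = case_sum Inl (case_sum Inl Inr)"
  have J: "join3 n (part_one n) \<alpha> = (\<lambda>A. p -` A) ` \<alpha>"
    unfolding p_def by (rule join3_unit_left[OF \<alpha>])
  have p13: "p (emb13 x) = x" and p23: "p (emb23 x) = x" for x by (cases x; simp add: p_def)+
  have v13: "emb13 -` (p -` A) = A" for A using p13 by auto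
  have P: "part_mult n (part_one n) \<alpha> = (\<lambda>A. A) ` \<alpha> - {{}}"
    by (simp add: part_mult_def J image_image v13)
  then show mult: "part_mult n (part_one n) \<alpha> = \<alpha>" using parts_nonempty[OF \<alpha>] by auto
  have "\<not> p -` A \<subseteq> middle n" if A: "A \<in> \<alpha>" for A
  proof -
    obtain a where "a \<in> A" using parts_nonempty[OF \<alpha> A] by blast
    then have "emb13 a \<in> p -` A" using p13 by simp
    moreover have "emb13 a \<notin> middle n" by (cases a) auto
    ultimately show ?thesis by blast
  qed
  then show "dead_blocks n (part_one n) \<alpha> = {}" by (auto simp: dead_blocks_def J)
  assume g: "g \<in> \<alpha> \<rightarrow>\<^sub>E UNIV"
  let ?z = "zero_label (part_one n)"
  have "label_mult n (part_one n) ?z \<alpha> g A = g A" if A: "A \<in> \<alpha>" for A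
  proof -
    have "label_mult n (part_one n) ?z \<alpha> g A = label3 n (part_one n) ?z \<alpha> g (p -` A)"
      using A J v13 parts_nonempty[OF \<alpha> A]
      by (intro label_mult_block[OF part_one_in_parts \<alpha>]) auto
    also have "\<dots> = g A"
    proof -
      define I where "I = {i \<in> {1..n}. Inl i \<in> A}"
      have "B = A" if B: "B \<in> \<alpha>" "emb23 ` B \<subseteq> p -` A" for B
      proof -
        obtain b where "b \<in> B" using parts_nonempty[OF \<alpha> B(1)] by blast
        then show ?thesis using B p23 parts_eq[OF \<alpha> B(1) A, of b] by force
      qed
      then have Bs: "{B \<in> \<alpha>. emb23 ` B \<subseteq> p -` A} = {A}" using A p23 by auto
      have As: "{B \<in> part_one n. emb12 ` B \<subseteq> p -` A} = (\<lambda>i. {Inl i, Inr i}) ` I"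
        by (auto simp: part_one_def I_def p_def)
      have mid: "p -` A \<inter> middle n = (\<lambda>i. Inr (Inl i)) ` I"
        by (auto simp: middle_def I_def p_def)
      have "sum ?z ((\<lambda>i. {Inl i, Inr i}) ` I) = 0"
        by (intro sum.neutral) (auto simp: zero_label_def part_one_def I_def)
      moreover have "card ((\<lambda>i. {Inl i, Inr i} :: vert set) ` I) = card I"
        by (intro card_image inj_onI) (auto simp: doubleton_eq_iff)
      moreover have "card ((\<lambda>i. Inr (Inl i) :: vert3) ` I) = card I"
        by (intro card_image inj_onI) auto
      ultimately show ?thesis unfolding label3_eq[OF As Bs] mid by simp
    qed
    finally show ?thesis .
  qed
  moreover have "label_mult n (part_one n) ?z \<alpha> g A = g A" if "A \<notin> \<alpha>" for A
    using that by (simp add: label_mult_def mult PiE_arb[OF g that])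
  ultimately show "label_mult n (part_one n) ?z \<alpha> g = g" by blast
qed


text \<open>
  A product of two such partitions has exactly one dead block, the whole middle component.  Its label
  is the sum of the two labels that meet there, up to a constant.  This records which factors are neighbours.
\<close>

definition sever :: "nat \<Rightarrow> part" where
  "sever n = {Inl ` {1..n}, Inr ` {1..n}}"

definition sever_label :: "nat \<Rightarrow> int \<Rightarrow> int \<Rightarrow> label" where
  "sever_label n a b = (\<lambda>A\<in>sever n. if A = Inl ` {1..n} then a else b)"

lemma sever_in_parts: "1 \<le> n \<Longrightarrow> sever n \<in> parts n"
  unfolding parts_def mem_Collect_eq
  by (rule partition_onI) (auto simp: sever_def verts_def disjnt_def)

lemma Inl_image_neq_Inr_image:
  assumes "A \<noteq> {}"
  shows "Inl ` A \<noteq> Inr ` A"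
proof -
  obtain a where "a \<in> A" using assms by blast
  then have "Inl a \<in> Inl ` A" "Inl a \<notin> Inr ` A" by auto
  then show ?thesis by metis
qed

lemma sever_mult:
  assumes n: "1 \<le> n"
  shows "part_mult n (sever n) (sever n) = sever n"
    and "dead_count n (sever n) (sever_label n a b) (sever n) (sever_label n a' b') =
      (\<lambda>i. if i = b + a' + int n - 1 then 1 else 0)"
    and "label_mult n (sever n) (sever_label n a b) (sever n) (sever_label n a' b') = sever_label n a b'"
proof -
  let ?L = "Inl ` {1..n} :: vert set" and ?R = "Inr ` {1..n} :: vert set"
  define C1 C2 C3 where "C1 = emb12 ` ?L" and "C2 = emb12 ` ?R" and "C3 = emb23 ` ?R"
  have C2': "C2 = emb23 ` ?L" "C2 = middle n" by (auto simp: C2_def image_image middle_def)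
  note sever = sever_in_parts[OF n]
  note One_nat_def [simp del]
  have mem: "Inl i \<in> C1 \<longleftrightarrow> i \<in> {1..n}" "Inr y \<notin> C1" "Inl i \<notin> C2" "Inr (Inl i) \<in> C2 \<longleftrightarrow> i \<in> {1..n}" "Inr (Inr i) \<notin> C2"
      "Inl i \<notin> C3" "Inr (Inl i) \<notin> C3" "Inr (Inr i) \<in> C3 \<longleftrightarrow> i \<in> {1..n}" for i y
    by (auto simp: C1_def C2_def C3_def image_image)
  have ne: "C1 \<noteq> {}" "C2 \<noteq> {}" "C3 \<noteq> {}" using n by (simp_all add: C1_def C2_def C3_def)
  have sub: "C1 \<subseteq> verts3 n" "C2 \<subseteq> verts3 n" "C3 \<subseteq> verts3 n" by (auto simp: C1_def C2_def C3_def)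
  have J: "join3 n (sever n) (sever n) = {C1, C2, C3}"
  proof (rule join3_eq[OF sever sever])
    show "\<Union>{C1, C2, C3} = verts3 n" unfolding C2'(2)
      by (auto simp: C1_def C3_def verts3_def image_image Plus_def middle_def)
    have "C1 \<in> join3 n (sever n) (sever n)"
      unfolding C1_def by (rule join3_image12[OF sever sever]) (auto simp: sever_def)
    moreover have "C2 \<in> join3 n (sever n) (sever n)"
      unfolding C2_def by (rule join3_image12[OF sever sever]) (auto simp: sever_def image_image)
    moreover have "C3 \<in> join3 n (sever n) (sever n)"
      unfolding C3_def by (rule join3_image23[OF sever sever]) (auto simp: sever_def)
    ultimately show "{C1, C2, C3} \<subseteq> join3 n (sever n) (sever n)" by simp
  qed
  have v: "emb13 -` C1 = ?L" "emb13 -` C2 = {}" "emb13 -` C3 = ?R"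
    by (auto simp: set_eq_iff split_sum_all mem)
  show mult: "part_mult n (sever n) (sever n) = sever n"
  proof -
    have "part_mult n (sever n) (sever n) = {?L, {}, ?R} - {{}}"
      unfolding part_mult_def J by (simp add: v)
    moreover have "?L \<noteq> {}" "?R \<noteq> {}" using n by simp_all
    ultimately show ?thesis by (simp add: sever_def insert_Diff_if)
  qed
  have LR: "?L \<noteq> ?R" by (rule Inl_image_neq_Inr_image) (use n in simp)
  have in12: "emb12 ` ?L \<subseteq> C1" "\<not> emb12 ` ?R \<subseteq> C1" "\<not> emb12 ` ?L \<subseteq> C2" "emb12 ` ?R \<subseteq> C2"
     "\<not> emb12 ` ?L \<subseteq> C3" "\<not> emb12 ` ?R \<subseteq> C3"
    using n by (auto simp: mem image_subset_iff intro!: bexI[of _ 1])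
  have in23: "\<not> emb23 ` ?L \<subseteq> C1" "\<not> emb23 ` ?R \<subseteq> C1" "emb23 ` ?L \<subseteq> C2" "\<not> emb23 ` ?R \<subseteq> C2"
     "\<not> emb23 ` ?L \<subseteq> C3" "emb23 ` ?R \<subseteq> C3"
    using n by (auto simp: mem image_subset_iff intro!: bexI[of _ 1])
  have filt: "{A \<in> sever n. Q A} = (if Q ?L then {?L} else {}) \<union> (if Q ?R then {?R} else {})" for Q
    unfolding sever_def by auto
  have As: "{A \<in> sever n. emb12 ` A \<subseteq> C1} = {?L}" "{A \<in> sever n. emb12 ` A \<subseteq> C2} = {?R}" "{A \<in> sever n. emb12 ` A \<subseteq> C3} = {}"
    by (simp_all only: filt in12 if_True if_False Un_empty_right Un_empty_left)
  have Bs: "{A \<in> sever n. emb23 ` A \<subseteq> C1} = {}" "{A \<in> sever n. emb23 ` A \<subseteq> C2} = {?L}" "{A \<in> sever n. emb23 ` A \<subseteq> C3} = {?R}"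
    by (simp_all only: filt in23 if_True if_False Un_empty_right Un_empty_left)
  have mid: "C1 \<inter> middle n = {}" "C2 \<inter> middle n = middle n" "C3 \<inter> middle n = {}"
    by (auto simp: C2'(2) middle_def mem)
  have card_mid: "card (middle n) = n" unfolding middle_def by (subst card_image) (auto intro: inj_onI)
  have lab: "sever_label n x y ?L = x" "sever_label n x y ?R = y" for x y
    using LR by (auto simp: sever_label_def sever_def)
  have l3: "label3 n (sever n) (sever_label n a b) (sever n) (sever_label n a' b') C1 = a"
    "label3 n (sever n) (sever_label n a b) (sever n) (sever_label n a' b') C2 = b + a' + int n - 1"
    "label3 n (sever n) (sever_label n a b) (sever n) (sever_label n a' b') C3 = b'"
    by (simp_all add: label3_def As Bs mid card_mid lab)
  have "\<not> C1 \<subseteq> middle n" "\<not> C3 \<subseteq> middle n" using mid ne by blast+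
  then have "dead_blocks n (sever n) (sever n) = {C2}"
    using C2' by (auto simp: dead_blocks_def J)
  then have "{C \<in> dead_blocks n (sever n) (sever n). label3 n (sever n) (sever_label n a b) (sever n) (sever_label n a' b') C = i} =
    (if i = b + a' + int n - 1 then {C2} else {})" for i
    using l3(2) by auto
  then show "dead_count n (sever n) (sever_label n a b) (sever n) (sever_label n a' b') =
      (\<lambda>i. if i = b + a' + int n - 1 then 1 else 0)"
    unfolding dead_count_def by (intro ext) simp
  have L: "label_mult n (sever n) (sever_label n a b) (sever n) (sever_label n a' b') ?L = a"
    using label_mult_block[OF sever sever, of C1 ?L] J v n l3(1) by simp
  have R: "label_mult n (sever n) (sever_label n a b) (sever n) (sever_label n a' b') ?R = b'"
    using label_mult_block[OF sever sever, of C3 ?R] J v n l3(3) by simp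
  show "label_mult n (sever n) (sever_label n a b) (sever n) (sever_label n a' b') = sever_label n a b'"
  proof
    fix A
    consider "A = ?L" | "A = ?R" | "A \<notin> sever n" by (auto simp: sever_def)
    then show "label_mult n (sever n) (sever_label n a b) (sever n) (sever_label n a' b') A = sever_label n a b' A"
    proof cases
      case 3 then show ?thesis by (simp add: label_mult_def mult sever_label_def)
    qed (simp_all only: L R lab)
  qed
qed


definition trunk :: "nat \<Rightarrow> bool \<Rightarrow> bool \<Rightarrow> vert set" where
  "trunk n p q = {x \<in> verts n. \<not> (p \<and> x = Inl 2) \<and> \<not> (q \<and> x = Inr 2)}"

text \<open>
  The flags \<open>p\<close> and \<open>q\<close> tell whether the incoming, respectively outgoing, vertex
  \<open>2\<close> is cut off from the trunk, which contains all the other vertices.  The product of two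
  such partitions has a dead block if the vertex is cut off on both sides of the junction.  If it is cut
  off on neither side, the junction closes one more loop than otherwise, which raises the label of the
  trunk.
\<close>

definition dangling :: "nat \<Rightarrow> bool \<Rightarrow> bool \<Rightarrow> part" where
  "dangling n p q = insert (trunk n p q) ((if p then {{Inl 2}} else {}) \<union> (if q then {{Inr 2}} else {}))"

definition trunk_label :: "nat \<Rightarrow> bool \<Rightarrow> bool \<Rightarrow> int \<Rightarrow> label" where
  "trunk_label n p q g = (\<lambda>A\<in>dangling n p q. if A = trunk n p q then g else 0)"

lemma trunk_simps [simp]:
  "Inl i \<in> trunk n p q \<longleftrightarrow> i \<in> {1..n} \<and> \<not> (p \<and> i = 2)"
  "Inr i \<in> trunk n p q \<longleftrightarrow> i \<in> {1..n} \<and> \<not> (q \<and> i = 2)"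
  by (auto simp: trunk_def)

lemma trunk_neq [simp]:
  assumes "2 \<le> n"
  shows "trunk n p q \<noteq> {Inl 2}" "trunk n p q \<noteq> {Inr 2}" "trunk n p q \<noteq> {}"
proof -
  have "Inl 1 \<in> trunk n p q" using assms by simp
  moreover have "Inl 1 \<notin> {Inl 2 :: vert}" "Inl 1 \<notin> {Inr 2 :: vert}" by simp_all
  ultimately show "trunk n p q \<noteq> {Inl 2}" "trunk n p q \<noteq> {Inr 2}" "trunk n p q \<noteq> {}"
    by (metis, metis, blast)
qed

lemma dangling_in_parts:
  assumes "2 \<le> n"
  shows "dangling n p q \<in> parts n"
  unfolding parts_def mem_Collect_eq
proof (rule partition_onI)
  show "\<Union>(dangling n p q) = verts n"
    using assms by (auto simp: dangling_def trunk_def split: if_splits)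
  show "disjnt A B" if "A \<in> dangling n p q" "B \<in> dangling n p q" "A \<noteq> B" for A B
    using that by (auto simp: dangling_def disjnt_def trunk_def split: if_splits)
  show "{} \<notin> dangling n p q" using trunk_neq(3)[OF assms, of p q] by (auto simp: dangling_def)
qed

text \<open>
  The component of the trunks in the triple union; \<open>m\<close> tells whether the middle vertex
  \<open>2\<close> is cut off.
\<close>

definition joined_trunk :: "nat \<Rightarrow> bool \<Rightarrow> bool \<Rightarrow> bool \<Rightarrow> vert3 set" where
  "joined_trunk n p m q = {x \<in> verts3 n. \<not> (p \<and> x = Inl 2) \<and> \<not> (m \<and> x = Inr (Inl 2)) \<and> \<not> (q \<and> x = Inr (Inr 2))}"

lemma joined_trunk_simps [simp]:
  "Inl i \<in> joined_trunk n p m q \<longleftrightarrow> i \<in> {1..n} \<and> \<not> (p \<and> i = 2)"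
  "Inr (Inl i) \<in> joined_trunk n p m q \<longleftrightarrow> i \<in> {1..n} \<and> \<not> (m \<and> i = 2)"
  "Inr (Inr i) \<in> joined_trunk n p m q \<longleftrightarrow> i \<in> {1..n} \<and> \<not> (q \<and> i = 2)"
  by (auto simp: joined_trunk_def)

context
  fixes n :: nat and p q p' q' :: bool
  assumes n: "2 \<le> n"
begin

lemma emb_joined_trunk:
  "emb12 x \<in> joined_trunk n p (q \<and> p') q' \<longleftrightarrow> x \<in> trunk n p (q \<and> p')"
  "emb23 x \<in> joined_trunk n p (q \<and> p') q' \<longleftrightarrow> x \<in> trunk n (q \<and> p') q'"
  "emb13 x \<in> joined_trunk n p (q \<and> p') q' \<longleftrightarrow> x \<in> trunk n p q'"
  by (cases x; simp)+

lemma join3_dangling: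
  "join3 n (dangling n p q) (dangling n p' q') = insert (joined_trunk n p (q \<and> p') q')
    ((if p then {{Inl 2}} else {}) \<union> (if q \<and> p' then {{Inr (Inl 2)}} else {}) \<union> (if q' then {{Inr (Inr 2)}} else {}))"
proof (rule join3_eq)
  note in_parts = dangling_in_parts[OF n]
  let ?\<alpha> = "dangling n p q" and ?\<beta> = "dangling n p' q'" and ?C = "joined_trunk n p (q \<and> p') q'"
  show "?\<alpha> \<in> parts n" "?\<beta> \<in> parts n" by (rule in_parts)+
  show "\<Union>(insert ?C ((if p then {{Inl 2}} else {}) \<union> (if q \<and> p' then {{Inr (Inl 2)}} else {}) \<union> (if q' then {{Inr (Inr 2)}} else {}))) = verts3 n"
    using n by (auto simp: joined_trunk_def split: if_splits)
  have trunks: "trunk n p q \<in> ?\<alpha>" "trunk n p' q' \<in> ?\<beta>" by (simp_all add: dangling_def)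
  have "?C \<in> join3 n ?\<alpha> ?\<beta>"
  proof (rule join3_blockI[OF in_parts in_parts, where h = "Inr (Inl 1)"])
    show "?C \<subseteq> verts3 n" by (auto simp: joined_trunk_def)
    have "Inl 1 \<in> ?C" using n by simp
    then show "?C \<noteq> {}" by blast
    show "emb12 ` A \<subseteq> ?C" if "A \<in> ?\<alpha>" "x \<in> A" "emb12 x \<in> ?C" for A x
    proof -
      have "trunk n p q \<subseteq> trunk n p (q \<and> p')" by (auto simp: trunk_def)
      then show ?thesis
        using that unfolding image_subset_iff emb_joined_trunk by (auto simp: dangling_def split: if_splits)
    qed
    show "emb23 ` B \<subseteq> ?C" if "B \<in> ?\<beta>" "x \<in> B" "emb23 x \<in> ?C" for B x
    proof -
      have "trunk n p' q' \<subseteq> trunk n (q \<and> p') q'" by (auto simp: trunk_def)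
      then show ?thesis
        using that unfolding image_subset_iff emb_joined_trunk by (auto simp: dangling_def split: if_splits)
    qed
    have hub: "emb12 (Inr 1) = Inr (Inl 1)" "emb23 (Inl 1) = Inr (Inl 1)"
      "Inr 1 \<in> trunk n p q" "Inl 1 \<in> trunk n p' q'" using n by simp_all
    have 12: "(emb12 x, Inr (Inl 1)) \<in> (glue ?\<alpha> ?\<beta>)\<^sup>+" if "x \<in> trunk n p q" for x
      using that hub(3) trunks(1) unfolding hub(1)[symmetric] glue_iff
      by (intro r_into_trancl) (auto simp: glue_iff simp del: emb_simps)
    have 23: "(emb23 x, Inr (Inl 1)) \<in> (glue ?\<alpha> ?\<beta>)\<^sup>+" if "x \<in> trunk n p' q'" for x
      using that hub(4) trunks(2) unfolding hub(2)[symmetric] glue_iff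
      by (intro r_into_trancl) (auto simp: glue_iff simp del: emb_simps)
    fix x assume x: "x \<in> ?C"
    show "(x, Inr (Inl 1)) \<in> (glue ?\<alpha> ?\<beta>)\<^sup>+"
    proof (cases x)
      case (Inl i) then show ?thesis using 12[of "Inl i"] x by simp
    next
      case (Inr y) note y = this
      show ?thesis
      proof (cases y)
        case (Inl i) then show ?thesis using 12[of "Inr i"] 23[of "Inl i"] x y by auto
      next
        case (Inr i) then show ?thesis using 23[of "Inr i"] x y by simp
      qed
    qed
  qed
  moreover have "emb12 ` {Inl 2} \<in> join3 n ?\<alpha> ?\<beta>" if p
    by (rule join3_image12[OF in_parts in_parts]) (use that in \<open>auto simp: dangling_def\<close>)
  moreover have "emb12 ` {Inr 2} \<in> join3 n ?\<alpha> ?\<beta>" if "q \<and> p'"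
    by (rule join3_image12[OF in_parts in_parts])
      (use that in \<open>auto simp: dangling_def split: if_splits\<close>)
  moreover have "emb23 ` {Inr 2} \<in> join3 n ?\<alpha> ?\<beta>" if q'
    by (rule join3_image23[OF in_parts in_parts]) (use that in \<open>auto simp: dangling_def\<close>)
  ultimately show "insert ?C ((if p then {{Inl 2}} else {}) \<union> (if q \<and> p' then {{Inr (Inl 2)}} else {}) \<union> (if q' then {{Inr (Inr 2)}} else {}))
      \<subseteq> join3 n ?\<alpha> ?\<beta>" by (auto split: if_splits)
qed

lemma part_mult_dangling:
  "part_mult n (dangling n p q) (dangling n p' q') = dangling n p q'"
proof -
  have v: "emb13 -` joined_trunk n p (q \<and> p') q' = trunk n p q'"
    "emb13 -` {Inl 2} = {Inl 2}" "emb13 -` {Inr (Inl 2)} = {}" "emb13 -` {Inr (Inr 2)} = {Inr 2}"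
    using emb_joined_trunk(3) by (auto simp: set_eq_iff split_sum_all)
  show ?thesis
    unfolding part_mult_def join3_dangling dangling_def[of n p q']
    using trunk_neq(3)[OF n] by (auto simp: v)
qed

lemma dead_blocks_dangling:
  "dead_blocks n (dangling n p q) (dangling n p' q') = (if q \<and> p' then {{Inr (Inl 2)}} else {})"
proof -
  have "Inl 1 \<in> joined_trunk n p (q \<and> p') q'" "Inl 1 \<notin> middle n" using n by simp_all
  then have "\<not> joined_trunk n p (q \<and> p') q' \<subseteq> middle n" by blast
  then show ?thesis
    unfolding dead_blocks_def join3_dangling using n by (auto split: if_splits)
qed

lemma label_mult_dangling:
  "label_mult n (dangling n p q) (trunk_label n p q g) (dangling n p' q') (trunk_label n p' q' h) =
    trunk_label n p q' (g + h + int n - 2 + (if q \<or> p' then 0 else 1))"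
proof -
  let ?\<alpha> = "dangling n p q" and ?\<beta> = "dangling n p' q'" and ?C = "joined_trunk n p (q \<and> p') q'"
  let ?g = "trunk_label n p q g" and ?h = "trunk_label n p' q' h"
  have in_parts: "?\<alpha> \<in> parts n" "?\<beta> \<in> parts n" by (rule dangling_in_parts[OF n])+
  note block = label_mult_block[OF in_parts, where g = ?g and h = ?h, unfolded join3_dangling]
  have C_trunk: "label_mult n ?\<alpha> ?g ?\<beta> ?h (trunk n p q') = g + h + int n - 2 + (if q \<or> p' then 0 else 1)"
  proof -
    have "label_mult n ?\<alpha> ?g ?\<beta> ?h (trunk n p q') = label3 n ?\<alpha> ?g ?\<beta> ?h ?C"
      using emb_joined_trunk(3) trunk_neq(3)[OF n] by (intro block) auto
    also have "\<dots> = g + h + int n - 2 + (if q \<or> p' then 0 else 1)"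
    proof -
      have "trunk n p q \<subseteq> trunk n p (q \<and> p')" "trunk n p' q' \<subseteq> trunk n (q \<and> p') q'"
        by (auto simp: trunk_def)
      then have As: "{A \<in> ?\<alpha>. emb12 ` A \<subseteq> ?C} = insert (trunk n p q) (if q \<and> \<not> p' then {{Inr 2}} else {})"
        and Bs: "{B \<in> ?\<beta>. emb23 ` B \<subseteq> ?C} = insert (trunk n p' q') (if p' \<and> \<not> q then {{Inl 2}} else {})"
        unfolding image_subset_iff emb_joined_trunk using n by (auto simp: dangling_def split: if_splits)
      have g: "?g (trunk n p q) = g" "q \<Longrightarrow> ?g {Inr 2} = 0" and h: "?h (trunk n p' q') = h" "p' \<Longrightarrow> ?h {Inl 2} = 0"
        using trunk_neq[OF n, of p q] trunk_neq[OF n, of p' q'] by (auto simp: trunk_label_def dangling_def)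
      have mid: "card (?C \<inter> middle n) = (if q \<and> p' then n - 1 else n)"
      proof -
        have "?C \<inter> middle n = (\<lambda>i. Inr (Inl i)) ` ({1..n} - (if q \<and> p' then {2} else {}))"
          by (auto simp: set_eq_iff split_sum_all image_iff)
        then have "card (?C \<inter> middle n) = card ({1..n} - (if q \<and> p' then {2} else {}))"
          by (simp add: card_image inj_on_def)
        then show ?thesis using n by simp
      qed
      show ?thesis
        unfolding label3_eq[OF As Bs] mid using n g h trunk_neq[OF n, of p q] trunk_neq[OF n, of p' q']
        by (cases q; cases p') (simp_all add: of_nat_diff)
    qed
    finally show ?thesis .
  qed
  have C_upper: "label_mult n ?\<alpha> ?g ?\<beta> ?h {Inl 2} = 0" if p
  proof -
    have "label_mult n ?\<alpha> ?g ?\<beta> ?h {Inl 2} = label3 n ?\<alpha> ?g ?\<beta> ?h {Inl 2}"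
      using that by (intro block) (auto simp: set_eq_iff split_sum_all)
    also have "\<dots> = 0"
    proof -
      have "A = {Inl 2}" if "A \<in> ?\<alpha>" "emb12 ` A \<subseteq> {Inl 2}" for A
      proof -
        have "A \<subseteq> {Inl 2}" using that(2) by auto
        then show ?thesis using parts_nonempty[OF in_parts(1) that(1)] by blast
      qed
      moreover have "{Inl 2} \<in> {A \<in> ?\<alpha>. emb12 ` A \<subseteq> {Inl 2}}" using \<open>p\<close> by (simp add: dangling_def)
      ultimately have As: "{A \<in> ?\<alpha>. emb12 ` A \<subseteq> {Inl 2}} = {{Inl 2}}" by blast
      have Bs: "{B \<in> ?\<beta>. emb23 ` B \<subseteq> {Inl 2}} = {}"
        using parts_nonempty[OF in_parts(2)] by (auto simp: image_subset_iff)
      have "?g {Inl 2} = 0" using trunk_neq[OF n, of p q] by (auto simp: trunk_label_def \<open>p\<close> dangling_def)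
      then show ?thesis unfolding label3_eq[OF As Bs] by simp
    qed
    finally show ?thesis .
  qed
  have C_lower: "label_mult n ?\<alpha> ?g ?\<beta> ?h {Inr 2} = 0" if q'
  proof -
    have "label_mult n ?\<alpha> ?g ?\<beta> ?h {Inr 2} = label3 n ?\<alpha> ?g ?\<beta> ?h {Inr (Inr 2)}"
      using that by (intro block) (auto simp: set_eq_iff split_sum_all)
    also have "\<dots> = 0"
    proof -
      have "B = {Inr 2}" if "B \<in> ?\<beta>" "emb23 ` B \<subseteq> {Inr (Inr 2)}" for B
      proof -
        have "B \<subseteq> {Inr 2}" using that(2) by auto
        then show ?thesis using parts_nonempty[OF in_parts(2) that(1)] by blast
      qed
      moreover have "{Inr 2} \<in> {B \<in> ?\<beta>. emb23 ` B \<subseteq> {Inr (Inr 2)}}" using \<open>q'\<close> by (simp add: dangling_def)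
      ultimately have Bs: "{B \<in> ?\<beta>. emb23 ` B \<subseteq> {Inr (Inr 2)}} = {{Inr 2}}" by blast
      have As: "{A \<in> ?\<alpha>. emb12 ` A \<subseteq> {Inr (Inr 2)}} = {}"
        using parts_nonempty[OF in_parts(1)] by (auto simp: image_subset_iff)
      have "?h {Inr 2} = 0" using trunk_neq[OF n, of p' q'] by (auto simp: trunk_label_def \<open>q'\<close> dangling_def)
      then show ?thesis unfolding label3_eq[OF As Bs] by simp
    qed
    finally show ?thesis .
  qed
  show ?thesis
  proof
    fix A
    consider "A \<notin> dangling n p q'" | "A = trunk n p q'" | "A = {Inl 2}" p | "A = {Inr 2}" q'
      unfolding dangling_def by (cases p; cases q') auto
    then show "label_mult n ?\<alpha> ?g ?\<beta> ?h A = trunk_label n p q' (g + h + int n - 2 + (if q \<or> p' then 0 else 1)) A"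
    proof cases
      case 1 then show ?thesis by (simp add: label_mult_def part_mult_dangling trunk_label_def)
    next
      case 2 then show ?thesis using C_trunk by (simp add: trunk_label_def dangling_def)
    next
      case 3 then show ?thesis using C_upper trunk_neq(1)[OF n, of p q'] by (auto simp: trunk_label_def dangling_def)
    next
      case 4 then show ?thesis using C_lower trunk_neq(2)[OF n, of p q'] by (auto simp: trunk_label_def dangling_def)
    qed
  qed
qed

end

section \<open>Identities of the monoids relate equi-adjacent words\<close>

lemma adj_simps [simp]:
  "adj [] = {}" "adj [a] = {}" "adj (a # b # w) = insert (a, b) (adj (b # w))"
  by (auto simp: adj_def Cons_eq_append_conv)

lemma adj_append:
  "u \<noteq> [] \<Longrightarrow> v \<noteq> [] \<Longrightarrow> adj (u @ v) = insert (last u, hd v) (adj u \<union> adj v)"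
proof (induction u rule: list_nonempty_induct)
  case (single a)
  then show ?case by (cases v) auto
next
  case (cons a u)
  then obtain b u' where "u = b # u'" by (cases u) auto
  with cons show ?case by auto
qed

lemma adj_map: "adj (map f w) = map_prod f f ` adj w"
  by (induction w rule: induct_list012) auto

lemma adj_framed:
  "adj (framed w) = (if w = [] then {(None, None)} else
    insert (None, Some (hd w)) (insert (Some (last w), None) (map_prod Some Some ` adj w)))"
proof (cases "w = []")
  case True then show ?thesis by (simp add: framed_def)
next
  case False
  have "framed w = [None] @ (map Some w @ [None])" by (simp add: framed_def)
  then have "adj (framed w) = adj ([None] @ (map Some w @ [None]))" by simp
  also have "\<dots> = insert (None, Some (hd w)) (insert (Some (last w), None) (adj (map Some w)))"
    using False by (simp add: adj_append hd_map last_map del: append_Cons append_Nil)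
  finally show ?thesis using False by (simp add: adj_map)
qed

fun junctions :: "('a \<Rightarrow> 'a \<Rightarrow> bool) \<Rightarrow> 'a list \<Rightarrow> nat" where
  "junctions Q (a # b # w) = (if Q a b then 1 else 0) + junctions Q (b # w)"
| "junctions Q w = 0"

lemma junctions_append:
  "u \<noteq> [] \<Longrightarrow> v \<noteq> [] \<Longrightarrow>
    junctions Q (u @ v) = junctions Q u + junctions Q v + (if Q (last u) (hd v) then 1 else 0)"
proof (induction u rule: list_nonempty_induct)
  case (single a)
  then show ?case by (cases v) auto
next
  case (cons a u)
  then obtain b u' where "u = b # u'" by (cases u) auto
  with cons show ?case by auto
qed

lemma junctions_pos_iff: "0 < junctions Q w \<longleftrightarrow> (\<exists>(a, b)\<in>adj w. Q a b)"
  by (induction w rule: induct_list012) auto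

lemma junctions_constant:
  "(\<And>z. z \<in> set w \<Longrightarrow> z = x) \<Longrightarrow> junctions (\<lambda>a b. a = x \<and> b = x) w = length w - 1"
  by (induction w rule: induct_list012) auto

text \<open>
  The term with the factor \<open>c\<close> allows for invariants in which each junction contributes a constant
  besides its own weight.  Applied to the powers of a single letter, such an invariant determines how
  often the letter occurs, and then the constants can be subtracted.
\<close>

lemma equi_adjacentI:
  assumes empty: "\<And>K. filter K u = [] \<longleftrightarrow> filter K v = []"
    and ends: "\<And>K. filter K u \<noteq> [] \<Longrightarrow> hd (filter K u) = hd (filter K v) \<and> last (filter K u) = last (filter K v)"
    and junc: "\<And>K x y. filter K u \<noteq> [] \<Longrightarrow>
      c * (length (filter K u) - 1) + junctions (\<lambda>a b. a = x \<and> b = y) (filter K u) =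
      c * (length (filter K v) - 1) + junctions (\<lambda>a b. a = x \<and> b = y) (filter K v)"
  shows "equi_adjacent u v"
proof -
  have mset: "mset u = mset v"
  proof (rule multiset_eqI)
    fix x
    have "length (filter ((=) x) u) = length (filter ((=) x) v)"
    proof (cases "filter ((=) x) u = []")
      case True then show ?thesis using empty by simp
    next
      case False
      then have ne: "filter ((=) x) v \<noteq> []" using empty by simp
      have eq: "c * (length (filter ((=) x) w) - 1) + junctions (\<lambda>a b. a = x \<and> b = x) (filter ((=) x) w) =
          (c + 1) * (length (filter ((=) x) w) - 1)" for w
        by (subst junctions_constant) auto
      then have "length (filter ((=) x) u) - 1 = length (filter ((=) x) v) - 1"
        using junc[OF False, of x x] nat_mult_eq_cancel1[of "c + 1"] unfolding eq by simp
      moreover have "0 < length (filter ((=) x) u)" "0 < length (filter ((=) x) v)"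
        using False ne by (metis length_greater_0_conv)+
      ultimately show ?thesis by linarith
    qed
    then show "count (mset u) x = count (mset v) x" by (simp add: count_mset count_list_eq_length_filter)
  qed
  have "adj (framed (filter K u)) = adj (framed (filter K v))" for K
  proof (cases "filter K u = []")
    case True
    moreover from True have "filter K v = []" using empty by blast
    ultimately show ?thesis by (simp only:)
  next
    case False
    then have ne: "filter K v \<noteq> []" using empty by blast
    have "length (filter K u) = length (filter K v)"
      using mset by (metis mset_filter size_mset)
    then have "junctions (\<lambda>a b. a = x \<and> b = y) (filter K u) = junctions (\<lambda>a b. a = x \<and> b = y) (filter K v)" for x y
      using junc[OF False] by simp
    then have "(\<exists>(a, b)\<in>adj (filter K u). a = x \<and> b = y) \<longleftrightarrow> (\<exists>(a, b)\<in>adj (filter K v). a = x \<and> b = y)" for x y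
      unfolding junctions_pos_iff[symmetric] by simp
    then have "adj (filter K u) = adj (filter K v)" by fastforce
    then show ?thesis using ends[OF False] False ne by (simp add: adj_framed)
  qed
  with mset show ?thesis by (simp add: equi_adjacent_def)
qed

text \<open>
  Substituting the unit \<open>e\<close> for the letters outside \<open>K\<close> deletes them.
\<close>

lemma filter_hom:
  assumes "e \<in> carrier S" "\<And>w. w \<noteq> [] \<Longrightarrow> f w \<in> carrier S"
    and "e \<otimes>\<^bsub>S\<^esub> e = e" "\<And>w. w \<noteq> [] \<Longrightarrow> e \<otimes>\<^bsub>S\<^esub> f w = f w" "\<And>w. w \<noteq> [] \<Longrightarrow> f w \<otimes>\<^bsub>S\<^esub> e = f w"
    and "\<And>u v. u \<noteq> [] \<Longrightarrow> v \<noteq> [] \<Longrightarrow> f u \<otimes>\<^bsub>S\<^esub> f v = f (u @ v)"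
  shows "(\<lambda>w. if filter K w = [] then e else f (filter K w)) \<in> hom free_semigroup S"
  using assms by (auto simp: hom_def free_semigroup_def simp del: filter_empty_conv)

lemma filter_hom_eq:
  assumes "holds_in (u, v) S" "(\<lambda>w. if filter K w = [] then e else f (filter K w)) \<in> hom free_semigroup S"
    and "\<And>w. w \<noteq> [] \<Longrightarrow> f w \<noteq> e"
  shows "filter K u = [] \<longleftrightarrow> filter K v = []" "filter K u \<noteq> [] \<Longrightarrow> f (filter K u) = f (filter K v)"
  using assms(1,3) bspec[OF assms(1)[unfolded holds_in_def] assms(2)]
  by (auto simp del: filter_empty_conv split: if_splits)


lemma zero_label_ext: "zero_label \<alpha> \<in> \<alpha> \<rightarrow>\<^sub>E UNIV"
  by (simp add: zero_label_def)

lemma part_one_neq_sever: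
  assumes "1 \<le> n"
  shows "sever n \<noteq> part_one n"
proof
  assume "sever n = part_one n"
  then have "Inl ` {1..n} \<in> part_one n" by (auto simp: sever_def)
  then obtain i where "Inl ` {1..n} = {Inl i, Inr i :: vert}" by (auto simp: part_one_def)
  then have "Inr i \<in> (Inl ` {1..n} :: vert set)" by simp
  then show False by auto
qed

lemma sever_label_eqD:
  assumes "1 \<le> n" "sever_label n a b = sever_label n a' b'"
  shows "a = a'" "b = b'"
proof -
  have "Inl ` {1..n} \<noteq> (Inr ` {1..n} :: vert set)"
    by (rule Inl_image_neq_Inr_image) (use assms in simp)
  then have "sever_label n x y (Inl ` {1..n}) = x" "sever_label n x y (Inr ` {1..n}) = y" for x y
    by (auto simp: sever_label_def sever_def)
  then show "a = a'" "b = b'" using assms(2) by metis+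
qed

text \<open>
  All remaining letters are sent to the severed partition.  The outgoing label of \<open>x\<close> and the
  incoming label of \<open>y\<close> are \<open>1\<close>, all other labels are \<open>0\<close>.  The dead blocks
  with the largest label \<open>n + 1\<close> then count the places at which \<open>y\<close> follows
  \<open>x\<close>, and the labels of the two live blocks show the first and the last letter.
\<close>

lemma equi_adjacent_if_holds_in_Cob:
  assumes n: "1 \<le> n" and hold: "holds_in (u, v) (Cob n)"
  shows "equi_adjacent u v"
proof -
  define e :: "part \<times> label \<times> (int \<Rightarrow> int)" where "e = (part_one n, zero_label (part_one n), \<lambda>i. 0)"
  define f where "f a b w = (sever n, sever_label n (a (hd w)) (b (last w)),
    \<lambda>i. int (junctions (\<lambda>p q. b p + a q + int n - 1 = i) w))" for a b :: "nat \<Rightarrow> int" and w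
  have mult: "(\<alpha>, g, s) \<otimes>\<^bsub>Cob n\<^esub> (\<beta>, h, t) =
      (part_mult n \<alpha> \<beta>, label_mult n \<alpha> g \<beta> h, \<lambda>i. s i + t i + dead_count n \<alpha> g \<beta> h i)" for \<alpha> g s \<beta> h t
    by (simp add: Cob_def Cob_bar_def)
  have carrier: "(\<alpha>, g, s) \<in> carrier (Cob n) \<longleftrightarrow> \<alpha> \<in> parts n \<and> g \<in> \<alpha> \<rightarrow>\<^sub>E UNIV \<and> finite {i. s i \<noteq> 0} \<and>
      (\<forall>A\<in>\<alpha>. 0 \<le> g A) \<and> (\<forall>i. 0 \<le> s i) \<and> (\<forall>i<0. s i = 0)" for \<alpha> g s
    by (auto simp: Cob_def Cob_bar_def)
  have unit: "e \<otimes>\<^bsub>Cob n\<^esub> (\<alpha>, g, s) = (\<alpha>, g, s)" "(\<alpha>, g, s) \<otimes>\<^bsub>Cob n\<^esub> e = (\<alpha>, g, s)"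
    if "\<alpha> \<in> parts n" "g \<in> \<alpha> \<rightarrow>\<^sub>E UNIV" for \<alpha> g s
    unfolding e_def mult using that
    by (simp_all add: unit_left unit_right dead_count_def)
  note sever = sever_in_parts[OF n]
  have ext: "sever_label n a b \<in> sever n \<rightarrow>\<^sub>E UNIV" for a b by (simp add: sever_label_def)
  have hom: "(\<lambda>w. if filter K w = [] then e else f a b (filter K w)) \<in> hom free_semigroup (Cob n)"
    if ab: "\<And>z. 0 \<le> a z \<and> a z \<le> 1" "\<And>z. 0 \<le> b z \<and> b z \<le> 1" for K a b
  proof (rule filter_hom)
    show "e \<in> carrier (Cob n)"
      unfolding e_def carrier by (simp add: part_one_in_parts zero_label_def)
    show "e \<otimes>\<^bsub>Cob n\<^esub> e = e"
      using unit(1)[OF part_one_in_parts zero_label_ext] by (simp add: e_def)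
    fix w :: "nat list"
    show "f a b w \<in> carrier (Cob n)"
    proof -
      have "junctions (\<lambda>p q. b p + a q + int n - 1 = i) w = 0" if "i \<notin> {0..int n + 1}" for i
      proof -
        have "b p + a q + int n - 1 \<noteq> i" for p q
        proof -
          have "0 \<le> b p" "b p \<le> 1" "0 \<le> a q" "a q \<le> 1" using ab by auto
          then show ?thesis using that n by auto
        qed
        then have "\<not> 0 < junctions (\<lambda>p q. b p + a q + int n - 1 = i) w"
          unfolding junctions_pos_iff by auto
        then show ?thesis by simp
      qed
      note 0 = this
      then have "{i. int (junctions (\<lambda>p q. b p + a q + int n - 1 = i) w) \<noteq> 0} \<subseteq> {0..int n + 1}" by force
      then have "finite {i. int (junctions (\<lambda>p q. b p + a q + int n - 1 = i) w) \<noteq> 0}"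
        by (rule finite_subset) simp
      then show ?thesis
        unfolding f_def carrier using 0 sever ext ab by (auto simp: sever_label_def)
    qed
    show "e \<otimes>\<^bsub>Cob n\<^esub> f a b w = f a b w" "f a b w \<otimes>\<^bsub>Cob n\<^esub> e = f a b w"
      unfolding f_def by (rule unit[OF sever ext])+
  next
    fix u v :: "nat list" assume "u \<noteq> []" "v \<noteq> []"
    then show "f a b u \<otimes>\<^bsub>Cob n\<^esub> f a b v = f a b (u @ v)"
      unfolding f_def mult sever_mult[OF n] by (auto simp: junctions_append fun_eq_iff)
  qed
  have f_ne: "f a b w \<noteq> e" for a b w
    using part_one_neq_sever[OF n] by (simp add: f_def e_def)
  note eq = filter_hom_eq[OF hold hom f_ne]
  show ?thesis
  proof (rule equi_adjacentI[where c = 0])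
    fix K
    show "filter K u = [] \<longleftrightarrow> filter K v = []"
      using eq(1)[of "\<lambda>_. 0" "\<lambda>_. 0" K] by simp
    assume ne: "filter K u \<noteq> []"
    have "f (\<lambda>z. of_bool (z = y)) (\<lambda>z. of_bool (z = x)) (filter K u) =
      f (\<lambda>z. of_bool (z = y)) (\<lambda>z. of_bool (z = x)) (filter K v)" for x y
      by (rule eq(2)[OF _ _ ne]) auto
    then have lab: "sever_label n (of_bool (hd (filter K u) = y)) (of_bool (last (filter K u) = x)) =
        sever_label n (of_bool (hd (filter K v) = y)) (of_bool (last (filter K v) = x))"
      and dead: "(\<lambda>i. int (junctions (\<lambda>p q. of_bool (p = x) + of_bool (q = y) + int n - 1 = i) (filter K u))) =
        (\<lambda>i. int (junctions (\<lambda>p q. of_bool (p = x) + of_bool (q = y) + int n - 1 = i) (filter K v)))" for x y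
      by (simp_all add: f_def)
    have "of_bool (hd (filter K u) = y) = (of_bool (hd (filter K v) = y) :: int)"
      "of_bool (last (filter K u) = x) = (of_bool (last (filter K v) = x) :: int)" for x y
      using sever_label_eqD[OF n lab] by blast+
    then show "hd (filter K u) = hd (filter K v) \<and> last (filter K u) = last (filter K v)"
      by (metis of_bool_eq_iff)
    fix x y :: nat
    have "(of_bool (p = x) + of_bool (q = y) + int n - 1 = int n + 1) \<longleftrightarrow> p = x \<and> q = y" for p q
      by auto
    then show "0 * (length (filter K u) - 1) + junctions (\<lambda>a b. a = x \<and> b = y) (filter K u) =
        0 * (length (filter K v) - 1) + junctions (\<lambda>a b. a = x \<and> b = y) (filter K v)"
      using fun_cong[OF dead, of x y "int n + 1"] by simp
  qed
qed


lemma part_one_neq_dangling: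
  assumes n: "2 \<le> n"
  shows "dangling n p q \<noteq> part_one n"
proof
  assume eq: "dangling n p q = part_one n"
  show False
  proof (cases p)
    case True
    then have "{Inl 2} \<in> part_one n" unfolding eq[symmetric] by (simp add: dangling_def)
    then obtain i where "{Inl 2} = {Inl i, Inr i :: vert}" by (auto simp: part_one_def)
    then have "Inr i \<in> {Inl 2 :: vert}" by simp
    then show False by simp
  next
    case False
    have "trunk n p q \<in> part_one n" unfolding eq[symmetric] by (simp add: dangling_def)
    then obtain i where i: "trunk n p q = {Inl i, Inr i}" by (auto simp: part_one_def)
    have "Inl 1 \<in> trunk n p q" "Inl 2 \<in> trunk n p q" using n False by simp_all
    then show False unfolding i by simp
  qed
qed

lemma dangling_eqD:
  assumes n: "2 \<le> n" and eq: "dangling n p q = dangling n p' q'"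
  shows "p = p'" "q = q'"
proof -
  have "{Inl 2} \<in> dangling n p q \<longleftrightarrow> p" "{Inr 2} \<in> dangling n p q \<longleftrightarrow> q" for p q
    using trunk_neq[OF n, of p q] by (auto simp: dangling_def)
  then show "p = p'" "q = q'" using eq by metis+
qed

lemma trunk_label_eqD:
  "trunk_label n p q g = trunk_label n p q g' \<Longrightarrow> g = g'"
  by (drule fun_cong[of _ _ "trunk n p q"]) (simp add: trunk_label_def dangling_def)

text \<open>
  All remaining letters are sent to dangling partitions, where \<open>x\<close> alone keeps its outgoing
  vertex \<open>2\<close> and \<open>y\<close> alone keeps its incoming one.  Each junction adds
  \<open>n - 2\<close> to the label of the trunk, and one more if \<open>y\<close> follows \<open>x\<close>.
\<close>

lemma equi_adjacent_if_holds_in_Cobo: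
  assumes n: "2 \<le> n" and hold: "holds_in (u, v) (Cobo n)"
  shows "equi_adjacent u v"
proof -
  define e :: "part \<times> label" where "e = (part_one n, zero_label (part_one n))"
  define f where "f p q w = (dangling n (p (hd w)) (q (last w)),
    trunk_label n (p (hd w)) (q (last w))
      (int ((n - 2) * (length w - 1) + junctions (\<lambda>a b. \<not> q a \<and> \<not> p b) w)))" for p q :: "nat \<Rightarrow> bool" and w
  have mult: "(\<alpha>, g) \<otimes>\<^bsub>Cobo n\<^esub> (\<beta>, h) = (part_mult n \<alpha> \<beta>, label_mult n \<alpha> g \<beta> h)" for \<alpha> g \<beta> h
    by (simp add: Cobo_def Cobo_bar_def)
  have carrier: "(\<alpha>, g) \<in> carrier (Cobo n) \<longleftrightarrow> \<alpha> \<in> parts n \<and> g \<in> \<alpha> \<rightarrow>\<^sub>E UNIV \<and> (\<forall>A\<in>\<alpha>. 0 \<le> g A)" for \<alpha> g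
    by (auto simp: Cobo_def Cobo_bar_def)
  have unit: "e \<otimes>\<^bsub>Cobo n\<^esub> (\<alpha>, g) = (\<alpha>, g)" "(\<alpha>, g) \<otimes>\<^bsub>Cobo n\<^esub> e = (\<alpha>, g)"
    if "\<alpha> \<in> parts n" "g \<in> \<alpha> \<rightarrow>\<^sub>E UNIV" for \<alpha> g
    unfolding e_def mult using that by (simp_all add: unit_left unit_right)
  note in_parts = dangling_in_parts[OF n]
  have ext: "trunk_label n p q g \<in> dangling n p q \<rightarrow>\<^sub>E UNIV" for p q g by (simp add: trunk_label_def)
  have hom: "(\<lambda>w. if filter K w = [] then e else f p q (filter K w)) \<in> hom free_semigroup (Cobo n)" for K p q
  proof (rule filter_hom)
    show "e \<in> carrier (Cobo n)"
      unfolding e_def carrier by (simp add: part_one_in_parts zero_label_def)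
    show "e \<otimes>\<^bsub>Cobo n\<^esub> e = e"
      using unit(1)[OF part_one_in_parts zero_label_ext] by (simp add: e_def)
    fix w :: "nat list"
    show "f p q w \<in> carrier (Cobo n)"
      unfolding f_def carrier using in_parts ext by (auto simp: trunk_label_def)
    show "e \<otimes>\<^bsub>Cobo n\<^esub> f p q w = f p q w" "f p q w \<otimes>\<^bsub>Cobo n\<^esub> e = f p q w"
      unfolding f_def by (rule unit[OF in_parts ext])+
  next
    fix u v :: "nat list" assume ne: "u \<noteq> []" "v \<noteq> []"
    then obtain k l where kl: "length u = Suc k" "length v = Suc l" by (cases u; cases v) auto
    have "(n - 2) * k + (n - 2) * l + (n - 2) = (n - 2) * Suc (k + l)"
      by (simp add: distrib_left)
    then have lengths: "int ((n - 2) * k) + int ((n - 2) * l) + int n - 2 = int ((n - 2) * Suc (k + l))"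
      using n by linarith
    have add: "int A + int B + int n - 2 = int C \<Longrightarrow>
        int (A + i) + int (B + j) + int n - 2 + (if b then 1 else 0) = int (C + (i + j + (if b then 1 else 0)))"
      for A B C i j b by simp
    have "length (u @ v) - 1 = Suc (k + l)" using kl by simp
    then have "int ((n - 2) * (length u - 1) + junctions Q u) + int ((n - 2) * (length v - 1) + junctions Q v)
        + int n - 2 + (if Q (last u) (hd v) then 1 else 0) =
      int ((n - 2) * (length (u @ v) - 1) + junctions Q (u @ v))" for Q
      unfolding junctions_append[OF ne] by (simp only: kl diff_Suc_1 add[OF lengths])
    note step = this[of "\<lambda>a b. \<not> q a \<and> \<not> p b"]
    have "(if q (last u) \<or> p (hd v) then 0 else 1) = (if \<not> q (last u) \<and> \<not> p (hd v) then 1 else (0 :: int))"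
      by simp
    then show "f p q u \<otimes>\<^bsub>Cobo n\<^esub> f p q v = f p q (u @ v)"
      unfolding f_def mult part_mult_dangling[OF n] label_mult_dangling[OF n]
      by (simp only: step) (simp add: ne)
  qed
  have f_ne: "f p q w \<noteq> e" for p q w
    using part_one_neq_dangling[OF n] by (simp add: f_def e_def)
  note eq = filter_hom_eq[OF hold hom f_ne]
  show ?thesis
  proof (rule equi_adjacentI[where c = "n - 2"])
    fix K
    show "filter K u = [] \<longleftrightarrow> filter K v = []" by (rule eq(1))
    assume ne: "filter K u \<noteq> []"
    have fe: "f (\<lambda>z. z \<noteq> y) (\<lambda>z. z \<noteq> x) (filter K u) = f (\<lambda>z. z \<noteq> y) (\<lambda>z. z \<noteq> x) (filter K v)" for x y
      by (rule eq(2)[OF ne])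
    then have "dangling n (hd (filter K u) \<noteq> y) (last (filter K u) \<noteq> x) =
        dangling n (hd (filter K v) \<noteq> y) (last (filter K v) \<noteq> x)" for x y
      by (simp add: f_def)
    from dangling_eqD[OF n this]
    show ends: "hd (filter K u) = hd (filter K v) \<and> last (filter K u) = last (filter K v)" by metis
    fix x y :: nat
    have "int ((n - 2) * (length (filter K u) - 1) + junctions (\<lambda>a b. a = x \<and> b = y) (filter K u)) =
        int ((n - 2) * (length (filter K v) - 1) + junctions (\<lambda>a b. a = x \<and> b = y) (filter K v))"
      using fe[of y x] ends by (auto simp: f_def dest!: trunk_label_eqD)
    then show "(n - 2) * (length (filter K u) - 1) + junctions (\<lambda>a b. a = x \<and> b = y) (filter K u) =
        (n - 2) * (length (filter K v) - 1) + junctions (\<lambda>a b. a = x \<and> b = y) (filter K v)"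
      by (simp only: of_nat_eq_iff)
  qed
qed

text \<open>
  All remaining letters are sent to dangling partitions, where \<open>x\<close> alone has its outgoing
  vertex \<open>2\<close> cut off and \<open>y\<close> alone its incoming one.  There is a dead block exactly where
  \<open>y\<close> follows \<open>x\<close>.
\<close>

lemma equi_adjacent_if_holds_in_Pd:
  assumes n: "2 \<le> n" and hold: "holds_in (u, v) (Pd n)"
  shows "equi_adjacent u v"
proof -
  define e :: "part \<times> int" where "e = (part_one n, 0)"
  define f where "f p q w = (dangling n (p (hd w)) (q (last w)), int (junctions (\<lambda>a b. q a \<and> p b) w))"
    for p q :: "nat \<Rightarrow> bool" and w
  have mult: "(\<alpha>, s) \<otimes>\<^bsub>Pd n\<^esub> (\<beta>, t) = (part_mult n \<alpha> \<beta>, s + t + int (card (dead_blocks n \<alpha> \<beta>)))" for \<alpha> s \<beta> t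
    by (simp add: Pd_def Pd_bar_def)
  have carrier: "(\<alpha>, s) \<in> carrier (Pd n) \<longleftrightarrow> \<alpha> \<in> parts n \<and> 0 \<le> s" for \<alpha> s
    by (auto simp: Pd_def Pd_bar_def)
  have unit: "e \<otimes>\<^bsub>Pd n\<^esub> (\<alpha>, s) = (\<alpha>, s)" "(\<alpha>, s) \<otimes>\<^bsub>Pd n\<^esub> e = (\<alpha>, s)" if "\<alpha> \<in> parts n" for \<alpha> s
    unfolding e_def mult using that by (simp_all add: unit_left unit_right)
  note in_parts = dangling_in_parts[OF n]
  have hom: "(\<lambda>w. if filter K w = [] then e else f p q (filter K w)) \<in> hom free_semigroup (Pd n)" for K p q
  proof (rule filter_hom)
    show "e \<in> carrier (Pd n)"
      unfolding e_def carrier by (simp add: part_one_in_parts)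
    show "e \<otimes>\<^bsub>Pd n\<^esub> e = e"
      using unit(1)[OF part_one_in_parts] by (simp add: e_def)
    fix w :: "nat list"
    show "f p q w \<in> carrier (Pd n)"
      unfolding f_def carrier using in_parts by simp
    show "e \<otimes>\<^bsub>Pd n\<^esub> f p q w = f p q w" "f p q w \<otimes>\<^bsub>Pd n\<^esub> e = f p q w"
      unfolding f_def by (rule unit[OF in_parts])+
  next
    fix u v :: "nat list" assume "u \<noteq> []" "v \<noteq> []"
    then show "f p q u \<otimes>\<^bsub>Pd n\<^esub> f p q v = f p q (u @ v)"
      unfolding f_def mult part_mult_dangling[OF n] dead_blocks_dangling[OF n]
      by (simp add: junctions_append)
  qed
  have f_ne: "f p q w \<noteq> e" for p q w
    using part_one_neq_dangling[OF n] by (simp add: f_def e_def)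
  note eq = filter_hom_eq[OF hold hom f_ne]
  show ?thesis
  proof (rule equi_adjacentI[where c = 0])
    fix K
    show "filter K u = [] \<longleftrightarrow> filter K v = []" by (rule eq(1))
    assume ne: "filter K u \<noteq> []"
    have fe: "f (\<lambda>z. z = y) (\<lambda>z. z = x) (filter K u) = f (\<lambda>z. z = y) (\<lambda>z. z = x) (filter K v)" for x y
      by (rule eq(2)[OF ne])
    then have "dangling n (hd (filter K u) = y) (last (filter K u) = x) =
        dangling n (hd (filter K v) = y) (last (filter K v) = x)" for x y
      by (simp add: f_def)
    from dangling_eqD[OF n this]
    show "hd (filter K u) = hd (filter K v) \<and> last (filter K u) = last (filter K v)" by metis
    fix x y :: nat
    show "0 * (length (filter K u) - 1) + junctions (\<lambda>a b. a = x \<and> b = y) (filter K u) =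
        0 * (length (filter K v) - 1) + junctions (\<lambda>a b. a = x \<and> b = y) (filter K v)"
      using fe[of y x] by (simp add: f_def)
  qed
qed

section \<open>Absence of finite bases\<close>

lemma holds_in_submagma:
  assumes "holds_in e T" "carrier S \<subseteq> carrier T" "mult S = mult T"
  shows "holds_in e S"
  using assms by (auto simp: holds_in_def hom_def Pi_def)

lemma not_finitely_based_over_parts:
  fixes S :: "(part \<times> 'a, 'm) monoid_scheme"
  assumes parts: "\<And>a. a \<in> carrier S \<Longrightarrow> fst a \<in> parts n"
    and morph: "\<And>a b. fst (a \<otimes>\<^bsub>S\<^esub> b) = part_mult n (fst a) (fst b)"
    and interchange: "\<And>\<alpha> a b c. \<lbrakk>\<alpha> \<in> parts n; part_mult n \<alpha> \<alpha> = \<alpha>; fst a = \<alpha>; fst b = \<alpha>; fst c = \<alpha>\<rbrakk> \<Longrightarrow>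
      a \<otimes>\<^bsub>S\<^esub> (b \<otimes>\<^bsub>S\<^esub> (a \<otimes>\<^bsub>S\<^esub> (c \<otimes>\<^bsub>S\<^esub> a))) = a \<otimes>\<^bsub>S\<^esub> (c \<otimes>\<^bsub>S\<^esub> (a \<otimes>\<^bsub>S\<^esub> (b \<otimes>\<^bsub>S\<^esub> a)))"
    and equi_adjacent: "\<And>u v. holds_in (u, v) S \<Longrightarrow> equi_adjacent u v"
  shows "\<not> finitely_based S"
proof (rule not_finitely_based[where \<pi> = fst and \<mu> = "part_mult n"])
  show "finite (fst ` carrier S)"
    using parts by (intro finite_subset[OF _ finite_parts[of n]]) blast
  show "a \<otimes>\<^bsub>S\<^esub> (b \<otimes>\<^bsub>S\<^esub> (a \<otimes>\<^bsub>S\<^esub> (c \<otimes>\<^bsub>S\<^esub> a))) = a \<otimes>\<^bsub>S\<^esub> (c \<otimes>\<^bsub>S\<^esub> (a \<otimes>\<^bsub>S\<^esub> (b \<otimes>\<^bsub>S\<^esub> a)))"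
    if "a \<in> carrier S" "fst b = fst a" "fst c = fst a" "part_mult n (fst a) (fst a) = fst a" for a b c
    by (rule interchange[OF parts[OF that(1)] that(4) refl that(2,3)])
qed (simp_all add: morph equi_adjacent)

lemma not_finitely_based_Cob:
  assumes n: "1 \<le> n"
  shows "\<not> finitely_based (Cob_bar n)" "\<not> finitely_based (Cob n)"
proof -
  have sub: "carrier (Cob n) \<subseteq> carrier (Cob_bar n)" and mult: "mult (Cob n) = mult (Cob_bar n)"
    by (auto simp: Cob_def)
  have parts: "fst a \<in> parts n" if "a \<in> carrier (Cob_bar n)" for a
    using that by (auto simp: Cob_bar_def)
  have morph: "fst (a \<otimes>\<^bsub>Cob_bar n\<^esub> b) = part_mult n (fst a) (fst b)" for a b
    by (auto simp: Cob_bar_def split: prod.splits)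
  show "\<not> finitely_based (Cob_bar n)"
    by (rule not_finitely_based_over_parts[OF parts morph Cob_bar_interchange
      equi_adjacent_if_holds_in_Cob[OF n holds_in_submagma[OF _ sub mult]]])
  show "\<not> finitely_based (Cob n)"
    by (rule not_finitely_based_over_parts[OF parts[OF subsetD[OF sub]] morph[folded mult]
      Cob_bar_interchange[where n = n, folded mult] equi_adjacent_if_holds_in_Cob[OF n]])
qed

lemma not_finitely_based_Cobo:
  assumes n: "2 \<le> n"
  shows "\<not> finitely_based (Cobo_bar n)" "\<not> finitely_based (Cobo n)"
proof -
  have sub: "carrier (Cobo n) \<subseteq> carrier (Cobo_bar n)" and mult: "mult (Cobo n) = mult (Cobo_bar n)"
    by (auto simp: Cobo_def)
  have parts: "fst a \<in> parts n" if "a \<in> carrier (Cobo_bar n)" for a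
    using that by (auto simp: Cobo_bar_def)
  have morph: "fst (a \<otimes>\<^bsub>Cobo_bar n\<^esub> b) = part_mult n (fst a) (fst b)" for a b
    by (auto simp: Cobo_bar_def split: prod.splits)
  show "\<not> finitely_based (Cobo_bar n)"
    by (rule not_finitely_based_over_parts[OF parts morph Cobo_bar_interchange
      equi_adjacent_if_holds_in_Cobo[OF n holds_in_submagma[OF _ sub mult]]])
  show "\<not> finitely_based (Cobo n)"
    by (rule not_finitely_based_over_parts[OF parts[OF subsetD[OF sub]] morph[folded mult]
      Cobo_bar_interchange[where n = n, folded mult] equi_adjacent_if_holds_in_Cobo[OF n]])
qed

lemma not_finitely_based_Pd:
  assumes n: "2 \<le> n"
  shows "\<not> finitely_based (Pd_bar n)" "\<not> finitely_based (Pd n)"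
proof -
  have sub: "carrier (Pd n) \<subseteq> carrier (Pd_bar n)" and mult: "mult (Pd n) = mult (Pd_bar n)"
    by (auto simp: Pd_def)
  have parts: "fst a \<in> parts n" if "a \<in> carrier (Pd_bar n)" for a
    using that by (auto simp: Pd_bar_def)
  have morph: "fst (a \<otimes>\<^bsub>Pd_bar n\<^esub> b) = part_mult n (fst a) (fst b)" for a b
    by (auto simp: Pd_bar_def split: prod.splits)
  show "\<not> finitely_based (Pd_bar n)"
    by (rule not_finitely_based_over_parts[OF parts morph _
      equi_adjacent_if_holds_in_Pd[OF n holds_in_submagma[OF _ sub mult]]])
      (assumption | rule Pd_bar_interchange)+
  show "\<not> finitely_based (Pd n)"
    by (rule not_finitely_based_over_parts[OF parts[OF subsetD[OF sub]] morph[folded mult]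
      _ equi_adjacent_if_holds_in_Pd[OF n]])
      (assumption | rule Pd_bar_interchange[where n = n, folded mult])+
qed

theorem theorem5p5:
  shows "(\<forall>n\<ge>1. \<not> finitely_based (Cob n) \<and> \<not> finitely_based (Cob_bar n)) \<and>
         (\<forall>n\<ge>2. \<not> finitely_based (Cobo n) \<and> \<not> finitely_based (Cobo_bar n)) \<and>
         (\<forall>n\<ge>2. \<not> finitely_based (Pd n) \<and> \<not> finitely_based (Pd_bar n))"
  using not_finitely_based_Cob not_finitely_based_Cobo not_finitely_based_Pd by simp

end
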